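(* Let $L$ be a (nonempty, unoriented) framed link in $S^3$ and let $\mathcal H^F_*(L)=(\mathcal H^F_0(L),\mathcal H^F_1(L))$ be its framed homology. Then the graded Euler characteristic of $\mathcal H^F_*(L)$ equals the unnormalized Kauffman bracket of $L$: $$\chi_A(\mathcal H^F_*(L))=(-A^{2}-A^{-2})\,\langle L\rangle .$$
   Context: Links are in $S^3$; a diagram is an unoriented planar link diagram and represents the framed link given by the blackboard framing. Equivalence of framed links is isotopy in $S^3$ respecting framings. Graded abelian groups are $\mathbb Z$-graded, morphisms have degree $0$, and $G\{l\}$ is the shift $(G\{l\})_j=G_{j-l}$. The graded dimension is $q\dim G=\sum_j A^j\operatorname{rk}G_j$. For a pair $(G_0,G_1)$ of finitely generated graded abelian groups (or a $2$-complex with these groups), $\chi_A=q\dim G_0-q\dim G_1\in\mathbb Z[A,A^{-1}]$. For $i\in\{0,1\}$ write $\underline i=1-i$. A $2$-complex of graded abelian groups is $(A_0,A_1,\partial_0,\partial_1)$ with $\partial_0:A_0\to A_1$, $\partial_1:A_1\to A_0$ degree-$0$ homomorphisms with $\partial_1\partial_0=0$ and $\partial_0\partial_1=0$. Its homology is $H_*(A)=(H_0(A),H_1(A))$ with $H_i(A)=\ker\partial_i/\operatorname{im}\partial_{\underline i}$. Let $W$ be the free graded abelian group with basis $w_+$ in degree $2$ and $w_-$ in degree $-2$. Define degree-$2$ maps $\bar m:W\otimes W\to W$, $w_-\otimes w_-\mapsto w_-$, $w_+\otimes w_-\mapsto w_+$, $w_-\otimes w_+\mapsto w_+$, $w_+\otimes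 w_+\mapsto 0$; and $\bar\Delta:W\to W\otimes W$, $w_-\mapsto w_+\otimes w_-+w_-\otimes w_+$, $w_+\mapsto w_+\otimes w_+$. A Kauffman state $s$ of $D$ marks each crossing with $A$ (or $0$) or $B$ (or $1$). Splitting each crossing according to its mark (the $A$-splitting joins the two regions swept by the overcrossing strand when rotated counterclockwise towards the undercrossing strand, the $B$-splitting joins the other two) gives a collection $D_s$ of $|s|$ disjoint circles. $a(s)$, $b(s)$ are the numbers of crossings marked $A$, $B$; $s_A$ is the state with all marks $A$. The Kauffman bracket of a nonempty diagram is $\langle D\rangle=\sum_s A^{a(s)-b(s)}(-A^2-A^{-2})^{|s|-1}$; it is an invariant of framed links, and $\langle L\rangle$ denotes $\langle D\rangle$ for any diagram $D$ of the framed link $L$. Put $W_s(D)=\big(\bigotimes_{\text{circles of }D_s}W\big)\{a(s)-b(s)\}$, and for $i\in\{0,1\}$ $$\langle\!\langle D\rangle\!\rangle_i=\bigoplus_{s:\ b(s)+|s_A|\in 2\mathbb Z+i}W_s(D).$$ An edge $\xi:s_0\to s_1$ is a pair of states differing at exactly one crossing, marked $A$ in $s_0$ and $B$ in $s_1$; $|\xi|=b(s_0)$. Passing from $D_{s_0}$ to $D_{s_1}$ either merges two circles into one or splits one circle into two; $\partial_\xi:W_{s_0}(D)\to W_{s_1}(D)$ (degree $0$ after the shifts) is $\bar m$, respectively $\bar\Delta$, on the factors of these circles and the identity on all other factors. Given an order of the crossings, $(-1)^\xi$ is $-1$ to the number of crossings marked $B$ in $s_0$ that precede the changing crossing. Set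 $\partial_i=\sum_{\xi:\ |\xi|+|s_A|\in 2\mathbb Z+i}(-1)^\xi\partial_\xi:\langle\!\langle D\rangle\!\rangle_i\to\langle\!\langle D\rangle\!\rangle_{\underline i}$ and $\langle\!\langle D\rangle\!\rangle=(\langle\!\langle D\rangle\!\rangle_0,\langle\!\langle D\rangle\!\rangle_1,\partial_0,\partial_1)$, a $2$-complex of graded abelian groups. For a framed link $L$, $\mathcal H^F_*(L)$ is the isomorphism class of the pair of graded abelian groups $H_*(\langle\!\langle D\rangle\!\rangle)$, where $D$ is any diagram of $L$ with any order of crossings (this does not depend on the choices). *)

theory Defs
  imports "HOL-Analysis.Analysis" "HOL-Algebra.Free_Abelian_Groups"
begin

section \<open>Framed links in the 3-sphere\<close>

text \<open>
  Three-space is \<^typ>\<open>complex \<times> real\<close>: the first component is the plane of the diagram (with its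
  usual orientation), the second one the height above that plane. The 3-sphere is the unit sphere of
  \<^typ>\<open>(complex \<times> real) \<times> real\<close>, and three-space is embedded into it by inverse stereographic
  projection.
\<close>

type_synonym space3 = "complex \<times> real"
type_synonym space4 = "space3 \<times> real"

definition S3 :: "space4 set"
  where "S3 = sphere 0 1"

definition inv_stereo :: "space3 \<Rightarrow> space4"
  where "inv_stereo x =
    ((2 / ((norm x)\<^sup>2 + 1)) *\<^sub>R x, ((norm x)\<^sup>2 - 1) / ((norm x)\<^sup>2 + 1))"

abbreviation velocity :: "(real \<Rightarrow> 'a::real_normed_vector) \<Rightarrow> real \<Rightarrow> 'a"
  where "velocity g t \<equiv> vector_derivative g (at t)"

text \<open>
  The component \<open>j < n\<close> is the closed curve \<open>g j\<close> of period 1, with the framing vector field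
  \<open>f j\<close>, a field tangent to the sphere and nowhere tangent to the link.
\<close>

definition framed_embedding ::
    "nat \<Rightarrow> (nat \<Rightarrow> real \<Rightarrow> space4) \<Rightarrow> (nat \<Rightarrow> real \<Rightarrow> space4) \<Rightarrow> bool"
  where "framed_embedding n g f \<longleftrightarrow>
    (\<forall>j<n.
        g j C1_differentiable_on UNIV \<and> continuous_on UNIV (f j) \<and>
        (\<forall>t. g j (t + 1) = g j t \<and> f j (t + 1) = f j t \<and>
             g j t \<in> S3 \<and> g j t \<bullet> f j t = 0 \<and>
             velocity (g j) t \<noteq> 0 \<and> f j t \<notin> span {velocity (g j) t})) \<and>
    inj_on (\<lambda>(j, t). g j t) ({..<n} \<times> {0..<1})"

text \<open>
  The unordered, unoriented, unparametrized framed link is the set of all pairs (point of the link,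
  framing vector at this point).
\<close>

definition framed_trace ::
    "nat \<Rightarrow> (nat \<Rightarrow> real \<Rightarrow> space4) \<Rightarrow> (nat \<Rightarrow> real \<Rightarrow> space4) \<Rightarrow> (space4 \<times> space4) set"
  where "framed_trace n g f = {(g j t, f j t) | j t. j < n}"

definition framed_link :: "(space4 \<times> space4) set \<Rightarrow> bool"
  where "framed_link L \<longleftrightarrow> (\<exists>n g f. framed_embedding n g f \<and> L = framed_trace n g f)"

definition framed_isotopic :: "(space4 \<times> space4) set \<Rightarrow> (space4 \<times> space4) set \<Rightarrow> bool"
  where "framed_isotopic L L' \<longleftrightarrow>
    (\<exists>n G F.
        (\<forall>u\<in>{0..1}. framed_embedding n (G u) (F u)) \<and>
        (\<forall>j<n. continuous_on ({0..1} \<times> UNIV) (\<lambda>(u, t). G u j t) \<and>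
               continuous_on ({0..1} \<times> UNIV) (\<lambda>(u, t). velocity (G u j) t) \<and>
               continuous_on ({0..1} \<times> UNIV) (\<lambda>(u, t). F u j t)) \<and>
        framed_trace n (G (0::real)) (F 0) = L \<and> framed_trace n (G 1) (F 1) = L')"


section \<open>Link diagrams\<close>

text \<open>
  Planar diagrams are encoded by unoriented PD codes. Every crossing \<open>c\<close> has four ends, numbered
  0, 1, 2, 3 counterclockwise such that 0 and 2 are the ends of the undercrossing strand and 1 and 3
  those of the overcrossing strand; \<open>ends D c k\<close> is the arc of the diagram that leaves \<open>c\<close> at the end
  \<open>k\<close>. An arc without any end is a simple closed curve without crossings.
\<close>

record diagram =
  crossings :: "nat set"
  arcs :: "nat set"
  ends :: "nat \<Rightarrow> nat \<Rightarrow> nat"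

definition crossing_ends :: "diagram \<Rightarrow> (nat \<times> nat) set"
  where "crossing_ends D = crossings D \<times> {..<4}"

definition PD_code :: "diagram \<Rightarrow> bool"
  where "PD_code D \<longleftrightarrow> finite (crossings D) \<and> finite (arcs D) \<and>
    (\<forall>(c, k)\<in>crossing_ends D. ends D c k \<in> arcs D) \<and>
    (\<forall>a\<in>arcs D. card {(c, k)\<in>crossing_ends D. ends D c k = a} \<in> {0, 2})"

definition generated_equiv :: "('a \<times> 'a) set \<Rightarrow> ('a \<times> 'a) set"
  where "generated_equiv R = (R \<union> R\<inverse>)\<^sup>*"

definition graph_components :: "diagram \<Rightarrow> nat set set"
  where "graph_components D = crossings D //
    generated_equiv {(c, c') | c c' k k'. (c, k) \<in> crossing_ends D \<and> (c', k') \<in> crossing_ends D \<and>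
      ends D c k = ends D c' k'}"

text \<open>
  The pair \<open>(c, k)\<close> also stands for the corner at \<open>c\<close> between the ends \<open>k\<close> and \<open>k + 1\<close>. If
  \<open>(c, k)\<close> and \<open>(c', k')\<close> are the two ends of an arc, then one and the same side of the arc is
  counterclockwise from the end \<open>k\<close> at \<open>c\<close> and clockwise from the end \<open>k'\<close> at \<open>c'\<close>. The classes of
  corners generated in this way are the faces of the 4-valent map.
\<close>

definition faces :: "diagram \<Rightarrow> (nat \<times> nat) set set"
  where "faces D = crossing_ends D //
    generated_equiv {((c, k), (c', (k' + 3) mod 4)) | c k c' k'.
      (c, k) \<in> crossing_ends D \<and> (c', k') \<in> crossing_ends D \<and> (c, k) \<noteq> (c', k') \<and>
      ends D c k = ends D c' k'}"

text \<open>
  Planarity: every connected component of the 4-valent map satisfies Euler's formula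
  \<open>V - E + F = 2\<close>. Faces are counted here separately for each component, and Euler
  characteristics of closed surfaces are at most 2, so it suffices to require the sum of the
  formulas.
\<close>

definition planar_diagram :: "diagram \<Rightarrow> bool"
  where "planar_diagram D \<longleftrightarrow> PD_code D \<and>
    int (card (crossings D)) - int (card ((\<lambda>(c, k). ends D c k) ` crossing_ends D))
      + int (card (faces D)) = 2 * int (card (graph_components D))"

text \<open>
  The closed space curves \<open>g j\<close>, \<open>j < n\<close>, project regularly onto the plane with diagram \<open>D\<close>. The
  under- and overcrossing at \<open>c\<close> take place at the parameters \<open>un c\<close> and \<open>ov c\<close>, each of them a
  component and a time; \<open>eu c\<close> and \<open>eo c\<close> say whether the ends 0 and 1 lead in the direction
  of the parametrization or against it. The arcs of \<open>D\<close> correspond to the connected components of the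
  projection without the crossing points.
\<close>

definition plane_curve :: "(nat \<Rightarrow> real \<Rightarrow> space3) \<Rightarrow> nat \<Rightarrow> real \<Rightarrow> complex"
  where "plane_curve g j t = fst (g j t)"

definition has_diagram :: "nat \<Rightarrow> (nat \<Rightarrow> real \<Rightarrow> space3) \<Rightarrow> diagram \<Rightarrow> bool"
  where "has_diagram n g D \<longleftrightarrow>
    (\<forall>j<n. g j C1_differentiable_on UNIV \<and>
       (\<forall>t. g j (t + 1) = g j t \<and> velocity (plane_curve g j) t \<noteq> 0)) \<and>
    (\<exists>(un :: nat \<Rightarrow> nat \<times> real) (ov :: nat \<Rightarrow> nat \<times> real) (eu :: nat \<Rightarrow> real) (eo :: nat \<Rightarrow> real)
      (\<alpha> :: nat \<Rightarrow> complex set).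
      let params = {..<n} \<times> {0..<1};
          pt = (\<lambda>(j, t). plane_curve g j t);
          height = (\<lambda>(j, t). snd (g j t));
          tangent = (\<lambda>(j, t). velocity (plane_curve g j) t);
          leaves = (\<lambda>(j, t) e a. \<forall>\<^sub>F \<tau> in at_right 0. plane_curve g j (t + e * \<tau>) \<in> \<alpha> a)
      in
        un ` crossings D \<subseteq> params \<and> ov ` crossings D \<subseteq> params \<and>
        (\<forall>x\<in>params. \<forall>y\<in>params. x \<noteq> y \<longrightarrow>
           (pt x = pt y \<longleftrightarrow> (\<exists>c\<in>crossings D. {x, y} = {un c, ov c}))) \<and>
        inj_on (\<lambda>c. pt (un c)) (crossings D) \<and>
        bij_betw \<alpha> (arcs D) (components (pt ` params - (\<lambda>c. pt (un c)) ` crossings D)) \<and>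
        (\<forall>c\<in>crossings D.
           eu c \<in> {1, -1} \<and> eo c \<in> {1, -1} \<and>
           pt (un c) = pt (ov c) \<and> height (un c) < height (ov c) \<and>
           0 < Im (cnj (eu c *\<^sub>R tangent (un c)) * (eo c *\<^sub>R tangent (ov c))) \<and>
           leaves (un c) (eu c) (ends D c 0) \<and> leaves (ov c) (eo c) (ends D c 1) \<and>
           leaves (un c) (- eu c) (ends D c 2) \<and> leaves (ov c) (- eo c) (ends D c 3)))"

text \<open>
  The blackboard framing is the normal field of the projected curve in the plane, considered as a
  horizontal vector field in space and transported to the sphere.
\<close>

definition blackboard :: "nat \<Rightarrow> (nat \<Rightarrow> real \<Rightarrow> space3) \<Rightarrow> (space4 \<times> space4) set"
  where "blackboard n g =
    framed_trace n (\<lambda>j t. inv_stereo (g j t))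
      (\<lambda>j t. frechet_derivative inv_stereo (at (g j t)) (\<i> * velocity (plane_curve g j) t, 0))"

definition diagram_of :: "diagram \<Rightarrow> (space4 \<times> space4) set \<Rightarrow> bool"
  where "diagram_of D L \<longleftrightarrow> planar_diagram D \<and>
    (\<exists>n g. has_diagram n g D \<and> framed_isotopic L (blackboard n g))"


section \<open>Kauffman states and the Kauffman bracket\<close>

text \<open>
  A state is represented by the set of the crossings that it marks with \<open>B\<close>. The two regions swept by
  the overcrossing strand (ends 1 and 3) when rotated counterclockwise are the corners between the
  ends 1 and 2 and between the ends 3 and 0. Joining them connects the end 0 with 1 and 2 with 3.
\<close>

definition states :: "diagram \<Rightarrow> nat set set"
  where "states D = Pow (crossings D)"

definition num_A :: "diagram \<Rightarrow> nat set \<Rightarrow> int"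
  where "num_A D s = int (card (crossings D - s))"

definition num_B :: "nat set \<Rightarrow> int"
  where "num_B s = int (card s)"

definition splitting :: "diagram \<Rightarrow> nat set \<Rightarrow> (nat \<times> nat) set"
  where "splitting D s =
    (\<Union>c\<in>crossings D - s. {(ends D c 0, ends D c 1), (ends D c 2, ends D c 3)}) \<union>
    (\<Union>c\<in>s. {(ends D c 1, ends D c 2), (ends D c 3, ends D c 0)})"

text \<open>A circle of a state is represented by the set of the arcs of the diagram that it runs through.\<close>

definition circles :: "diagram \<Rightarrow> nat set \<Rightarrow> nat set set"
  where "circles D s = arcs D // generated_equiv (splitting D s)"

definition circle_through :: "diagram \<Rightarrow> nat set \<Rightarrow> nat \<Rightarrow> nat set"
  where "circle_through D s a = generated_equiv (splitting D s) `` {a}"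

text \<open>
  Integer Laurent polynomials in \<open>A\<close>: finitely supported functions on the exponents, with the
  convolution product of the library.
\<close>

type_synonym laurent = "int \<Rightarrow>\<^sub>0 int"

definition A_pow :: "int \<Rightarrow> laurent"
  where "A_pow k = Poly_Mapping.single k 1"

definition kauffman_bracket :: "diagram \<Rightarrow> laurent"
  where "kauffman_bracket D =
    (\<Sum>s\<in>states D. A_pow (num_A D s - num_B s) *
      (- A_pow 2 - A_pow (-2)) ^ (card (circles D s) - 1))"


section \<open>Graded abelian groups and 2-complexes\<close>

text \<open>
  A graded abelian group is the family of its homogeneous parts; a pair of them is indexed by the
  numbers 0 and 1.
\<close>

type_synonym 'a graded_pair = "nat \<Rightarrow> int \<Rightarrow> 'a monoid"

definition Z_independent :: "'a monoid \<Rightarrow> 'a set \<Rightarrow> bool"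
  where "Z_independent G S \<longleftrightarrow> finite S \<and> S \<subseteq> carrier G \<and>
    (\<forall>c :: 'a \<Rightarrow> int. (\<Otimes>\<^bsub>G\<^esub>x\<in>S. x [^]\<^bsub>G\<^esub> c x) = \<one>\<^bsub>G\<^esub> \<longrightarrow> (\<forall>x\<in>S. c x = 0))"

text \<open>For groups of finite rank; the supremum of an unbounded set of numbers is unspecified.\<close>

definition group_rank :: "'a monoid \<Rightarrow> nat"
  where "group_rank G = Sup {card S | S. Z_independent G S}"

text \<open>For finitely generated graded groups, so that the sum is finite.\<close>

definition qdim :: "(int \<Rightarrow> 'a monoid) \<Rightarrow> laurent"
  where "qdim G = (\<Sum>j | group_rank (G j) \<noteq> 0. of_nat (group_rank (G j)) * A_pow j)"

definition euler_char :: "'a graded_pair \<Rightarrow> laurent"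
  where "euler_char G = qdim (G 0) - qdim (G 1)"

text \<open>
  The data of a 2-complex: \<open>bdry C i j\<close> is the homogeneous part in degree \<open>j\<close> of the boundary map
  from \<open>chains C i\<close> to \<open>chains C (1 - i)\<close>, for \<open>i\<close> in \<open>{0, 1}\<close>.
\<close>

record 'a two_complex =
  chains :: "'a graded_pair"
  bdry :: "nat \<Rightarrow> int \<Rightarrow> 'a \<Rightarrow> 'a"

definition homology :: "'a two_complex \<Rightarrow> 'a set graded_pair"
  where "homology C i j =
    subgroup_generated (chains C i j) (kernel (chains C i j) (chains C (1 - i) j) (bdry C i j))
      Mod (bdry C (1 - i) j ` carrier (chains C (1 - i) j))"


section \<open>The 2-complex of a diagram\<close>

text \<open>
  The basis elements \<open>w\<^sub>+\<close> and \<open>w\<^sub>-\<close> of \<open>W\<close>. A tensor power of \<open>W\<close> is the free abelian group on the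
  labellings of the tensor factors by basis elements of \<open>W\<close>.
\<close>

datatype w_basis = Wp | Wm

fun w_deg :: "w_basis \<Rightarrow> int" where
  "w_deg Wp = 2"
| "w_deg Wm = -2"

fun m_bar :: "w_basis \<Rightarrow> w_basis \<Rightarrow> (w_basis \<Rightarrow>\<^sub>0 int)" where
  "m_bar Wm Wm = frag_of Wm"
| "m_bar Wp Wm = frag_of Wp"
| "m_bar Wm Wp = frag_of Wp"
| "m_bar Wp Wp = 0"

fun Delta_bar :: "w_basis \<Rightarrow> (w_basis \<times> w_basis \<Rightarrow>\<^sub>0 int)" where
  "Delta_bar Wm = frag_of (Wp, Wm) + frag_of (Wm, Wp)"
| "Delta_bar Wp = frag_of (Wp, Wp)"

text \<open>
  A state together with a labelling of its circles is a basis element of the direct sum of the groups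
  \<open>W_s(D)\<close>; its degree takes the shift by \<open>a(s) - b(s)\<close> into account.
\<close>

type_synonym enhanced_state = "nat set \<times> (nat set \<Rightarrow> w_basis)"

definition enhanced_states :: "diagram \<Rightarrow> enhanced_state set"
  where "enhanced_states D = (SIGMA s : states D. circles D s \<rightarrow>\<^sub>E UNIV)"

fun state_deg :: "diagram \<Rightarrow> enhanced_state \<Rightarrow> int" where
  "state_deg D (s, v) = (\<Sum>C\<in>circles D s. w_deg (v C)) + num_A D s - num_B s"

definition bracket_basis :: "diagram \<Rightarrow> nat \<Rightarrow> int \<Rightarrow> enhanced_state set"
  where "bracket_basis D i j = {(s, v) \<in> enhanced_states D.
    (card s + card (circles D {})) mod 2 = i \<and> state_deg D (s, v) = j}"

text \<open>
  The edge that changes the mark of \<open>c\<close> from \<open>A\<close> to \<open>B\<close>. In \<open>s\<close> the two strands at \<open>c\<close> are those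
  of the ends 0, 1 and of the ends 2, 3; in the target they are those of the ends 3, 0 and
  of the ends 1, 2. So the circles involved are on both sides those through the ends 0 and 2.
  Two circles are merged iff these are different in \<open>s\<close>; otherwise one circle is split. All
  other circles are, as sets of arcs, the same in \<open>s\<close> and in the target.
\<close>

definition edge_map :: "diagram \<Rightarrow> nat \<Rightarrow> enhanced_state \<Rightarrow> (enhanced_state \<Rightarrow>\<^sub>0 int)"
  where "edge_map D c = (\<lambda>(s, v).
    let s' = insert c s;
        C0 = circle_through D s (ends D c 0);
        C2 = circle_through D s (ends D c 2);
        C0' = circle_through D s' (ends D c 0);
        C2' = circle_through D s' (ends D c 2)
    in if C0 \<noteq> C2
       then frag_extend (\<lambda>x. frag_of (s', restrict (v(C0' := x)) (circles D s')))
              (m_bar (v C0) (v C2))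
       else frag_extend (\<lambda>(x, y). frag_of (s', restrict (v(C0' := x, C2' := y)) (circles D s')))
              (Delta_bar (v C0)))"

text \<open>The order of the crossings is given by a reflexive linear order \<open>r\<close>.\<close>

definition edge_sign :: "(nat \<times> nat) set \<Rightarrow> nat set \<Rightarrow> nat \<Rightarrow> int"
  where "edge_sign r s c = (-1) ^ card {d \<in> s. d \<noteq> c \<and> (d, c) \<in> r}"

definition bracket_bdry ::
    "diagram \<Rightarrow> (nat \<times> nat) set \<Rightarrow> nat \<Rightarrow> (enhanced_state \<Rightarrow>\<^sub>0 int) \<Rightarrow> (enhanced_state \<Rightarrow>\<^sub>0 int)"
  where "bracket_bdry D r i = frag_extend (\<lambda>(s, v).
    \<Sum>c | c \<in> crossings D - s \<and> (card s + card (circles D {})) mod 2 = i.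
      frag_cmul (edge_sign r s c) (edge_map D c (s, v)))"

definition bracket_complex ::
    "diagram \<Rightarrow> (nat \<times> nat) set \<Rightarrow> (enhanced_state \<Rightarrow>\<^sub>0 int) two_complex"
  where "bracket_complex D r =
    \<lparr>chains = (\<lambda>i j. free_Abelian_group (bracket_basis D i j)),
     bdry = (\<lambda>i j. bracket_bdry D r i)\<rparr>"

text \<open>The isomorphism class of the homology of the 2-complex of \<open>D\<close>.\<close>

definition framed_homology :: "diagram \<Rightarrow> (nat \<times> nat) set \<Rightarrow> 'a graded_pair set"
  where "framed_homology D r = {H. \<forall>i<2. \<forall>j.
    comm_group (H i j) \<and> homology (bracket_complex D r) i j \<cong> H i j}"

end

theory Submission
  imports Defs "HOL-Combinatorics.Transposition"
begin

text \<open>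
  Two facts about the bracket complex have to be supplied: its boundary maps preserve degrees and
  square to zero, so that the Euler characteristic can be read off the chain groups, where it is a
  state sum.

  Both rest on planarity: changing the mark of one crossing always changes the number of circles by
  one. For this, the bipartite double cover of the 4-valent map has Euler characteristic at least
  twice that of the map, so by the genus inequality it has twice as many components. Hence the
  crossing ends can be coloured such that the colours alternate around every crossing and along
  every arc, which orients the circles of all states at once. They become the cycles of a permutation
  of the arcs, and a change of mark multiplies this permutation by a transposition.

  Squares of edges commute because \<open>W_s\<close> is the ring generated by the arcs with \<open>a\<^sup>2 = 0\<close> for every arc
  and \<open>a = b\<close> for arcs on a common circle, with \<open>w\<^sub>-\<close> the unit: a merge is the quotient map
  and a split is the multiplication of a lift by the sum of the two arcs at the crossing.
\<close>

section \<open>Generated equivalence relations and cycles of permutations\<close>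

text \<open>Planarity is available only as Euler's formula, without curves in a plane. On a map of
  positive genus a change of mark may keep the number of circles, and then neither
  \<open>m_bar\<close> nor \<open>Delta_bar\<close> fits the edge. This case has to be excluded by
  counting alone. The genus inequality bounds the number of components of the double cover from
  below; connectivity of the base bounds it from above, so the count is sharp. One colouring serves
  all states because both splittings of a crossing join ends of opposite colour.

  The same fact yields the sign in the result: each change of mark alters the number of circles by
  one, so b(s) + |s_A| and |s| have the same parity, and the sign of a chain group turns (A^2 +
  A^-2)^|s| into (-A^2 - A^-2)^|s|.

  Since \<open>group_rank\<close> is defined by independent sets in arbitrary groups, ranks are
  computed by comparison with dimensions of rational spans.\<close>

lemma equiv_generated_equiv: "equiv UNIV (generated_equiv R)"
  unfolding generated_equiv_def
  by (intro equivI) (auto simp: refl_on_def sym_rtrancl sym_Un_converse trans_rtrancl)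

lemma generated_equiv_sym: "(x, y) \<in> generated_equiv R \<Longrightarrow> (y, x) \<in> generated_equiv R"
  by (meson equiv_generated_equiv equivE symE)

lemma generated_equiv_trans:
  "(x, y) \<in> generated_equiv R \<Longrightarrow> (y, z) \<in> generated_equiv R \<Longrightarrow> (x, z) \<in> generated_equiv R"
  by (meson equiv_generated_equiv equivE transE)

lemma generated_equiv_refl [simp]: "(x, x) \<in> generated_equiv R"
  by (simp add: generated_equiv_def)

lemma generated_equiv_base: "(x, y) \<in> R \<Longrightarrow> (x, y) \<in> generated_equiv R"
  by (auto simp: generated_equiv_def)

lemma subset_generated_equiv: "R \<subseteq> generated_equiv R"
  by (auto simp: generated_equiv_def)

lemma Un_converse_subset_generated_equiv: "R \<union> R\<inverse> \<subseteq> generated_equiv R"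
  by (auto simp: generated_equiv_def)

lemma generated_equiv_least:
  assumes "equiv UNIV E" "R \<subseteq> E"
  shows "generated_equiv R \<subseteq> E"
proof -
  have "R \<union> R\<inverse> \<subseteq> E" using assms by (auto dest: equivE symD)
  moreover have "E\<^sup>* \<subseteq> E"
  proof
    fix z assume "z \<in> E\<^sup>*"
    then show "z \<in> E"
      using rtrancl_induct[of "fst z" "snd z" E "\<lambda>w. (fst z, w) \<in> E"] assms(1)
      by (cases z) (auto elim!: equivE dest: refl_onD transD)
  qed
  ultimately show ?thesis
    unfolding generated_equiv_def by (meson rtrancl_mono subset_trans)
qed

lemma generated_equiv_mono: "R \<subseteq> generated_equiv S \<Longrightarrow> generated_equiv R \<subseteq> generated_equiv S"
  by (rule generated_equiv_least[OF equiv_generated_equiv])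

lemma generated_equiv_subset: "R \<subseteq> S \<Longrightarrow> generated_equiv R \<subseteq> generated_equiv S"
  by (rule generated_equiv_mono) (auto intro: generated_equiv_base)

lemma generated_equiv_induct:
  assumes "(x, y) \<in> generated_equiv R"
    and "P x"
    and "\<And>u v. (u, v) \<in> R \<Longrightarrow> P u \<longleftrightarrow> P v"
  shows "P y"
  using assms(1) unfolding generated_equiv_def
  by (induction rule: rtrancl_induct) (use assms in auto)

lemma generated_equiv_invariant:
  assumes "(x, y) \<in> generated_equiv R" and "\<And>u v. (u, v) \<in> R \<Longrightarrow> f u = f v"
  shows "f x = f y"
  using generated_equiv_induct[OF assms(1), of "\<lambda>z. f x = f z"] assms(2) by auto

text \<open>The relation with the two classes of \<open>x\<close> and \<open>y\<close> united. A
  merge of circles is this passage from \<open>E\<close> to \<open>E'\<close>, a split the same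
  passage read backwards, so one notion serves both types of edges.\<close>

definition joined :: "'a \<Rightarrow> 'a \<Rightarrow> ('a \<times> 'a) set \<Rightarrow> ('a \<times> 'a) set \<Rightarrow> bool" where
  "joined x y E E' \<longleftrightarrow> (x, y) \<notin> E \<and>
    (\<forall>u v. (u, v) \<in> E' \<longleftrightarrow>
      (u, v) \<in> E \<or> (u, x) \<in> E \<and> (y, v) \<in> E \<or> (u, y) \<in> E \<and> (x, v) \<in> E)"

text \<open>A chain that uses the new pair several times can be shortened to one with at most one
  use, so these three cases exhaust the possibilities.\<close>

lemma generated_equiv_insert:
  "(u, v) \<in> generated_equiv (insert (a, b) R) \<longleftrightarrow>
     (u, v) \<in> generated_equiv R \<or>
     (u, a) \<in> generated_equiv R \<and> (b, v) \<in> generated_equiv R \<or>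
     (u, b) \<in> generated_equiv R \<and> (a, v) \<in> generated_equiv R"
  (is "?L \<longleftrightarrow> ?P v")
proof
  assume ?L
  then show "?P v"
  proof (rule generated_equiv_induct)
    fix x y assume "(x, y) \<in> insert (a, b) R"
    then consider "x = a" "y = b" | "(x, y) \<in> generated_equiv R"
      by (auto intro: generated_equiv_base)
    then show "?P x \<longleftrightarrow> ?P y"
      by cases (use generated_equiv_trans[of _ _ R] generated_equiv_sym[of _ _ R]
          generated_equiv_refl[of _ R] in metis)+
  qed auto
next
  let ?G = "generated_equiv (insert (a, b) R)"
  have sub: "(x, y) \<in> ?G" if "(x, y) \<in> generated_equiv R" for x y
    using that generated_equiv_subset[OF subset_insertI] by blast
  have ab: "(a, b) \<in> ?G" by (auto intro: generated_equiv_base)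
  assume "?P v"
  then consider "(u, v) \<in> generated_equiv R"
    | "(u, a) \<in> generated_equiv R" "(b, v) \<in> generated_equiv R"
    | "(u, b) \<in> generated_equiv R" "(a, v) \<in> generated_equiv R" by blast
  then show ?L
  proof cases
    case 1
    then show ?thesis by (rule sub)
  next
    case 2
    show ?thesis by (rule generated_equiv_trans[OF generated_equiv_trans[OF sub[OF 2(1)] ab] sub[OF 2(2)]])
  next
    case 3
    show ?thesis
      by (rule generated_equiv_trans[OF generated_equiv_trans[OF sub[OF 3(1)] generated_equiv_sym[OF ab]] sub[OF 3(2)]])
  qed
qed

lemma generated_equiv_insert_absorb:
  "(a, b) \<in> generated_equiv R \<Longrightarrow> generated_equiv (insert (a, b) R) = generated_equiv R"
  by (intro equalityI generated_equiv_mono) (auto intro: generated_equiv_base)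

lemma joined_insert:
  "(a, b) \<notin> generated_equiv R \<Longrightarrow>
    joined a b (generated_equiv R) (generated_equiv (insert (a, b) R))"
  unfolding joined_def by (auto simp: generated_equiv_insert)

lemma generated_equiv_closed:
  assumes "R \<subseteq> B \<times> B" "x \<in> B"
  shows "generated_equiv R `` {x} \<subseteq> B"
proof
  fix y assume "y \<in> generated_equiv R `` {x}"
  then have "(x, y) \<in> generated_equiv R" by simp
  then show "y \<in> B"
    by (rule generated_equiv_induct) (use assms in auto)
qed

lemma joined_class:
  assumes "equiv UNIV E" "joined x y E E'"
  shows "E' `` {u} = (if (u, x) \<in> E \<or> (u, y) \<in> E then E `` {x} \<union> E `` {y} else E `` {u})"
proof -
  have eqc: "(u, v) \<in> E \<longleftrightarrow> (w, v) \<in> E" if "(u, w) \<in> E" for u v w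
    using that assms(1) by (meson equivE symD transD)
  have j: "(u, v) \<in> E' \<longleftrightarrow>
      (u, v) \<in> E \<or> (u, x) \<in> E \<and> (y, v) \<in> E \<or> (u, y) \<in> E \<and> (x, v) \<in> E" for v
    using assms(2) by (simp add: joined_def)
  have ne: "(x, y) \<notin> E" using assms(2) by (simp add: joined_def)
  consider "(u, x) \<in> E" "(u, y) \<notin> E" | "(u, y) \<in> E" "(u, x) \<notin> E" | "(u, x) \<notin> E" "(u, y) \<notin> E"
    using ne eqc[of u x y] by blast
  then show ?thesis
  proof cases
    case 1
    then have "(u, v) \<in> E' \<longleftrightarrow> (x, v) \<in> E \<or> (y, v) \<in> E" for v
      unfolding j using eqc[OF 1(1), of v] by blast
    then show ?thesis using 1 by auto
  next
    case 2
    then have "(u, v) \<in> E' \<longleftrightarrow> (x, v) \<in> E \<or> (y, v) \<in> E" for v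
      unfolding j using eqc[OF 2(1), of v] by blast
    then show ?thesis using 2 by auto
  next
    case 3
    then have "(u, v) \<in> E' \<longleftrightarrow> (u, v) \<in> E" for v
      unfolding j by blast
    then show ?thesis using 3 by auto
  qed
qed

lemma joined_quotient:
  assumes "equiv UNIV E" "joined x y E E'" "x \<in> B" "y \<in> B"
  shows "B // E' = insert (E `` {x} \<union> E `` {y}) (B // E - {E `` {x}, E `` {y}})"
proof -
  have *: "E `` {u} = E `` {x} \<longleftrightarrow> (u, x) \<in> E" for u x
    by (meson assms(1) UNIV_I eq_equiv_class_iff)
  have c: "E' `` {u} = (if (u, x) \<in> E \<or> (u, y) \<in> E then E `` {x} \<union> E `` {y} else E `` {u})" for u
    by (rule joined_class[OF assms(1,2)])
  have r: "(x, x) \<in> E" using assms(1) by (auto elim: equivE dest: refl_onD)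
  have "B // E' = (\<lambda>u. E' `` {u}) ` B" "B // E = (\<lambda>u. E `` {u}) ` B"
    by (auto simp: quotient_def)
  moreover have "(\<lambda>u. E' `` {u}) ` B =
      insert (E `` {x} \<union> E `` {y}) ((\<lambda>u. E `` {u}) ` {u \<in> B. (u, x) \<notin> E \<and> (u, y) \<notin> E})"
    using assms(3,4) r unfolding c by (auto simp: image_iff)
  moreover have "(\<lambda>u. E `` {u}) ` {u \<in> B. (u, x) \<notin> E \<and> (u, y) \<notin> E} =
      (\<lambda>u. E `` {u}) ` B - {E `` {x}, E `` {y}}"
    unfolding *[symmetric] by blast
  ultimately show ?thesis by simp
qed

text \<open>Two classes disappear and one appears; their union is not an old class, since
  \<open>x\<close> and \<open>y\<close> were unrelated.\<close>

lemma joined_card_quotient: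
  assumes "equiv UNIV E" "joined x y E E'" "x \<in> B" "y \<in> B" "finite B"
  shows "card (B // E) = Suc (card (B // E'))"
proof -
  have fin: "finite (B // E)" using assms(5) by (simp add: quotient_def)
  have *: "E `` {u} = E `` {x} \<longleftrightarrow> (u, x) \<in> E" for u x
    by (meson assms(1) UNIV_I eq_equiv_class_iff)
  have r: "(u, u) \<in> E" for u using assms(1) by (auto elim: equivE dest: refl_onD)
  have ne: "E `` {x} \<noteq> E `` {y}" using assms(2) by (simp add: * joined_def)
  have new: "E `` {x} \<union> E `` {y} \<notin> B // E"
  proof
    assume "E `` {x} \<union> E `` {y} \<in> B // E"
    then obtain u where u: "E `` {x} \<union> E `` {y} = E `` {u}" by (auto simp: quotient_def)
    then have "(u, x) \<in> E" "(u, y) \<in> E" using r by blast+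
    then show False using ne by (metis *)
  qed
  have "{E `` {x}, E `` {y}} \<subseteq> B // E" using assms(3,4) by (auto simp: quotient_def)
  then have "card (B // E - {E `` {x}, E `` {y}}) = card (B // E) - 2"
    and "card (B // E) \<ge> 2"
    using fin ne card_Diff_subset[of "{E `` {x}, E `` {y}}" "B // E"] card_mono[of "B // E" "{E `` {x}, E `` {y}}"]
    by auto
  then show ?thesis
    unfolding joined_quotient[OF assms(1-4)] using fin new by simp
qed

text \<open>A function that is constant along the generators is constant on classes. Lower bounds
  for the numbers of faces and vertices of the double cover come from here.\<close>

lemma card_quotient_ge_image:
  assumes "finite B" and "\<And>u v. (u, v) \<in> R \<Longrightarrow> f u = f v"
  shows "card (f ` B) \<le> card (B // generated_equiv R)"
proof -
  have "f ` B \<subseteq> (\<lambda>X. f (SOME x. x \<in> X)) ` (B // generated_equiv R)"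
  proof
    fix z assume "z \<in> f ` B"
    then obtain b where b: "b \<in> B" "z = f b" by auto
    have "(SOME x. x \<in> generated_equiv R `` {b}) \<in> generated_equiv R `` {b}"
      by (rule someI[of _ b]) simp
    then have "f b = f (SOME x. x \<in> generated_equiv R `` {b})"
      using generated_equiv_invariant[of b _ R f] assms(2) by blast
    then show "z \<in> (\<lambda>X. f (SOME x. x \<in> X)) ` (B // generated_equiv R)"
      using b by (intro image_eqI[of _ _ "generated_equiv R `` {b}"]) (auto simp: quotient_def)
  qed
  moreover have "finite (B // generated_equiv R)" using assms(1) by (simp add: quotient_def)
  ultimately show ?thesis by (meson card_image_le card_mono finite_imageI le_trans)
qed

section \<open>Cycles of a permutation as classes of a generated equivalence\<close>

definition map_rel :: "'a set \<Rightarrow> ('a \<Rightarrow> 'a) \<Rightarrow> ('a \<times> 'a) set" where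
  "map_rel B p = {(x, p x) | x. x \<in> B}"

lemma map_rel_iff: "(x, y) \<in> map_rel B p \<longleftrightarrow> x \<in> B \<and> y = p x"
  by (auto simp: map_rel_def)

text \<open>On a finite set a backward step of a permutation is an iterate of forward steps, so the
  symmetric closure adds nothing to the forward orbit.\<close>

lemma map_rel_cycle:
  assumes "finite B" "bij_betw p B B" "(x, y) \<in> generated_equiv (map_rel B p)" "x \<in> B"
  shows "\<exists>n. y = (p ^^ n) x"
proof -
  have B: "(p ^^ n) z \<in> B" if "z \<in> B" for n z
    using that assms(2) by (induction n) (auto dest: bij_betwE)
  \<comment> \<open>Two iterates of \<open>z\<close> coincide by finiteness; injectivity cancels
    their common steps until one of them is \<open>z\<close> itself.\<close>
  have fin: "\<exists>n. z = (p ^^ n) (p z)" if "z \<in> B" for z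
  proof -
    have "(\<lambda>n. (p ^^ n) z) ` UNIV \<subseteq> B" using B[OF that] by auto
    then have "\<not> inj (\<lambda>n. (p ^^ n) z)"
      using assms(1) finite_subset range_inj_infinite by blast
    then obtain i j where "i < j" "(p ^^ i) z = (p ^^ j) z"
      by (metis (mono_tags, lifting) injI linorder_neqE_nat)
    then show ?thesis
    proof (induction i arbitrary: j)
      case 0
      then obtain k where "j = Suc k" by (cases j) auto
      with 0 show ?case by (intro exI[of _ k]) (simp add: funpow_swap1)
    next
      case (Suc i)
      then obtain k where k: "j = Suc k" by (cases j) auto
      have "p ((p ^^ i) z) = p ((p ^^ k) z)" using Suc.prems k by simp
      then have "(p ^^ i) z = (p ^^ k) z"
        using B[OF that] assms(2) by (metis bij_betw_imp_inj_on inj_onD)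
      then show ?case using Suc.IH[of k] Suc.prems(1) k by auto
    qed
  qed
  have "y \<in> B \<and> (\<exists>n. y = (p ^^ n) x)"
    using assms(3)
  proof (rule generated_equiv_induct)
    show "x \<in> B \<and> (\<exists>n. x = (p ^^ n) x)" using assms(4) by (auto intro: exI[of _ 0])
  next
    fix u v assume "(u, v) \<in> map_rel B p"
    then have uv: "u \<in> B" "v = p u" by (auto simp: map_rel_iff)
    then obtain m where m: "u = (p ^^ m) v" using fin by blast
    have "(\<exists>n. u = (p ^^ n) x) \<longleftrightarrow> (\<exists>n. v = (p ^^ n) x)"
      using uv m by (metis funpow.simps(2) comp_apply funpow_add)
    moreover have "v \<in> B" using uv assms(2) by (auto dest: bij_betwE)
    ultimately show "(u \<in> B \<and> (\<exists>n. u = (p ^^ n) x)) = (v \<in> B \<and> (\<exists>n. v = (p ^^ n) x))"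
      using uv by simp
  qed
  then show ?thesis by simp
qed

lemma funpow_in_generated_equiv:
  assumes "x \<in> B" "\<And>z. z \<in> B \<Longrightarrow> p z \<in> B"
  shows "(p ^^ n) x \<in> B \<and> (x, (p ^^ n) x) \<in> generated_equiv (map_rel B p)"
proof (induction n)
  case (Suc n)
  then have "((p ^^ n) x, p ((p ^^ n) x)) \<in> generated_equiv (map_rel B p)"
    by (intro generated_equiv_base) (simp add: map_rel_iff)
  then show ?case using Suc assms(2) generated_equiv_trans[of x "(p ^^ n) x"] by auto
qed (use assms in simp)

section \<open>Product of a permutation with a transposition\<close>

context
  fixes B :: "'a set" and p p' :: "'a \<Rightarrow> 'a" and a b :: 'a
  assumes fin: "finite B" and p: "bij_betw p B B" and ab: "a \<in> B" "b \<in> B" "a \<noteq> b"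
    and p': "\<And>x. x \<in> B \<Longrightarrow> p' x = p (Transposition.transpose a b x)"
begin

lemma bij_transposed: "bij_betw p' B B"
proof -
  have "bij_betw (Transposition.transpose a b) B B"
    using ab by (simp add: bij_betw_transpose_iff)
  then have "bij_betw (p \<circ> Transposition.transpose a b) B B" using p bij_betw_trans by blast
  then show ?thesis using p' bij_betw_cong[of B p' "p \<circ> Transposition.transpose a b" B] by simp
qed

text \<open>The transposition moves points only between \<open>a\<close> and \<open>b\<close>, so it
  becomes invisible once these are identified. The cycles of \<open>p\<close> and \<open>p'\<close>
  thus have a common coarsening, and it remains to see which of the two keeps \<open>a\<close> and
  \<open>b\<close> apart.\<close>

lemma join_transposed:
  "generated_equiv (insert (a, b) (map_rel B p)) = generated_equiv (insert (a, b) (map_rel B p'))"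
proof -
  have 1: "insert (a, b) (map_rel B q) \<subseteq> generated_equiv (insert (a, b) (map_rel B q'))"
    if *: "\<And>x. x \<in> B \<Longrightarrow> q x = q' (Transposition.transpose a b x)" for q q' :: "'a \<Rightarrow> 'a"
  proof -
    let ?G = "generated_equiv (insert (a, b) (map_rel B q'))"
    have "(x, q x) \<in> ?G" if "x \<in> B" for x
    proof -
      have "(x, Transposition.transpose a b x) \<in> ?G"
        using generated_equiv_base[of a b "insert (a, b) (map_rel B q')"]
        by (auto simp: Transposition.transpose_def dest: generated_equiv_sym)
      moreover have "(Transposition.transpose a b x, q' (Transposition.transpose a b x)) \<in> ?G"
        using that ab by (intro generated_equiv_base) (auto simp: map_rel_iff Transposition.transpose_def)
      ultimately show ?thesis using *[OF that] generated_equiv_trans by metis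
    qed
    then show ?thesis by (auto simp: map_rel_iff intro: generated_equiv_base)
  qed
  have 2: "p x = p' (Transposition.transpose a b x)" if "x \<in> B" for x
    using p'[of "Transposition.transpose a b x"] that ab by (auto simp: Transposition.transpose_def)
  show ?thesis
    by (intro equalityI generated_equiv_mono 1 p' 2)
qed

text \<open>The common cycle is cut in two: \<open>p'\<close> closes up its piece \<open>S\<close>
  from \<open>p a\<close> to \<open>b\<close>, because it sends \<open>b\<close> to
  \<open>p a\<close>.\<close>

lemma transposed_separates:
  assumes "(a, b) \<in> generated_equiv (map_rel B p)"
  shows "(a, b) \<notin> generated_equiv (map_rel B p')"
proof
  obtain n where n: "b = (p ^^ n) a" using map_rel_cycle[OF fin p assms ab(1)] by auto
  \<comment> \<open>The first visit to \<open>b\<close>, so that \<open>S\<close> stops before the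
    cycle returns to \<open>a\<close>.\<close>
  define m where "m = (LEAST n. b = (p ^^ n) a)"
  have m: "b = (p ^^ m) a" unfolding m_def by (rule LeastI[of _ n]) (rule n)
  have mmin: "b \<noteq> (p ^^ k) a" if "k < m" for k
    using not_less_Least[of k] that unfolding m_def by metis
  define S where "S = (\<lambda>k. (p ^^ k) a) ` {1..m}"
  have m0: "m > 0" using m ab(3) by (cases m) auto
  have pB: "p x \<in> B" if "x \<in> B" for x using that p by (auto dest: bij_betwE)
  have SB: "S \<subseteq> B"
    unfolding S_def using funpow_in_generated_equiv[of a B p] ab(1) pB by auto
  have aS: "a \<notin> S"
  proof
    assume "a \<in> S"
    then obtain k where k: "k \<ge> 1" "k \<le> m" "(p ^^ k) a = a" unfolding S_def by auto
    \<comment> \<open>If \<open>a\<close> were met again after \<open>k\<close> steps,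
      \<open>b\<close> would be reached already \<open>k\<close> steps before
      \<open>m\<close>.\<close>
    have "(p ^^ (m - k)) a = (p ^^ (m - k)) ((p ^^ k) a)" using k(3) by simp
    also have "\<dots> = (p ^^ m) a" using k(2) by (simp flip: funpow_add comp_apply[of "p ^^ (m - k)"])
    finally show False using mmin[of "m - k"] k m by auto
  qed
  have bS: "b \<in> S" unfolding S_def using m m0 by auto
  have p'S: "p' x \<in> S" if xS: "x \<in> S" for x
  proof (cases "x = b")
    case True
    have "p' b = p a" using p'[OF ab(2)] by simp
    then show ?thesis using True m0 unfolding S_def by (auto intro!: image_eqI[of _ _ 1])
  next
    case False
    then have x: "p' x = p x" using xS aS SB p'[of x] by (auto simp: Transposition.transpose_def)
    obtain k where k: "k \<in> {1..m}" "x = (p ^^ k) a" using xS unfolding S_def by blast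
    then have "k \<noteq> m" using False m by auto
    then show ?thesis using k x unfolding S_def by (auto intro!: image_eqI[of _ _ "Suc k"])
  qed
  have "p' ` S = S"
    using p'S endo_inj_surj[of S p'] bij_transposed SB fin
    by (meson bij_betw_imp_inj_on finite_subset image_subsetI inj_on_subset)
  then have S_iff: "x \<in> S \<longleftrightarrow> p' x \<in> S" if "x \<in> B" for x
    using that SB bij_transposed unfolding bij_betw_def
    by (metis inj_on_image_mem_iff)
  assume "(a, b) \<in> generated_equiv (map_rel B p')"
  then have "(b, a) \<in> generated_equiv (map_rel B p')" by (rule generated_equiv_sym)
  then have "a \<in> S"
    by (rule generated_equiv_induct) (use bS S_iff in \<open>auto simp: map_rel_iff\<close>)
  then show False using aS by simp
qed

text \<open>From \<open>b\<close> the map \<open>p'\<close> jumps to \<open>p a\<close> and then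
  follows the old cycle of \<open>a\<close>, which avoids \<open>b\<close>, until it arrives at
  \<open>a\<close>.\<close>

lemma transposed_connects:
  assumes "(a, b) \<notin> generated_equiv (map_rel B p)"
  shows "(a, b) \<in> generated_equiv (map_rel B p')"
proof -
  let ?G = "generated_equiv (map_rel B p)" and ?G' = "generated_equiv (map_rel B p')"
  have pB: "p x \<in> B" if "x \<in> B" for x using that p by (auto dest: bij_betwE)
  have pa: "p a \<in> B" "(a, p a) \<in> ?G"
    using ab pB by (auto intro: generated_equiv_base simp: map_rel_iff)
  then obtain n where n: "a = (p ^^ n) (p a)"
    using map_rel_cycle[OF fin p generated_equiv_sym[OF pa(2)]] by blast
  have path: "(b, (p ^^ k) (p a)) \<in> ?G' \<or> (b, a) \<in> ?G'" for k
  proof (induction k)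
    case 0
    have "p' b = p a" using p'[OF ab(2)] by simp
    then show ?case using ab by (auto intro!: generated_equiv_base simp: map_rel_iff)
  next
    case (Suc k)
    let ?x = "(p ^^ k) (p a)"
    have x: "?x \<in> B" "(p a, ?x) \<in> ?G" using funpow_in_generated_equiv[OF pa(1) pB] by auto
    then have "?x \<noteq> b" using assms generated_equiv_trans[OF pa(2) x(2)] by auto
    show ?case
    proof (cases "?x = a")
      case True
      then show ?thesis using Suc by auto
    next
      case False
      then have "p' ?x = p ?x" using \<open>?x \<noteq> b\<close> x(1) p'[of ?x] by simp
      then have "(?x, (p ^^ Suc k) (p a)) \<in> ?G'"
        using x(1) by (auto intro!: generated_equiv_base simp: map_rel_iff)
      then show ?thesis using Suc by (blast intro: generated_equiv_trans)
    qed
  qed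
  then have "(b, a) \<in> ?G'" using path[of n] n by auto
  then show ?thesis by (rule generated_equiv_sym)
qed

end

section \<open>The genus inequality and source-sink colourings\<close>

text \<open>
  The map with rotation \<open>p\<close> is built up edge by edge. A new edge either joins two corners of one face
  and splits this face, or it unites two faces and at most two components.
\<close>

lemma genus_inequality:
  assumes "finite B" "bij_betw p B B" "S \<subseteq> B"
    and "\<And>x. x \<in> S \<Longrightarrow> \<alpha> x \<in> S \<and> \<alpha> x \<noteq> x \<and> \<alpha> (\<alpha> x) = x"
  defines "q \<equiv> \<lambda>S x. p (if x \<in> S then \<alpha> x else x)"
  shows "bij_betw (q S) B B \<and>
    2 * (card (B // generated_equiv (map_rel B (q S))) + card (B // generated_equiv (map_rel B p)))
      \<le> card S + 4 * card (B // generated_equiv (map_rel B p \<union> map_rel S \<alpha>))"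
proof -
  have "finite S" using assms(1,3) finite_subset by blast
  then show ?thesis using assms(3,4)
  proof (induction S rule: finite_psubset_induct)
    case (psubset S)
    show ?case
    proof (cases "S = {}")
      case True
      \<comment> \<open>Without edges, the faces, the vertices and the components all are the cycles
        of \<open>p\<close>, and equality holds.\<close>
      have "map_rel B (q {}) = map_rel B p" "map_rel {} \<alpha> = {}"
        by (auto simp: map_rel_def q_def)
      moreover have "bij_betw (q {}) B B" using assms(2) by (simp add: q_def)
      ultimately show ?thesis using True by simp
    next
      case False
      then obtain a where a: "a \<in> S" by blast
      define b S' where "b = \<alpha> a" and "S' = S - {a, b}"
      have b: "b \<in> S" "a \<noteq> b" "\<alpha> b = a" using psubset.prems(2)[OF a] by (auto simp: b_def)
      have S': "\<alpha> x \<in> S' \<and> \<alpha> x \<noteq> x \<and> \<alpha> (\<alpha> x) = x" if "x \<in> S'" for x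
        using that psubset.prems(2)[of x] a b unfolding S'_def by (metis Diff_iff b_def insert_iff empty_iff)
      let ?G = "generated_equiv (map_rel B p \<union> map_rel S \<alpha>)"
      let ?G' = "generated_equiv (map_rel B p \<union> map_rel S' \<alpha>)"
      let ?Q = "generated_equiv (map_rel B (q S))"
      let ?Q' = "generated_equiv (map_rel B (q S'))"
      have IH: "bij_betw (q S') B B"
        "2 * (card (B // ?Q') + card (B // generated_equiv (map_rel B p))) \<le> card S' + 4 * card (B // ?G')"
        using psubset.IH[of S'] psubset.prems(1) S' a by (auto simp: S'_def)
      have card: "card S = card S' + 2"
      proof -
        have "card {a, b} \<le> card S" using a b psubset.hyps(1) by (intro card_mono) auto
        then show ?thesis
          unfolding S'_def using a b psubset.hyps(1) by (simp add: card_Diff_subset)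
      qed
      have q: "q S x = q S' (Transposition.transpose a b x)" for x
        using a b unfolding q_def S'_def Transposition.transpose_def b_def[symmetric]
        by (auto simp: b_def)
      have abB: "a \<in> B" "b \<in> B" using a b psubset.prems by auto
      have G: "?G = generated_equiv (insert (a, b) (map_rel B p \<union> map_rel S' \<alpha>))"
      proof (intro equalityI generated_equiv_mono subsetI)
        fix z assume "z \<in> map_rel B p \<union> map_rel S \<alpha>"
        then have "z \<in> insert (a, b) (map_rel B p \<union> map_rel S' \<alpha>) \<or> z = (b, a)"
          using b by (auto simp: map_rel_def S'_def b_def)
        then show "z \<in> generated_equiv (insert (a, b) (map_rel B p \<union> map_rel S' \<alpha>))"
          by (cases z) (auto intro: generated_equiv_base intro: generated_equiv_sym[OF generated_equiv_base])
      next
        fix z assume "z \<in> insert (a, b) (map_rel B p \<union> map_rel S' \<alpha>)"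
        then have "z \<in> map_rel B p \<union> map_rel S \<alpha>"
          using a unfolding b_def S'_def by (cases z) (auto simp: map_rel_iff)
        then show "z \<in> ?G" using subset_generated_equiv by blast
      qed
      \<comment> \<open>A step of the face permutation runs along an edge and then around a vertex,
        so faces stay within components.\<close>
      have Q'G': "?Q' \<subseteq> ?G'"
      proof (intro generated_equiv_mono subsetI)
        fix z assume "z \<in> map_rel B (q S')"
        then obtain x where x: "x \<in> B" "z = (x, q S' x)" by (auto simp: map_rel_def)
        let ?y = "if x \<in> S' then \<alpha> x else x"
        have "(x, ?y) \<in> ?G'" by (auto intro!: generated_equiv_base simp: map_rel_def)
        moreover have "?y \<in> B" using x S' psubset.prems(1) by (auto simp: S'_def)
        then have "(?y, p ?y) \<in> ?G'" by (intro generated_equiv_base) (auto simp: map_rel_def)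
        ultimately show "z \<in> ?G'" unfolding x(2) q_def by (rule generated_equiv_trans)
      qed
      have joinQ: "generated_equiv (insert (a, b) (map_rel B (q S'))) =
          generated_equiv (insert (a, b) (map_rel B (q S)))"
        by (rule join_transposed[OF assms(1) IH(1) abB b(2) q])
      \<comment> \<open>The claim is twice V - E + F <= 2K, where \<open>S\<close> contains both
        ends of every edge. A new edge adds 2 to \<open>card S\<close>; either F grows by one and K
        is unchanged, or F drops by one and K by at most one.\<close>
      have "card (B // ?Q) + card (B // generated_equiv (map_rel B p)) \<le>
          card (B // ?Q') + card (B // generated_equiv (map_rel B p)) + 1 \<and> ?G = ?G' \<or>
        card (B // ?Q') = Suc (card (B // ?Q)) \<and> card (B // ?G') \<le> Suc (card (B // ?G))"
      proof (cases "(a, b) \<in> ?Q'")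
        case True
        then have "?G = ?G'" unfolding G using Q'G' by (intro generated_equiv_insert_absorb) auto
        moreover have "(a, b) \<notin> ?Q"
          by (rule transposed_separates[OF assms(1) IH(1) abB b(2) q True])
        then have "joined a b ?Q ?Q'"
          using joined_insert[of a b "map_rel B (q S)"]
          unfolding joinQ[symmetric] generated_equiv_insert_absorb[OF True] by blast
        then have "card (B // ?Q) = Suc (card (B // ?Q'))"
          using joined_card_quotient[OF equiv_generated_equiv _ abB assms(1)] by blast
        ultimately show ?thesis by simp
      next
        case False
        then have *: "(a, b) \<in> ?Q"
          by (rule transposed_connects[OF assms(1) IH(1) abB b(2) q])
        have "joined a b ?Q' ?Q"
          using joined_insert[OF False] unfolding joinQ generated_equiv_insert_absorb[OF *] .
        then have "card (B // ?Q') = Suc (card (B // ?Q))"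
          using joined_card_quotient[OF equiv_generated_equiv _ abB assms(1)] by blast
        moreover have "card (B // ?G') \<le> Suc (card (B // ?G))"
        proof (cases "(a, b) \<in> ?G'")
          case True
          then show ?thesis unfolding G by (simp add: generated_equiv_insert_absorb)
        next
          case False
          then show ?thesis unfolding G
            using joined_card_quotient[OF equiv_generated_equiv joined_insert[OF False] abB assms(1)]
            by simp
        qed
        ultimately show ?thesis by simp
      qed
      moreover have "bij_betw (q S) B B"
        by (rule bij_transposed[OF assms(1) IH(1) abB b(2) q])
      ultimately show ?thesis using IH(2) card by (elim disjE conjE; simp)
    qed
  qed
qed

section \<open>Crossing ends and edges of a PD code\<close>

lemma PD_code_partner:
  assumes "PD_code D" "b \<in> crossing_ends D"
  shows "\<exists>!b'. b' \<in> crossing_ends D \<and> b' \<noteq> b \<and> case_prod (ends D) b' = case_prod (ends D) b"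
proof -
  let ?e = "case_prod (ends D)"
  let ?X = "{b' \<in> crossing_ends D. ?e b' = ?e b}"
  have "?e b \<in> arcs D" using assms by (auto simp: PD_code_def)
  moreover have "\<forall>a\<in>arcs D. card {b' \<in> crossing_ends D. ?e b' = a} \<in> {0, 2}"
    using assms(1) by (simp add: PD_code_def split_def)
  ultimately have "card ?X \<in> {0, 2}" by (rule bspec[rotated])
  moreover have "finite ?X" using assms(1) by (auto simp: PD_code_def crossing_ends_def)
  then have "card ?X \<noteq> 0" using assms(2) by (cases b) auto
  ultimately have "card ?X = 2" by blast
  then obtain x y where xy: "?X = {x, y}" "x \<noteq> y" by (meson card_2_iff)
  have iff: "b' \<in> crossing_ends D \<and> ?e b' = ?e b \<longleftrightarrow> b' = x \<or> b' = y" for b'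
    using xy(1) by (metis (mono_tags, lifting) insert_iff mem_Collect_eq singleton_iff)
  have "b = x \<or> b = y" using assms(2) iff by blast
  then show ?thesis
  proof
    assume "b = x"
    then show ?thesis by (intro ex1I[of _ y]) (use iff xy(2) in metis)+
  next
    assume "b = y"
    then show ?thesis by (intro ex1I[of _ x]) (use iff xy(2) in metis)+
  qed
qed

definition other_end :: "diagram \<Rightarrow> nat \<times> nat \<Rightarrow> nat \<times> nat" where
  "other_end D b = (THE b'. b' \<in> crossing_ends D \<and> b' \<noteq> b \<and>
     case_prod (ends D) b' = case_prod (ends D) b)"

lemma other_end:
  assumes "PD_code D" "b \<in> crossing_ends D"
  shows "other_end D b \<in> crossing_ends D" "other_end D b \<noteq> b"
    and "case_prod (ends D) (other_end D b) = case_prod (ends D) b"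
  using theI'[OF PD_code_partner[OF assms]] unfolding other_end_def by auto

lemma other_end_unique:
  assumes "PD_code D" "b \<in> crossing_ends D" "b' \<in> crossing_ends D" "b' \<noteq> b"
    and "case_prod (ends D) b' = case_prod (ends D) b"
  shows "b' = other_end D b"
  using PD_code_partner[OF assms(1,2)] other_end[OF assms(1,2)] assms(3-) by blast

lemma other_end_other_end:
  assumes "PD_code D" "b \<in> crossing_ends D"
  shows "other_end D (other_end D b) = b"
  using other_end[OF assms] other_end_unique[OF assms(1) _ assms(2), of "other_end D b"] by auto

text \<open>Double counting of the ends, four at each crossing and two on each used arc. This
  eliminates the number of edges from Euler's formula.\<close>

lemma card_used_arcs:
  assumes "PD_code D"
  shows "card (case_prod (ends D) ` crossing_ends D) = 2 * card (crossings D)"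
proof -
  let ?e = "case_prod (ends D)" and ?B = "crossing_ends D"
  have fin: "finite ?B" using assms by (auto simp: PD_code_def crossing_ends_def)
  have "card {x \<in> ?B. ?e x = y} = 2" if "y \<in> ?e ` ?B" for y
  proof -
    obtain b where b: "b \<in> ?B" "y = ?e b" using \<open>y \<in> ?e ` ?B\<close> by blast
    have "x \<in> ?B \<and> ?e x = y \<longleftrightarrow> x = b \<or> x = other_end D b" for x
      using b other_end[OF assms b(1)] other_end_unique[OF assms b(1), of x] by metis
    then have "{x \<in> ?B. ?e x = y} = {b, other_end D b}" by blast
    then show ?thesis using other_end(2)[OF assms b(1)] by simp
  qed
  then have "(\<Sum>x\<in>?B. 1) = (\<Sum>y\<in>?e ` ?B. 2 :: nat)"
    by (subst sum.image_gen[OF fin, of _ ?e]) simp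
  then show ?thesis by (simp add: crossing_ends_def card_cartesian_product)
qed

lemma even_add_3_mod_4: "even ((k + 3) mod 4) \<longleftrightarrow> odd (k :: nat)"
  by presburger

text \<open>Such a colouring amounts to a choice of one of two components of the cover over every
  component of the map. Counting gives at least \<open>2 * K\<close> components, while lifting of
  paths leaves at most two over each component of the map; hence there are exactly two.\<close>

lemma source_sink_coloring:
  assumes "planar_diagram D"
  obtains \<sigma> :: "nat \<times> nat \<Rightarrow> bool"
  where "\<And>c k. (c, k) \<in> crossing_ends D \<Longrightarrow> \<sigma> (c, (k + 3) mod 4) \<longleftrightarrow> \<not> \<sigma> (c, k)"
    and "\<And>b. b \<in> crossing_ends D \<Longrightarrow> \<sigma> (other_end D b) \<longleftrightarrow> \<not> \<sigma> b"
proof -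
  have PD: "PD_code D" using assms by (simp add: planar_diagram_def)
  let ?B = "crossing_ends D" and ?e = "case_prod (ends D)"
  \<comment> \<open>\<open>p\<close> and \<open>\<alpha>\<close> are the rotation and the edge involution of the bipartite double cover; as both of
    them switch the sheet, the faces lift to closed faces.\<close>
  define B where "B = ?B \<times> (UNIV :: bool set)"
  define p :: "(nat \<times> nat) \<times> bool \<Rightarrow> (nat \<times> nat) \<times> bool"
    where "p = (\<lambda>((c, k), h). ((c, (k + 3) mod 4), \<not> h))"
  define \<alpha> :: "(nat \<times> nat) \<times> bool \<Rightarrow> (nat \<times> nat) \<times> bool"
    where "\<alpha> = (\<lambda>(b, h). (other_end D b, \<not> h))"
  define q where "q = (\<lambda>x. p (if x \<in> B then \<alpha> x else x))"
  define E where "E = generated_equiv (map_rel B p \<union> map_rel B \<alpha>)"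
  define Rg where "Rg = {(c, c') | c c' k k'. (c, k) \<in> ?B \<and> (c', k') \<in> ?B \<and> ends D c k = ends D c' k'}"
  define Rf where "Rf = {((c, k), (c', (k' + 3) mod 4)) | c k c' k'.
      (c, k) \<in> ?B \<and> (c', k') \<in> ?B \<and> (c, k) \<noteq> (c', k') \<and> ends D c k = ends D c' k'}"
  define V F K where "V = card (crossings D)" and "F = card (faces D)"
    and "K = card (graph_components D)"
  have finV: "finite (crossings D)" using PD by (simp add: PD_code_def)
  then have finB: "finite ?B" by (simp add: crossing_ends_def)
  then have fin: "finite B" by (simp add: B_def)
  have comps: "graph_components D = crossings D // generated_equiv Rg"
    unfolding graph_components_def Rg_def ..
  have faces: "faces D = ?B // generated_equiv Rf"
    unfolding faces_def Rf_def ..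
  have euler: "F = V + 2 * K"
    using assms card_used_arcs[OF PD]
    by (simp add: planar_diagram_def V_def F_def K_def)
  have pB: "p x \<in> B" if "x \<in> B" for x
    using that by (auto simp: B_def p_def crossing_ends_def)
  have "inj_on p B"
  proof (rule inj_on_inverseI[where g = "\<lambda>((c, k), h). ((c, (k + 1) mod 4), \<not> h)"])
    fix x assume "x \<in> B"
    then obtain c k h where "x = ((c, k), h)" "k < 4" by (auto simp: B_def crossing_ends_def)
    moreover have "((k + 3) mod 4 + 1) mod 4 = k" if "k < 4" for k :: nat using that by presburger
    ultimately show "(\<lambda>((c, k), h). ((c, (k + 1) mod 4), \<not> h)) (p x) = x"
      by (simp add: p_def)
  qed
  then have "bij_betw p B B"
    unfolding bij_betw_def using endo_inj_surj[OF fin] pB by blast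
  moreover have "\<alpha> x \<in> B \<and> \<alpha> x \<noteq> x \<and> \<alpha> (\<alpha> x) = x" if "x \<in> B" for x
    using that other_end[OF PD] other_end_other_end[OF PD] by (auto simp: B_def \<alpha>_def)
  ultimately have genus: "2 * (card (B // generated_equiv (map_rel B q)) +
      card (B // generated_equiv (map_rel B p))) \<le> card B + 4 * card (B // E)"
    using genus_inequality[OF fin _ subset_refl, of p \<alpha>] unfolding q_def E_def by blast
  have "2 * F \<le> card (B // generated_equiv (map_rel B q))"
  proof -
    let ?f = "\<lambda>(b, h :: bool). (generated_equiv Rf `` {b}, h)"
    have "?f u = ?f v" if "(u, v) \<in> map_rel B q" for u v
    proof -
      obtain b h where u: "u = (b, h)" by (cases u)
      then have b: "b \<in> ?B" and v: "v = p (\<alpha> u)"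
        using that by (auto simp: map_rel_iff q_def B_def)
      obtain c k where c: "other_end D b = (c, k)" by (cases "other_end D b")
      have "(b, (c, (k + 3) mod 4)) \<in> Rf"
        using other_end[OF PD b] b c unfolding Rf_def by (cases b) auto
      then have "generated_equiv Rf `` {b} = generated_equiv Rf `` {(c, (k + 3) mod 4)}"
        by (meson equiv_class_eq equiv_generated_equiv generated_equiv_base)
      then show ?thesis using u v c by (simp add: p_def \<alpha>_def)
    qed
    then have "card (?f ` B) \<le> card (B // generated_equiv (map_rel B q))"
      by (rule card_quotient_ge_image[OF fin])
    moreover have "?f ` B = faces D \<times> UNIV"
      unfolding faces B_def quotient_def by force
    ultimately show ?thesis by (simp add: F_def card_cartesian_product)
  qed
  moreover have "2 * V \<le> card (B // generated_equiv (map_rel B p))"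
  proof -
    \<comment> \<open>Each step around a crossing switches the sheet and also the parity of the end,
      so the eight lifted ends fall into two cycles that this invariant tells apart.\<close>
    let ?f = "\<lambda>((c :: nat, k :: nat), h). (c, h \<noteq> odd k)"
    have "?f u = ?f v" if "(u, v) \<in> map_rel B p" for u v
      using that unfolding map_rel_iff p_def by (cases u) (auto simp: even_add_3_mod_4)
    then have "card (?f ` B) \<le> card (B // generated_equiv (map_rel B p))"
      by (rule card_quotient_ge_image[OF fin])
    moreover have "?f ` B = crossings D \<times> UNIV"
    proof -
      have "(c, h) \<in> ?f ` B" if "c \<in> crossings D" for c h
        using that by (intro image_eqI[of _ _ "((c, 0), h)"]) (auto simp: B_def crossing_ends_def)
      then show ?thesis by (auto simp: B_def crossing_ends_def)
    qed
    ultimately show ?thesis by (simp add: V_def card_cartesian_product)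
  qed
  moreover have "card B = 8 * V"
    by (simp add: B_def crossing_ends_def card_cartesian_product V_def)
  \<comment> \<open>With c components the bounds combine to
    \<open>2 * (2 * F + 2 * V) \<le> 8 * V + 4 * c\<close>, and inserting
    \<open>F = V + 2 * K\<close> leaves \<open>2 * K \<le> c\<close>.\<close>
  ultimately have many: "2 * K \<le> card (B // E)" using genus euler by simp
  define rep where "rep c = (SOME c'. c' \<in> generated_equiv Rg `` {c})" for c
  have rep: "(c, rep c) \<in> generated_equiv Rg" for c
    using someI[of "\<lambda>c'. c' \<in> generated_equiv Rg `` {c}" c] by (auto simp: rep_def)
  have rep_cong: "rep c = rep c'" if "(c, c') \<in> generated_equiv Rg" for c c'
    unfolding rep_def using equiv_class_eq[OF equiv_generated_equiv that] by simp
  have RgB: "Rg \<subseteq> crossings D \<times> crossings D" by (auto simp: Rg_def crossing_ends_def)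
  have rep_in: "rep c \<in> crossings D" if "c \<in> crossings D" for c
    using generated_equiv_closed[OF RgB that] rep[of c] by blast
  have E_p: "(x, p x) \<in> E" if "x \<in> B" for x
    unfolding E_def using that by (intro generated_equiv_base) (auto simp: map_rel_iff)
  have E_\<alpha>: "(x, \<alpha> x) \<in> E" if "x \<in> B" for x
    unfolding E_def using that by (intro generated_equiv_base) (auto simp: map_rel_iff)
  have E_trans: "(x, z) \<in> E" if "(x, y) \<in> E" "(y, z) \<in> E" for x y z
    using that unfolding E_def by (rule generated_equiv_trans)
  have E_sym: "(y, x) \<in> E" if "(x, y) \<in> E" for x y
    using that unfolding E_def by (rule generated_equiv_sym)
  \<comment> \<open>The exchange of the sheets is an automorphism of the cover.\<close>
  have flip: "((b, \<not> h), (b', \<not> h')) \<in> E" if "((b, h), (b', h')) \<in> E" for b h b' h'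
  proof -
    let ?P = "\<lambda>z. ((b, \<not> h), (fst z, \<not> snd z)) \<in> E"
    have step: "((fst u, \<not> snd u), (fst v, \<not> snd v)) \<in> E" if uv: "(u, v) \<in> map_rel B p \<union> map_rel B \<alpha>" for u v
    proof -
      have "(fst u, \<not> snd u) \<in> B" using uv by (auto simp: map_rel_iff B_def)
      moreover have "(fst v, \<not> snd v) = p (fst u, \<not> snd u) \<or> (fst v, \<not> snd v) = \<alpha> (fst u, \<not> snd u)"
        using uv by (auto simp: map_rel_iff p_def \<alpha>_def split: prod.splits)
      ultimately show ?thesis using E_p E_\<alpha> by metis
    qed
    have "?P (b', h')"
    proof (rule generated_equiv_induct[of "(b, h)" _ "map_rel B p \<union> map_rel B \<alpha>" ?P])
      show "((b, h), (b', h')) \<in> generated_equiv (map_rel B p \<union> map_rel B \<alpha>)"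
        using that by (simp add: E_def)
      show "?P (b, h)" by (simp add: E_def)
      fix u v assume "(u, v) \<in> map_rel B p \<union> map_rel B \<alpha>"
      then show "?P u \<longleftrightarrow> ?P v" using step E_trans E_sym by meson
    qed
    then show ?thesis by simp
  qed
  have rot: "\<exists>h'. (((c, k), h), ((c, k'), h')) \<in> E"
    if "(c, k) \<in> ?B" "k' < 4" for c k k' h
  proof -
    have "(c, (k + 3 * n) mod 4) \<in> ?B \<and> (\<exists>h'. (((c, k), h), ((c, (k + 3 * n) mod 4), h')) \<in> E)" for n
    proof (induction n)
      case 0
      then show ?case using that by (auto simp: crossing_ends_def E_def intro!: exI[of _ h])
    next
      case (Suc n)
      then obtain h' where h': "(((c, k), h), ((c, (k + 3 * n) mod 4), h')) \<in> E"
        and B': "((c, (k + 3 * n) mod 4), h') \<in> B" by (auto simp: B_def)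
      have "((k + 3 * n) mod 4 + 3) mod 4 = (k + 3 * Suc n) mod 4" by presburger
      then have "p ((c, (k + 3 * n) mod 4), h') = ((c, (k + 3 * Suc n) mod 4), \<not> h')"
        by (simp add: p_def)
      then have "(((c, k), h), ((c, (k + 3 * Suc n) mod 4), \<not> h')) \<in> E"
        and "((c, (k + 3 * Suc n) mod 4), \<not> h') \<in> B"
        using E_trans[OF h' E_p[OF B']] pB[OF B'] by auto
      then show ?case by (auto simp: B_def)
    qed
    \<comment> \<open>The number of turns solves \<open>k + 3 * n = k'\<close> modulo 4: as 3 is its
      own inverse there, n = 3(k' - k), which is congruent to \<open>k + 3 * k'\<close>.\<close>
    from this[of "k + 3 * k'"] have "\<exists>h'. (((c, k), h), ((c, (k + 3 * (k + 3 * k')) mod 4), h')) \<in> E"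
      by blast
    moreover have "k + 3 * (k + 3 * k') = k' + 4 * (k + 2 * k')" by simp
    then have "(k + 3 * (k + 3 * k')) mod 4 = k'" using that(2) by (metis mod_less mod_mult_self2)
    ultimately show ?thesis by simp
  qed
  \<comment> \<open>Paths lift to the cover; the sheet in which they end is left open.\<close>
  have lift: "\<exists>h'. (((c, k), h), ((c', k'), h')) \<in> E"
    if "(c, c') \<in> generated_equiv Rg" "(c, k) \<in> ?B" "k' < 4" for c c' k k' h
  proof -
    let ?P = "\<lambda>z. \<forall>k'<4. \<exists>h'. (((c, k), h), ((z, k'), h')) \<in> E"
    have step: "?P v" if "?P u" "(u, v) \<in> Rg" for u v
    proof (intro allI impI)
      fix k' :: nat assume k': "k' < 4"
      obtain i j where ij: "(u, i) \<in> ?B" "(v, j) \<in> ?B" "ends D u i = ends D v j"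
        using \<open>(u, v) \<in> Rg\<close> by (auto simp: Rg_def)
      then obtain h' where h': "(((c, k), h), ((u, i), h')) \<in> E"
        using \<open>?P u\<close> by (auto simp: crossing_ends_def)
      have "\<exists>h''. (((u, i), h'), ((v, j), h'')) \<in> E"
      proof (cases "(u, i) = (v, j)")
        case True
        then show ?thesis using ij by (auto simp: E_def intro!: exI[of _ h'])
      next
        case False
        then have "(v, j) = other_end D (u, i)"
          by (intro other_end_unique[OF PD ij(1,2)]) (use ij(3) in auto)
        then show ?thesis
          using E_\<alpha>[of "((u, i), h')"] ij by (auto simp: B_def \<alpha>_def)
      qed
      then obtain h'' where "(((u, i), h'), ((v, j), h'')) \<in> E" by blast
      moreover obtain h3 where "(((v, j), h''), ((v, k'), h3)) \<in> E"
        using rot[OF ij(2) k'] by blast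
      ultimately show "\<exists>h'. (((c, k), h), ((v, k'), h')) \<in> E"
        using E_trans h' by blast
    qed
    have sym: "(v, u) \<in> Rg" if "(u, v) \<in> Rg" for u v
      using that unfolding Rg_def by force
    have "?P c'"
    proof (rule generated_equiv_induct[OF that(1), of ?P])
      show "?P c" using rot[OF that(2)] by blast
    next
      fix u v assume "(u, v) \<in> Rg"
      then show "?P u \<longleftrightarrow> ?P v" using step sym by blast
    qed
    then show ?thesis using that(3) by blast
  qed
  \<comment> \<open>By \<open>lift\<close>, every component of the cover contains one of the at most
    \<open>2 * K\<close> lifts of the ends 0 at the representatives. That many components are
    required, so no two of these lifts share a component.\<close>
  have distinct: "(((rep c, 0), True), ((rep c, 0), False)) \<notin> E" if "c \<in> crossings D" for c
  proof -
    let ?\<Phi> = "\<lambda>(r, h). E `` {((r, 0), h)}"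
    let ?R = "rep ` crossings D"
    have "B // E \<subseteq> ?\<Phi> ` (?R \<times> UNIV)"
    proof
      fix X assume "X \<in> B // E"
      then obtain c k h where X: "X = E `` {((c, k), h)}" "(c, k) \<in> ?B"
        by (auto simp: quotient_def B_def)
      obtain h' where "(((c, k), h), ((rep c, 0), h')) \<in> E" using lift[OF rep X(2) zero_less_numeral] by blast
      then have "X = ?\<Phi> (rep c, h')"
        unfolding X(1) E_def by (simp add: equiv_class_eq[OF equiv_generated_equiv])
      then show "X \<in> ?\<Phi> ` (?R \<times> UNIV)" using X(2) by (force simp: crossing_ends_def)
    qed
    then have le: "card (B // E) \<le> card (?\<Phi> ` (?R \<times> UNIV))"
      using finV by (intro card_mono) auto
    have "card ?R \<le> K"
    proof -
      have "?R \<subseteq> (\<lambda>X. SOME c'. c' \<in> X) ` graph_components D"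
      proof
        fix r assume "r \<in> ?R"
        then obtain c where "c \<in> crossings D" "r = (SOME c'. c' \<in> generated_equiv Rg `` {c})"
          by (auto simp: rep_def)
        then show "r \<in> (\<lambda>X. SOME c'. c' \<in> X) ` graph_components D"
          unfolding comps by (metis imageI quotientI)
      qed
      then have "card ?R \<le> card ((\<lambda>X. SOME c'. c' \<in> X) ` graph_components D)"
        using finV by (intro card_mono) (auto simp: comps quotient_def)
      also have "\<dots> \<le> K" unfolding K_def
        using finV by (intro card_image_le) (auto simp: comps quotient_def)
      finally show ?thesis .
    qed
    then have "card (?\<Phi> ` (?R \<times> UNIV)) \<ge> card (?R \<times> (UNIV :: bool set))"
      using le many by (simp add: card_cartesian_product)
    then have "inj_on ?\<Phi> (?R \<times> UNIV)"
      using finV card_image_le[of "?R \<times> (UNIV :: bool set)" ?\<Phi>]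
      by (intro eq_card_imp_inj_on) auto
    moreover have "(rep c, True) \<in> ?R \<times> UNIV" "(rep c, False) \<in> ?R \<times> UNIV" using that by auto
    ultimately have "?\<Phi> (rep c, True) \<noteq> ?\<Phi> (rep c, False)"
      using inj_onD[of ?\<Phi> "?R \<times> UNIV" "(rep c, True)" "(rep c, False)"] by blast
    then show ?thesis
      unfolding E_def using equiv_class_eq[OF equiv_generated_equiv] by fastforce
  qed
  \<comment> \<open>The colour records whether the lift to the sheet \<open>True\<close> lies in the
    component chosen over the representative.\<close>
  define \<sigma> where "\<sigma> = (\<lambda>(c, k :: nat). (((c, k), True), ((rep c, 0), True)) \<in> E)"
  have \<sigma>_flip: "\<sigma> (c', k') \<longleftrightarrow> \<not> \<sigma> (c, k)"
    if b: "(c, k) \<in> ?B" "(c', k') \<in> ?B" and c: "rep c = rep c'"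
      and e: "(((c, k), True), ((c', k'), False)) \<in> E" for c k c' k'
  proof -
    have c_in: "c \<in> crossings D" using b by (simp add: crossing_ends_def)
    obtain h where h: "(((c, k), True), ((rep c, 0), h)) \<in> E" using lift[OF rep b(1) zero_less_numeral] by blast
    have "(((c', k'), False), ((rep c, 0), h)) \<in> E"
      using E_trans[OF E_sym[OF e] h] .
    then have h': "(((c', k'), True), ((rep c, 0), \<not> h)) \<in> E"
      using flip by fastforce
    have one: "\<not> ((x, ((rep c, 0), True)) \<in> E \<and> (x, ((rep c, 0), False)) \<in> E)" for x
      using distinct[OF c_in] E_trans E_sym by blast
    show ?thesis
      using h h' one[of "((c, k), True)"] one[of "((c', k'), True)"] c
      by (cases h) (auto simp: \<sigma>_def)
  qed
  show ?thesis
  proof (rule that[of \<sigma>])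
    fix c k assume "(c, k) \<in> ?B"
    then have "((c, k), True) \<in> B" "(c, (k + 3) mod 4) \<in> ?B" by (auto simp: B_def crossing_ends_def)
    then show "\<sigma> (c, (k + 3) mod 4) \<longleftrightarrow> \<not> \<sigma> (c, k)"
      using E_p[of "((c, k), True)"] \<open>(c, k) \<in> ?B\<close> by (intro \<sigma>_flip) (auto simp: p_def)
  next
    fix b assume b: "b \<in> ?B"
    obtain c k c' k' where ck: "b = (c, k)" "other_end D b = (c', k')"
      by (metis surj_pair)
    have "(c, k) \<in> ?B" "(c', k') \<in> ?B" "ends D c k = ends D c' k'"
      using other_end[OF PD b] b ck by auto
    then have "(c, c') \<in> Rg" unfolding Rg_def by blast
    then have "rep c = rep c'" by (intro rep_cong generated_equiv_base)
    moreover have "(((c, k), True), ((c', k'), False)) \<in> E"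
      using E_\<alpha>[of "(b, True)"] b ck by (simp add: \<alpha>_def B_def)
    ultimately show "\<sigma> (other_end D b) \<longleftrightarrow> \<not> \<sigma> b"
      using \<sigma>_flip[of c k c' k'] b other_end(1)[OF PD b] unfolding ck(2) unfolding ck(1) by blast
  qed
qed

section \<open>Change of a mark\<close>

lemma joined_sym: "joined x y E E' \<longleftrightarrow> joined y x E E'" if "equiv UNIV E"
  using that unfolding joined_def by (meson equivE symD)

lemma joined_cong:
  assumes "equiv UNIV E" "(x, a) \<in> E" "(y, b) \<in> E"
  shows "joined x y E E' \<longleftrightarrow> joined a b E E'"
proof -
  have *: "(u, w) \<in> E \<longleftrightarrow> (v, w) \<in> E" "(w, u) \<in> E \<longleftrightarrow> (w, v) \<in> E"
    if "(u, v) \<in> E" for u v w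
    using that assms(1) by (meson equivE symD transD)+
  show ?thesis
    unfolding joined_def
    by (simp only: *[OF assms(2)] *[OF assms(3)])
qed

text \<open>The end at the same crossing to which the state joins a given one. \<open>B\<close>
  joins 0 with 3 and 1 with 2, hence \<open>3 - k\<close>; \<open>A\<close> joins 0 with 1 and 2
  with 3.\<close>

definition partner :: "nat set \<Rightarrow> nat \<times> nat \<Rightarrow> nat \<times> nat" where
  "partner s = (\<lambda>(c, k). (c, if c \<in> s then 3 - k else if even k then k + 1 else k - 1))"

lemma lessThan_4: "k < 4 \<longleftrightarrow> k = 0 \<or> k = 1 \<or> k = 2 \<or> k = (3 :: nat)"
  by auto

lemma partner_in: "b \<in> crossing_ends D \<Longrightarrow> partner s b \<in> crossing_ends D"
  by (auto simp: partner_def crossing_ends_def lessThan_4)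

lemma partner_partner: "b \<in> crossing_ends D \<Longrightarrow> partner s (partner s b) = b"
  by (auto simp: partner_def crossing_ends_def lessThan_4)

lemma splitting_partner:
  assumes "s \<subseteq> crossings D"
  shows "generated_equiv (splitting D s) =
    generated_equiv ((\<lambda>b. (case_prod (ends D) b, case_prod (ends D) (partner s b))) ` crossing_ends D)"
    (is "_ = generated_equiv ?P")
proof
  have "splitting D s \<subseteq> ?P"
  proof -
    have "(ends D c k, ends D c l) \<in> ?P" if "c \<in> crossings D" "k < 4" "partner s (c, k) = (c, l)" for c k l
      using that by (intro image_eqI[of _ _ "(c, k)"]) (auto simp: crossing_ends_def)
    then show ?thesis
      using assms unfolding splitting_def by (auto simp: partner_def)
  qed
  then show "generated_equiv (splitting D s) \<subseteq> generated_equiv ?P"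
    by (rule generated_equiv_subset)
  show "generated_equiv ?P \<subseteq> generated_equiv (splitting D s)"
  proof (rule generated_equiv_mono, clarify)
    fix c k assume "(c, k) \<in> crossing_ends D"
    then have c: "c \<in> crossings D" "k < 4" by (auto simp: crossing_ends_def)
    have "(ends D c k, case_prod (ends D) (partner s (c, k))) \<in> splitting D s \<union> (splitting D s)\<inverse>"
      using c unfolding splitting_def partner_def lessThan_4 by auto
    then show "(ends D c k, case_prod (ends D) (partner s (c, k))) \<in> generated_equiv (splitting D s)"
      using Un_converse_subset_generated_equiv by (rule rev_subsetD)
  qed
qed

section \<open>Oriented circles as cycles of a permutation of the arcs\<close>

locale colored_diagram =
  fixes D :: diagram and \<sigma> :: "nat \<times> nat \<Rightarrow> bool"
  assumes PD: "PD_code D"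
    and \<sigma>_next: "\<And>c k. (c, k) \<in> crossing_ends D \<Longrightarrow> \<sigma> (c, (k + 3) mod 4) \<longleftrightarrow> \<not> \<sigma> (c, k)"
    and \<sigma>_other: "\<And>b. b \<in> crossing_ends D \<Longrightarrow> \<sigma> (other_end D b) \<longleftrightarrow> \<not> \<sigma> b"
begin

abbreviation "end_arc \<equiv> case_prod (ends D)"

text \<open>The ends coloured \<open>False\<close> are those at which an arc arrives; a used arc has
  exactly one, because its two ends differ in colour.\<close>

definition incoming :: "nat \<Rightarrow> nat \<times> nat" where
  "incoming a = (THE b. b \<in> crossing_ends D \<and> \<not> \<sigma> b \<and> end_arc b = a)"

text \<open>One step along the circles of the state in the direction of the colouring. Closed curves
  without crossings are fixed points, hence cycles of their own.\<close>

definition next_arc :: "nat set \<Rightarrow> nat \<Rightarrow> nat" where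
  "next_arc s a = (if a \<in> end_arc ` crossing_ends D then end_arc (partner s (incoming a)) else a)"

lemma \<sigma>_parity: "(c, k) \<in> crossing_ends D \<Longrightarrow> \<sigma> (c, k) \<longleftrightarrow> \<sigma> (c, 0) \<noteq> odd k"
  using \<sigma>_next[of c 0] \<sigma>_next[of c 3] \<sigma>_next[of c 2]
  by (auto simp: crossing_ends_def lessThan_4)

text \<open>Colours alternate around the crossing and either splitting joins ends of different
  parity, so all states respect the same orientation.\<close>

lemma \<sigma>_partner: "b \<in> crossing_ends D \<Longrightarrow> \<sigma> (partner s b) \<longleftrightarrow> \<not> \<sigma> b"
proof -
  assume b: "b \<in> crossing_ends D"
  obtain c k where ck: "b = (c, k)" by (cases b)
  then have k: "k < 4" using b by (simp add: crossing_ends_def)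
  define l where "l = (if c \<in> s then 3 - k else if even k then k + 1 else k - 1)"
  have "partner s b = (c, l)" by (simp add: ck partner_def l_def)
  moreover have "odd l \<longleftrightarrow> even k" using k unfolding lessThan_4 l_def by auto
  ultimately show ?thesis
    using \<sigma>_parity[of c k] \<sigma>_parity[of c l] partner_in[OF b, of s] b ck by auto
qed

lemma same_color_unique:
  assumes "b \<in> crossing_ends D" "b' \<in> crossing_ends D" "end_arc b = end_arc b'" "\<sigma> b = \<sigma> b'"
  shows "b = b'"
  using other_end_unique[OF PD assms(2,1)] \<sigma>_other[OF assms(2)] assms(3,4) by metis

lemma incoming_eq: "b \<in> crossing_ends D \<Longrightarrow> \<not> \<sigma> b \<Longrightarrow> incoming (end_arc b) = b"
  unfolding incoming_def by (rule the_equality) (auto intro: same_color_unique)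

lemma incoming:
  assumes "a \<in> end_arc ` crossing_ends D"
  shows "incoming a \<in> crossing_ends D" "\<not> \<sigma> (incoming a)" "end_arc (incoming a) = a"
proof -
  obtain b where b: "b \<in> crossing_ends D" "a = end_arc b" using assms by blast
  obtain b' where "b' \<in> crossing_ends D" "a = end_arc b'" "\<not> \<sigma> b'"
    using b other_end[OF PD b(1)] \<sigma>_other[OF b(1)] by metis
  then show "incoming a \<in> crossing_ends D" "\<not> \<sigma> (incoming a)" "end_arc (incoming a) = a"
    using incoming_eq by auto
qed

lemma arc_in: "b \<in> crossing_ends D \<Longrightarrow> end_arc b \<in> arcs D"
  using PD by (auto simp: PD_code_def)

lemma next_arc_arc: "b \<in> crossing_ends D \<Longrightarrow> \<not> \<sigma> b \<Longrightarrow> next_arc s (end_arc b) = end_arc (partner s b)"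
  unfolding next_arc_def using incoming_eq by simp

lemma bij_next_arc: "bij_betw (next_arc s) (arcs D) (arcs D)"
proof -
  have used: "next_arc s a \<in> end_arc ` crossing_ends D \<longleftrightarrow> a \<in> end_arc ` crossing_ends D" for a
    using incoming partner_in unfolding next_arc_def by auto
  have "inj_on (next_arc s) (arcs D)"
  proof (rule inj_onI)
    fix a a' assume eq: "next_arc s a = next_arc s a'"
    show "a = a'"
    proof (cases "a \<in> end_arc ` crossing_ends D")
      case True
      then have a': "a' \<in> end_arc ` crossing_ends D" using used[of a] used[of a'] eq by simp
      note i = incoming[OF True] incoming[OF a']
      have "end_arc (partner s (incoming a)) = end_arc (partner s (incoming a'))"
        using eq True a' by (simp add: next_arc_def)
      then have "partner s (incoming a) = partner s (incoming a')"
        by (rule same_color_unique[rotated 2])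
          (use i partner_in in \<open>auto simp: \<sigma>_partner\<close>)
      then have "incoming a = incoming a'"
        using i(1,4) partner_partner by metis
      then show ?thesis using i(3,6) by metis
    next
      case False
      then have "a' \<notin> end_arc ` crossing_ends D" using used[of a] used[of a'] eq by simp
      then show ?thesis using False eq by (simp add: next_arc_def)
    qed
  qed
  moreover have "next_arc s ` arcs D \<subseteq> arcs D"
    using arc_in[OF partner_in[OF incoming(1)]] by (auto simp: next_arc_def)
  moreover have "finite (arcs D)" using PD by (simp add: PD_code_def)
  ultimately show ?thesis using endo_inj_surj unfolding bij_betw_def by blast
qed

text \<open>Of two ends that are joined, exactly one is incoming; read from this end, the pair is a
  step of the permutation.\<close>

lemma splitting_next_arc:
  assumes "s \<subseteq> crossings D"
  shows "generated_equiv (splitting D s) = generated_equiv (map_rel (arcs D) (next_arc s))"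
    (is "_ = ?G")
  unfolding splitting_partner[OF assms]
proof (rule equalityI)
  have out: "(end_arc b, end_arc (partner s b)) \<in> ?G" if "b \<in> crossing_ends D" "\<not> \<sigma> b" for b
    using that next_arc_arc arc_in by (intro generated_equiv_base) (simp add: map_rel_iff)
  have "(end_arc b, end_arc (partner s b)) \<in> ?G" if b: "b \<in> crossing_ends D" for b
  proof (cases "\<sigma> b")
    case True
    then show ?thesis
      using out[of "partner s b"] b by (simp add: partner_in partner_partner \<sigma>_partner generated_equiv_sym)
  qed (use out b in blast)
  then show "generated_equiv ((\<lambda>b. (end_arc b, end_arc (partner s b))) ` crossing_ends D) \<subseteq> ?G"
    by (intro generated_equiv_mono) blast
  show "?G \<subseteq> generated_equiv ((\<lambda>b. (end_arc b, end_arc (partner s b))) ` crossing_ends D)"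
  proof (rule generated_equiv_mono, rule subrelI)
    fix a a' assume "(a, a') \<in> map_rel (arcs D) (next_arc s)"
    then have a': "a' = next_arc s a" by (simp add: map_rel_iff)
    show "(a, a') \<in> generated_equiv ((\<lambda>b. (end_arc b, end_arc (partner s b))) ` crossing_ends D)"
    proof (cases "a \<in> end_arc ` crossing_ends D")
      case True
      then have "(a, a') = (end_arc (incoming a), end_arc (partner s (incoming a)))"
        using incoming a' by (simp add: next_arc_def)
      then show ?thesis using incoming(1)[OF True] by (intro generated_equiv_base) blast
    qed (simp add: a' next_arc_def)
  qed
qed

text \<open>The incoming ends at \<open>c\<close> are two opposite ones, and the two splittings send
  them to the same outgoing ends in exchanged order. All other arcs arrive elsewhere and keep their
  successors.\<close>

lemma next_arc_insert:
  assumes "c \<in> crossings D" "c \<notin> s"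
  obtains a b where "a \<in> arcs D" "b \<in> arcs D" "a \<noteq> b"
    and "\<And>z. next_arc (insert c s) z = next_arc s (Transposition.transpose a b z)"
    and "a = ends D c 0 \<and> b = ends D c 2 \<or> a = ends D c 1 \<and> b = ends D c 3"
proof -
  define i where "i = (if \<sigma> (c, 0) then 1 else 0 :: nat)"
  have ends: "(c, k) \<in> crossing_ends D" if "k < 4" for k
    using that assms(1) by (simp add: crossing_ends_def)
  have in_i: "\<not> \<sigma> (c, k) \<longleftrightarrow> k = i \<or> k = i + 2" if "k < 4" for k
    using \<sigma>_parity[OF ends[OF that]] that unfolding lessThan_4 i_def by auto
  have i: "i < 4" "i + 2 < 4" by (auto simp: i_def)
  define a b where "a = ends D c i" and "b = ends D c (i + 2)"
  have inc: "incoming a = (c, i)" "incoming b = (c, i + 2)"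
    using incoming_eq[OF ends[OF i(1)]] incoming_eq[OF ends[OF i(2)]] in_i i
    by (auto simp: a_def b_def)
  then have ne: "a \<noteq> b" by auto
  have part: "partner (insert c s) (c, i) = partner s (c, i + 2)"
    "partner (insert c s) (c, i + 2) = partner s (c, i)"
    using assms(2) by (auto simp: partner_def i_def)
  have used: "a \<in> end_arc ` crossing_ends D" "b \<in> end_arc ` crossing_ends D"
    using ends i unfolding a_def b_def by force+
  show ?thesis
  proof (rule that[of a b])
    show "a \<in> arcs D" "b \<in> arcs D" using used arc_in by auto
    show "a = ends D c 0 \<and> b = ends D c 2 \<or> a = ends D c 1 \<and> b = ends D c 3"
      by (auto simp: a_def b_def i_def numeral_3_eq_3 numeral_2_eq_2)
    fix z
    show "next_arc (insert c s) z = next_arc s (Transposition.transpose a b z)"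
    proof (cases "z = a \<or> z = b")
      case True
      then show ?thesis using used inc part ne by (auto simp: next_arc_def)
    next
      case False
      have "partner (insert c s) (incoming z) = partner s (incoming z)" if z: "z \<in> end_arc ` crossing_ends D"
      proof -
        obtain d k where dk: "incoming z = (d, k)" by (cases "incoming z")
        have "d \<noteq> c"
        proof
          assume "d = c"
          then have "k = i \<or> k = i + 2"
            using incoming(1,2)[OF z] dk in_i[of k] by (auto simp: crossing_ends_def)
          then show False using incoming(3)[OF z] dk \<open>d = c\<close> False by (auto simp: a_def b_def)
        qed
        then show ?thesis by (simp add: dk partner_def)
      qed
      then show ?thesis using False by (simp add: next_arc_def)
    qed
  qed (rule ne)
qed

text \<open>This excludes edges that keep the number of circles: if the ends 0 and 2 lie on one
  circle it is split, otherwise their circles are merged.\<close>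

lemma edge_joined:
  assumes s: "s \<subseteq> crossings D" and c: "c \<in> crossings D - s"
  defines "E \<equiv> generated_equiv (splitting D s)" and "E' \<equiv> generated_equiv (splitting D (insert c s))"
  shows "if (ends D c 0, ends D c 2) \<in> E then joined (ends D c 0) (ends D c 2) E' E
    else joined (ends D c 0) (ends D c 2) E E'"
proof -
  obtain a b where ab: "a \<in> arcs D" "b \<in> arcs D" "a \<noteq> b"
    and nxt: "\<And>z. next_arc (insert c s) z = next_arc s (Transposition.transpose a b z)"
    and ab_cases: "a = ends D c 0 \<and> b = ends D c 2 \<or> a = ends D c 1 \<and> b = ends D c 3"
    using next_arc_insert[of c s] c by blast
  have fin: "finite (arcs D)" using PD by (simp add: PD_code_def)
  have E: "E = generated_equiv (map_rel (arcs D) (next_arc s))"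
    and E': "E' = generated_equiv (map_rel (arcs D) (next_arc (insert c s)))"
    unfolding E_def E'_def using s c by (auto intro!: splitting_next_arc)
  note tr = fin bij_next_arc[of s] ab nxt
  have jn: "generated_equiv (insert (a, b) (map_rel (arcs D) (next_arc s))) =
      generated_equiv (insert (a, b) (map_rel (arcs D) (next_arc (insert c s))))"
    by (rule join_transposed[OF tr])
  have main: "if (a, b) \<in> E then joined a b E' E else joined a b E E'"
  proof (cases "(a, b) \<in> E")
    case True
    then have "(a, b) \<notin> E'" unfolding E E' by (rule transposed_separates[OF tr])
    then have "joined a b E' (generated_equiv (insert (a, b) (map_rel (arcs D) (next_arc (insert c s)))))"
      unfolding E' by (rule joined_insert)
    moreover have "generated_equiv (insert (a, b) (map_rel (arcs D) (next_arc s))) = E"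
      using True unfolding E by (rule generated_equiv_insert_absorb)
    ultimately show ?thesis using True jn by simp
  next
    case False
    then have *: "(a, b) \<in> E'" unfolding E E' by (rule transposed_connects[OF tr])
    have "joined a b E (generated_equiv (insert (a, b) (map_rel (arcs D) (next_arc s))))"
      using False unfolding E by (rule joined_insert)
    moreover have "generated_equiv (insert (a, b) (map_rel (arcs D) (next_arc (insert c s)))) = E'"
      using * unfolding E' by (rule generated_equiv_insert_absorb)
    ultimately show ?thesis using False jn by simp
  qed
  have eq: "equiv UNIV E" "equiv UNIV E'" unfolding E_def E'_def by (rule equiv_generated_equiv)+
  show ?thesis
    using ab_cases
  proof
    assume "a = ends D c 1 \<and> b = ends D c 3"
    \<comment> \<open>If the incoming ends are 1 and 3, each of them shares a circle with 0 or 2 in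
      both states; the change of mark only exchanges who goes with whom.\<close>
    have 1: "(ends D c 0, a) \<in> E" "(ends D c 2, b) \<in> E"
      unfolding E_def using c ab_cases \<open>a = ends D c 1 \<and> b = ends D c 3\<close>
      by (auto simp: splitting_def intro!: generated_equiv_base)
    have "(ends D c 3, ends D c 0) \<in> E'" "(ends D c 1, ends D c 2) \<in> E'"
      unfolding E'_def by (auto simp: splitting_def intro!: generated_equiv_base)
    then have 2: "(ends D c 0, b) \<in> E'" "(ends D c 2, a) \<in> E'"
      unfolding E'_def using \<open>a = ends D c 1 \<and> b = ends D c 3\<close> by (auto intro: generated_equiv_sym)
    have "(ends D c 0, ends D c 2) \<in> E \<longleftrightarrow> (a, b) \<in> E"
      using 1 unfolding E_def by (meson generated_equiv_sym generated_equiv_trans)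
    then show ?thesis
      using main joined_cong[OF eq(1) 1, of E'] joined_cong[OF eq(2) 2, of E]
        joined_sym[OF eq(2), of a b E] by (simp split: if_splits)
  next
    assume "a = ends D c 0 \<and> b = ends D c 2"
    then show ?thesis using main by auto
  qed
qed

end

section \<open>Edge maps on monomials\<close>

lemma joinedD:
  assumes "joined x y E E'" "equiv UNIV E"
  shows "(x, y) \<notin> E" "(x, y) \<in> E'" "E \<subseteq> E'"
proof -
  have "(z, z) \<in> E" for z using assms(2) by (auto elim: equivE dest: refl_onD)
  then show "(x, y) \<notin> E" "(x, y) \<in> E'" "E \<subseteq> E'"
    using assms(1) unfolding joined_def by auto
qed

lemma joined_new:
  assumes "joined x y E E'" "equiv UNIV E" "(p, q) \<in> E'" "(p, q) \<notin> E"
  shows "(p, x) \<in> E \<and> (q, y) \<in> E \<or> (p, y) \<in> E \<and> (q, x) \<in> E"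
  using assms unfolding joined_def by (meson equivE symD)

text \<open>Circles that are met carry the class of an arc, all others the unit. The restriction to
  \<open>circles D s\<close> makes this a labelling in the sense of
  \<open>enhanced_states\<close>.\<close>

definition mark :: "diagram \<Rightarrow> nat set \<Rightarrow> nat list \<Rightarrow> nat set \<Rightarrow> w_basis" where
  "mark D s as = (\<lambda>C\<in>circles D s. if C \<in> circle_through D s ` set as then Wp else Wm)"

text \<open>
  The image of a product of arcs in \<open>W_s\<close>, viewed as a quotient of the polynomial ring over the arcs;
  it vanishes if two of the arcs lie on the same circle.
\<close>

definition monomial :: "diagram \<Rightarrow> nat set \<Rightarrow> nat list \<Rightarrow> (enhanced_state \<Rightarrow>\<^sub>0 int)" where
  "monomial D s as =
    (if distinct (map (circle_through D s) as) then frag_of (s, mark D s as) else 0)"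

abbreviation state_equiv :: "diagram \<Rightarrow> nat set \<Rightarrow> (nat \<times> nat) set" where
  "state_equiv D s \<equiv> generated_equiv (splitting D s)"

lemma circle_through_eq_iff: "circle_through D s a = circle_through D s b \<longleftrightarrow> (a, b) \<in> state_equiv D s"
  unfolding circle_through_def using equiv_generated_equiv by (rule eq_equiv_class_iff) auto

lemma circles_eq: "circles D s = circle_through D s ` arcs D"
  by (auto simp: circles_def circle_through_def quotient_def)

lemma monomial_swap: "monomial D s (a # b # as) = monomial D s (b # a # as)"
  unfolding monomial_def mark_def by (auto simp: insert_commute)

lemma monomial_cong:
  assumes "(a, b) \<in> state_equiv D s"
  shows "monomial D s (a # as) = monomial D s (b # as)"
proof -
  have "circle_through D s a = circle_through D s b" using assms by (simp add: circle_through_eq_iff)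
  then show ?thesis by (simp add: monomial_def mark_def)
qed

lemma joined_circle_through:
  assumes "joined x y (state_equiv D s) (state_equiv D s')"
  shows "circle_through D s' u =
      (if circle_through D s u = circle_through D s x \<or> circle_through D s u = circle_through D s y
       then circle_through D s x \<union> circle_through D s y else circle_through D s u)"
    and "circle_through D s x \<noteq> circle_through D s y"
    and "circle_through D s x \<union> circle_through D s y \<noteq> circle_through D s u"
proof -
  show "circle_through D s' u =
      (if circle_through D s u = circle_through D s x \<or> circle_through D s u = circle_through D s y
       then circle_through D s x \<union> circle_through D s y else circle_through D s u)"
    unfolding circle_through_eq_iff
    unfolding circle_through_def by (rule joined_class[OF equiv_generated_equiv assms])
  have ne: "(x, y) \<notin> state_equiv D s"
    using assms by (rule joinedD) (rule equiv_generated_equiv)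
  then show "circle_through D s x \<noteq> circle_through D s y" by (simp add: circle_through_eq_iff)
  have self: "w \<in> circle_through D s w" for w by (simp add: circle_through_def)
  show "circle_through D s x \<union> circle_through D s y \<noteq> circle_through D s u"
  proof
    assume *: "circle_through D s x \<union> circle_through D s y = circle_through D s u"
    then have "x \<in> circle_through D s u" "y \<in> circle_through D s u" using self by blast+
    then show False using ne unfolding circle_through_def
      by (meson Image_singleton_iff generated_equiv_sym generated_equiv_trans)
  qed
qed

text \<open>A merge only identifies the classes of \<open>x\<close> and \<open>y\<close>, so the
  list of arcs stays. Factors on both circles come to lie on one, and their product vanishes in
  accordance with \<open>m_bar Wp Wp\<close>.\<close>

lemma edge_map_merge:
  fixes D s c
  defines "x \<equiv> ends D c 0" and "y \<equiv> ends D c 2" and "s' \<equiv> insert c s"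
  assumes j: "joined x y (state_equiv D s) (state_equiv D s')"
    and xy: "x \<in> arcs D" "y \<in> arcs D"
  shows "frag_extend (edge_map D c) (monomial D s as) = monomial D s' as"
proof -
  define cl cl' where "cl = circle_through D s" and "cl' = circle_through D s'"
  define N where "N = cl x \<union> cl y"
  have cl': "cl' u = (if cl u = cl x \<or> cl u = cl y then N else cl u)" for u
    unfolding cl_def cl'_def N_def by (rule joined_circle_through[OF j])
  have ne: "cl x \<noteq> cl y" and new: "N \<noteq> cl u" for u
    unfolding cl_def N_def by (rule joined_circle_through[OF j])+
  show ?thesis
  proof (cases "distinct (map cl as)")
    case False
    then have "\<not> distinct (map cl' as)" by (auto simp: distinct_map inj_on_def cl')
    then show ?thesis using False by (simp add: monomial_def cl_def cl'_def)
  next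
    case True
    define v where "v = mark D s as"
    have v: "v (cl u) = (if cl u \<in> cl ` set as then Wp else Wm)" if "u \<in> arcs D" for u
      using that by (simp add: v_def mark_def circles_eq cl_def)
    have edge: "edge_map D c (s, v) = frag_extend (\<lambda>w. frag_of (s', restrict (v(N := w)) (circles D s')))
              (m_bar (v (cl x)) (v (cl y)))"
      using ne cl'[of x] unfolding edge_map_def
      by (simp add: Let_def cl_def[symmetric] s'_def[symmetric] x_def[symmetric] y_def[symmetric] cl'_def[symmetric])
    have lhs: "frag_extend (edge_map D c) (monomial D s as) = edge_map D c (s, v)"
      using True by (simp add: monomial_def v_def cl_def)
    show ?thesis
    proof (cases "cl x \<in> cl ` set as \<and> cl y \<in> cl ` set as")
      case both: True
      then obtain a b where ab: "a \<in> set as" "b \<in> set as" "cl a = cl x" "cl b = cl y" by auto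
      then have "a \<noteq> b" "cl' a = cl' b" using ne by (auto simp: cl')
      then have "\<not> distinct (map cl' as)" using ab by (auto simp: distinct_map inj_on_def)
      then show ?thesis using both xy unfolding lhs edge by (simp add: v monomial_def cl'_def)
    next
      case False
      define w where "w = (if cl x \<in> cl ` set as \<or> cl y \<in> cl ` set as then Wp else Wm)"
      have m: "m_bar (v (cl x)) (v (cl y)) = frag_of w"
        using False xy by (auto simp: v w_def)
      \<comment> \<open>At most one of the two merged circles is met, so no two factors are brought
        together.\<close>
      have "inj_on cl' (set as)"
      proof (rule inj_onI)
        fix a b assume ab: "a \<in> set as" "b \<in> set as" "cl' a = cl' b"
        then have "cl a = cl b" using False new[of a] new[of b] unfolding cl' by (metis image_eqI)
        then show "a = b" using True ab by (auto simp: distinct_map inj_on_def)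
      qed
      then have dist: "distinct (map cl' as)" using True by (simp add: distinct_map)
      have "restrict (v(N := w)) (circles D s') = mark D s' as"
        unfolding mark_def
      proof (rule restrict_ext)
        fix C assume "C \<in> circles D s'"
        then obtain u where u: "u \<in> arcs D" "C = cl' u" by (auto simp: circles_eq cl'_def)
        show "(v(N := w)) C = (if C \<in> circle_through D s' ` set as then Wp else Wm)"
        proof (cases "cl u = cl x \<or> cl u = cl y")
          case True
          then have "C = N" using u by (simp add: cl')
          moreover have "N \<in> cl' ` set as \<longleftrightarrow> cl x \<in> cl ` set as \<or> cl y \<in> cl ` set as"
          proof -
            have "N = cl' a \<longleftrightarrow> cl x = cl a \<or> cl y = cl a" for a
              using new[of a] by (auto simp: cl')
            then show ?thesis by (simp add: image_iff bex_disj_distrib)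
          qed
          ultimately show ?thesis by (simp add: w_def cl'_def)
        next
          case False
          then have C: "C = cl u" "C \<noteq> N" using u new[of u] by (auto simp: cl')
          have "C = cl' a \<longleftrightarrow> C = cl a" for a
            using False C new[of a] by (auto simp: cl')
          then show ?thesis using C(2) v[OF u(1)] C(1) by (simp add: image_iff cl'_def)
        qed
      qed
      then show ?thesis using dist unfolding lhs edge m by (simp add: monomial_def cl'_def)
    qed
  qed
qed

text \<open>Multiplication by \<open>x + y\<close>. On a circle with label \<open>Wm\<close> this
  gives the two terms of \<open>Delta_bar Wm\<close>. On a circle with label \<open>Wp\<close> one
  of the new circles is already occupied; the factor on it makes a square, hence zero, and the other
  one leaves \<open>Wp\<close> on both.\<close>

lemma edge_map_split:
  fixes D s c
  defines "x \<equiv> ends D c 0" and "y \<equiv> ends D c 2" and "s' \<equiv> insert c s"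
  assumes j: "joined x y (state_equiv D s') (state_equiv D s)"
    and xy: "x \<in> arcs D" "y \<in> arcs D"
  shows "frag_extend (edge_map D c) (monomial D s as) = monomial D s' (x # as) + monomial D s' (y # as)"
proof -
  define cl cl' where "cl = circle_through D s" and "cl' = circle_through D s'"
  define M where "M = cl' x \<union> cl' y"
  have cl: "cl u = (if cl' u = cl' x \<or> cl' u = cl' y then M else cl' u)" for u
    unfolding cl_def cl'_def M_def by (rule joined_circle_through[OF j])
  have ne: "cl' x \<noteq> cl' y" and new: "M \<noteq> cl' u" for u
    unfolding cl'_def M_def by (rule joined_circle_through[OF j])+
  have M: "cl u = M \<longleftrightarrow> cl' u = cl' x \<or> cl' u = cl' y" for u
    using new[of u] by (auto simp: cl)
  have old: "cl u = cl w \<longleftrightarrow> cl' u = cl' w" if "cl u \<noteq> M" for u w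
    using that new[of u] new[of w] by (auto simp: cl split: if_splits)
  have mono: "monomial D s' bs =
      (if distinct (map cl' bs) then frag_of (s', mark D s' bs) else 0)" for bs
    by (simp add: monomial_def cl'_def)
  show ?thesis
  proof (cases "distinct (map cl as)")
    case False
    \<comment> \<open>Two factors on the circle that is split may get separated, but then they
      occupy both new circles, and \<open>x\<close> as well as \<open>y\<close> repeats one of
      them.\<close>
    have "\<not> distinct (map cl' (x # as)) \<and> \<not> distinct (map cl' (y # as))"
    proof (cases "distinct (map cl' as)")
      case True
      then obtain a b where ab: "a \<in> set as" "b \<in> set as" "cl a = cl b" "cl' a \<noteq> cl' b"
        using False by (auto simp: distinct_map inj_on_def) blast
      then have "cl a = M" "cl b = M" using old by metis+
      then have "cl' x \<in> cl' ` set as" "cl' y \<in> cl' ` set as"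
        using ab unfolding M by (metis image_eqI)+
      then show ?thesis by auto
    qed auto
    then have "monomial D s' (x # as) = 0" "monomial D s' (y # as) = 0"
      unfolding mono by (simp_all only: if_False)
    moreover have "monomial D s as = 0" using False by (simp add: monomial_def cl_def)
    ultimately show ?thesis by simp
  next
    case True
    define v where "v = mark D s as"
    have v: "v (cl u) = (if cl u \<in> cl ` set as then Wp else Wm)" if "u \<in> arcs D" for u
      using that by (simp add: v_def mark_def circles_eq cl_def)
    have "cl x = M" "cl y = M" by (simp_all add: M)
    then have edge: "edge_map D c (s, v) = frag_extend
        (\<lambda>(w, z). frag_of (s', restrict (v(cl' x := w, cl' y := z)) (circles D s')))
        (Delta_bar (v M))"
      unfolding edge_map_def
      by (simp add: Let_def cl_def[symmetric] s'_def[symmetric] x_def[symmetric] y_def[symmetric] cl'_def[symmetric])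
    have lhs: "frag_extend (edge_map D c) (monomial D s as) = edge_map D c (s, v)"
      using True by (simp add: monomial_def v_def cl_def)
    have inj: "inj_on cl (set as)" "distinct as" using True by (auto simp: distinct_map)
    then have inj': "inj_on cl' (set as)" by (auto simp: inj_on_def cl)
    \<comment> \<open>\<open>bs\<close> stands for \<open>as\<close> enlarged by \<open>x\<close> or
      \<open>y\<close>; off the two new circles the labels are those of \<open>as\<close>.\<close>
    have marks: "restrict (v(cl' x := w, cl' y := z)) (circles D s') = mark D s' bs"
      if "w = (if cl' x \<in> cl' ` set bs then Wp else Wm)" "z = (if cl' y \<in> cl' ` set bs then Wp else Wm)"
        and bs: "set as \<subseteq> set bs" "set bs \<subseteq> insert x (insert y (set as))" for w z bs
      unfolding mark_def
    proof (rule restrict_ext)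
      fix C assume "C \<in> circles D s'"
      then obtain u where u: "u \<in> arcs D" "C = cl' u" by (auto simp: circles_eq cl'_def)
      show "(v(cl' x := w, cl' y := z)) C = (if C \<in> circle_through D s' ` set bs then Wp else Wm)"
      proof (cases "C = cl' x \<or> C = cl' y")
        case True
        then show ?thesis using that(1,2) ne by (auto simp: cl'_def)
      next
        case False
        then have C: "C = cl u" "cl u \<noteq> M" using u new[of u] by (auto simp: cl)
        have "C = cl' a \<longleftrightarrow> C = cl a" for a
          using old[OF C(2), of a] C(1) u(2) by simp
        then have "C \<in> cl' ` set bs \<longleftrightarrow> C \<in> cl ` set as"
          using bs False C by (auto simp: image_iff) blast+
        then show ?thesis using False v[OF u(1)] C(1) by (simp add: cl'_def)
      qed
    qed
    show ?thesis
    proof (cases "M \<in> cl ` set as")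
      case False
      then have out: "cl' x \<notin> cl' ` set as" "cl' y \<notin> cl' ` set as"
        by (auto simp: image_iff) (metis M)+
      have "v M = Wm" using v[OF xy(1)] \<open>cl x = M\<close> False by simp
      moreover have "restrict (v(cl' x := Wp, cl' y := Wm)) (circles D s') = mark D s' (x # as)"
        "restrict (v(cl' x := Wm, cl' y := Wp)) (circles D s') = mark D s' (y # as)"
        using out ne by (auto intro!: marks)
      moreover have "distinct (map cl' (x # as))" "distinct (map cl' (y # as))"
        using out inj inj' by (auto simp: distinct_map)
      ultimately show ?thesis unfolding lhs edge mono by (simp add: frag_extend_add)
    next
      case True
      then obtain a where a: "a \<in> set as" "cl a = M" by auto
      have unique: "b = a" if "b \<in> set as" "cl' b = cl' x \<or> cl' b = cl' y" for b
        using that a inj(1) M[of b] by (auto simp: inj_on_def)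
      have vM: "v M = Wp" using v[OF xy(1)] \<open>cl x = M\<close> True by simp
      have a': "cl' a = cl' x \<or> cl' a = cl' y" using a M by simp
      then show ?thesis
      proof
        assume ax: "cl' a = cl' x"
        then have in_out: "cl' x \<in> cl' ` set as" "cl' y \<notin> cl' ` set as"
          using a unique ne by (metis image_eqI, metis image_iff)
        then have "restrict (v(cl' x := Wp, cl' y := Wp)) (circles D s') = mark D s' (y # as)"
          by (auto intro!: marks)
        moreover have "\<not> distinct (map cl' (x # as))" "distinct (map cl' (y # as))"
          using in_out inj inj' by (auto simp: distinct_map)
        ultimately show ?thesis unfolding lhs edge mono vM by simp
      next
        assume ay: "cl' a = cl' y"
        then have in_out: "cl' y \<in> cl' ` set as" "cl' x \<notin> cl' ` set as"
          using a unique ne by (metis image_eqI, metis image_iff)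
        then have "restrict (v(cl' x := Wp, cl' y := Wp)) (circles D s') = mark D s' (x # as)"
          by (auto intro!: marks)
        moreover have "\<not> distinct (map cl' (y # as))" "distinct (map cl' (x # as))"
          using in_out inj inj' by (auto simp: distinct_map)
        ultimately show ?thesis unfolding lhs edge mono vM by simp
      qed
    qed
  qed
qed

section \<open>The square of the boundary\<close>

lemma edge_sign_insert:
  assumes "finite s" "c \<notin> s" "c \<noteq> d"
  shows "edge_sign r (insert c s) d = (if (c, d) \<in> r then - edge_sign r s d else edge_sign r s d)"
proof -
  have "{e \<in> insert c s. e \<noteq> d \<and> (e, d) \<in> r} =
      (if (c, d) \<in> r then insert c {e \<in> s. e \<noteq> d \<and> (e, d) \<in> r} else {e \<in> s. e \<noteq> d \<and> (e, d) \<in> r})"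
    using assms(3) by auto
  then show ?thesis using assms by (simp add: edge_sign_def)
qed

text \<open>Exactly one of \<open>c\<close>, \<open>d\<close> precedes the other, so marking the
  first of two crossings changes the sign of the second edge in exactly one of the two
  orders.\<close>

lemma edge_sign_anticommute:
  assumes "linear_order_on A r" "c \<in> A" "d \<in> A" "finite s" "c \<notin> s" "d \<notin> s" "c \<noteq> d"
  shows "edge_sign r s c * edge_sign r (insert c s) d = - (edge_sign r s d * edge_sign r (insert d s) c)"
proof -
  have "(c, d) \<in> r \<longleftrightarrow> (d, c) \<notin> r"
    using assms unfolding linear_order_on_def partial_order_on_def total_on_def
    by (meson antisymD)
  then show ?thesis using assms by (simp add: edge_sign_insert)
qed

text \<open>Exchanging the two indices shows that the sum is its own negative, and the group has no
  element of order two.\<close>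

lemma antisymmetric_sum_eq_0:
  fixes f :: "'a \<Rightarrow> 'a \<Rightarrow> ('b \<Rightarrow>\<^sub>0 int)"
  assumes "finite X" and "\<And>c d. c \<in> X \<Longrightarrow> d \<in> X \<Longrightarrow> c \<noteq> d \<Longrightarrow> f c d = - f d c"
  shows "(\<Sum>c\<in>X. \<Sum>d\<in>X - {c}. f c d) = 0"
proof -
  let ?g = "\<lambda>c d. if c = d then 0 else f c d"
  have g: "(\<Sum>c\<in>X. \<Sum>d\<in>X - {c}. f c d) = (\<Sum>c\<in>X. \<Sum>d\<in>X. ?g c d)"
    using assms(1) by (intro sum.cong refl sum.mono_neutral_cong_left) auto
  also have "\<dots> = (\<Sum>d\<in>X. \<Sum>c\<in>X. ?g c d)" by (rule sum.swap)
  also have "\<dots> = (\<Sum>d\<in>X. \<Sum>c\<in>X. - ?g d c)"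
  proof (intro sum.cong refl)
    fix c d assume "d \<in> X" "c \<in> X"
    then show "?g c d = - ?g d c" using assms(2)[of c d] by simp
  qed
  also have "\<dots> = - (\<Sum>c\<in>X. \<Sum>d\<in>X. ?g c d)" by (simp add: sum_negf)
  finally have "(\<Sum>c\<in>X. \<Sum>d\<in>X. ?g c d) = - (\<Sum>c\<in>X. \<Sum>d\<in>X. ?g c d)"
    unfolding g .
  moreover have "p = 0" if "p = - p" for p :: "'b \<Rightarrow>\<^sub>0 int"
  proof (rule poly_mapping_eqI)
    fix k
    have "Poly_Mapping.lookup p k = - Poly_Mapping.lookup p k" by (metis that lookup_uminus)
    then show "Poly_Mapping.lookup p k = Poly_Mapping.lookup 0 k" by simp
  qed
  ultimately show ?thesis unfolding g by blast
qed

text \<open>The degree of a product of arcs, assigned to vanishing products as well: every circle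
  starts with -2 for \<open>Wm\<close>, and each factor raises one circle by 4 to
  \<open>Wp\<close>.\<close>

definition monomial_deg :: "diagram \<Rightarrow> nat set \<Rightarrow> nat list \<Rightarrow> int" where
  "monomial_deg D s as = 4 * int (length as) - 2 * int (card (circles D s)) + num_A D s - num_B s"

definition state_parity :: "diagram \<Rightarrow> nat set \<Rightarrow> nat" where
  "state_parity D s = (card s + card (circles D {})) mod 2"

lemma monomial_in_chains:
  assumes "finite (arcs D)" "s \<in> states D" "set as \<subseteq> arcs D"
  shows "monomial D s as \<in> carrier (free_Abelian_group
    (bracket_basis D (state_parity D s) (monomial_deg D s as)))"
proof (cases "distinct (map (circle_through D s) as)")
  case True
  let ?P = "circle_through D s ` set as"
  have fin: "finite (circles D s)" and sub: "?P \<subseteq> circles D s"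
    using assms by (auto simp: circles_eq)
  have card: "card ?P = length as"
    using True by (metis distinct_card length_map set_map)
  have "(\<Sum>C\<in>circles D s. w_deg (mark D s as C)) = (\<Sum>C\<in>circles D s. (if C \<in> ?P then 4 else 0) + (-2 :: int))"
    by (intro sum.cong) (auto simp: mark_def)
  also have "\<dots> = 4 * int (card ?P) - 2 * int (card (circles D s))"
    using fin sub by (simp add: sum_subtractf sum.If_cases Int_absorb1)
  finally have "state_deg D (s, mark D s as) = monomial_deg D s as"
    by (simp add: monomial_deg_def card)
  moreover have "(s, mark D s as) \<in> enhanced_states D"
    using assms(2) by (simp add: enhanced_states_def mark_def)
  ultimately have "(s, mark D s as) \<in> bracket_basis D (state_parity D s) (monomial_deg D s as)"
    by (simp add: bracket_basis_def state_parity_def)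
  then show ?thesis using True by (simp add: monomial_def)
qed (simp add: monomial_def)

text \<open>One arc is chosen on each circle with label \<open>Wp\<close>. The boundary can thus be
  studied on monomials, where the edge maps have uniform formulas.\<close>

lemma enhanced_state_monomial:
  assumes "finite (arcs D)" "(s, v) \<in> enhanced_states D"
  obtains as where "set as \<subseteq> arcs D" "distinct (map (circle_through D s) as)"
    "mark D s as = v" "monomial D s as = frag_of (s, v)"
proof -
  have v: "v \<in> circles D s \<rightarrow>\<^sub>E UNIV" using assms(2) by (auto simp: enhanced_states_def)
  have "finite {C \<in> circles D s. v C = Wp}" using assms(1) by (simp add: circles_eq)
  then obtain Cs where Cs: "set Cs = {C \<in> circles D s. v C = Wp}" "distinct Cs"
    using finite_distinct_list by blast
  define f where "f C = (SOME a. a \<in> arcs D \<and> circle_through D s a = C)" for C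
  have f: "f C \<in> arcs D \<and> circle_through D s (f C) = C" if "C \<in> circles D s" for C
    unfolding f_def by (rule someI_ex) (use that in \<open>auto simp: circles_eq\<close>)
  have map: "map (circle_through D s) (map f Cs) = Cs"
    using f Cs(1) by (auto intro!: map_idI)
  have mark: "mark D s (map f Cs) = v"
  proof
    fix C
    have "circle_through D s ` set (map f Cs) = set Cs" using map by (metis set_map)
    moreover have "v C = Wm" if "v C \<noteq> Wp" using that by (cases "v C") auto
    ultimately show "mark D s (map f Cs) C = v C"
      using v Cs(1) by (auto simp: mark_def PiE_def extensional_def)
  qed
  show ?thesis
    by (rule that[of "map f Cs"]) (use f Cs map mark in \<open>auto simp: monomial_def simp del: map_map\<close>)
qed

section \<open>The boundary of a coloured diagram\<close>

context colored_diagram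
begin

lemma finite_arcs: "finite (arcs D)" and finite_crossings: "finite (crossings D)"
  using PD by (auto simp: PD_code_def)

lemma ends_in: "c \<in> crossings D \<Longrightarrow> k < 4 \<Longrightarrow> ends D c k \<in> arcs D"
  using PD by (auto simp: PD_code_def crossing_ends_def)

lemma edge_map_monomial:
  assumes "s \<subseteq> crossings D" "c \<in> crossings D - s"
  shows "frag_extend (edge_map D c) (monomial D s as) =
    (if (ends D c 0, ends D c 2) \<in> state_equiv D s
     then monomial D (insert c s) (ends D c 0 # as) + monomial D (insert c s) (ends D c 2 # as)
     else monomial D (insert c s) as)"
  using edge_joined[OF assms] assms(2) ends_in[of c]
  by (simp add: edge_map_merge edge_map_split split: if_splits)

text \<open>Quotient maps and multiplications by sums of arcs commute as long as the types of the
  two edges do not depend on the order. Only configurations in which they do need a closer look at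
  the circles.\<close>

lemma edge_square:
  assumes s: "s \<subseteq> crossings D" and c: "c \<in> crossings D - s" and d: "d \<in> crossings D - s" and cd: "c \<noteq> d"
  shows "frag_extend (edge_map D d) (frag_extend (edge_map D c) (monomial D s as)) =
    frag_extend (edge_map D c) (frag_extend (edge_map D d) (monomial D s as))"
proof -
  define x y u v where "x = ends D c 0" and "y = ends D c 2" and "u = ends D d 0" and "v = ends D d 2"
  define E0 E1 E2 E3 where "E0 = state_equiv D s" and "E1 = state_equiv D (insert c s)"
    and "E2 = state_equiv D (insert d s)" and "E3 = state_equiv D (insert d (insert c s))"
  have comm: "insert c (insert d s) = insert d (insert c s)" by auto
  have eq: "equiv UNIV E0" "equiv UNIV E1" "equiv UNIV E2" "equiv UNIV E3"
    unfolding E0_def E1_def E2_def E3_def by (rule equiv_generated_equiv)+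
  have J1: "if (x, y) \<in> E0 then joined x y E1 E0 else joined x y E0 E1"
    unfolding x_def y_def E0_def E1_def by (rule edge_joined[OF s c])
  have J2: "if (u, v) \<in> E0 then joined u v E2 E0 else joined u v E0 E2"
    unfolding u_def v_def E0_def E2_def by (rule edge_joined[OF s d])
  have J3: "if (u, v) \<in> E1 then joined u v E3 E1 else joined u v E1 E3"
    unfolding u_def v_def E1_def E3_def by (rule edge_joined) (use s c d cd in auto)
  have J4: "if (x, y) \<in> E2 then joined x y E3 E2 else joined x y E2 E3"
    unfolding x_def y_def E2_def E3_def comm[symmetric] by (rule edge_joined) (use s c d cd in auto)
  let ?m = "monomial D (insert d (insert c s))"
  have e1: "frag_extend (edge_map D c) (monomial D s bs) =
      (if (x, y) \<in> E0 then monomial D (insert c s) (x # bs) + monomial D (insert c s) (y # bs)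
       else monomial D (insert c s) bs)" for bs
    unfolding x_def y_def E0_def by (rule edge_map_monomial[OF s c])
  have e2: "frag_extend (edge_map D d) (monomial D s bs) =
      (if (u, v) \<in> E0 then monomial D (insert d s) (u # bs) + monomial D (insert d s) (v # bs)
       else monomial D (insert d s) bs)" for bs
    unfolding u_def v_def E0_def by (rule edge_map_monomial[OF s d])
  have e3: "frag_extend (edge_map D d) (monomial D (insert c s) bs) =
      (if (u, v) \<in> E1 then ?m (u # bs) + ?m (v # bs) else ?m bs)" for bs
    unfolding u_def v_def E1_def by (rule edge_map_monomial) (use s c d cd in auto)
  have e4: "frag_extend (edge_map D c) (monomial D (insert d s) bs) =
      (if (x, y) \<in> E2 then ?m (x # bs) + ?m (y # bs) else ?m bs)" for bs
    unfolding x_def y_def E2_def comm[symmetric] by (rule edge_map_monomial) (use s c d cd in auto)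
  have m_cong: "?m (a # bs) = ?m (b # bs)" if "(a, b) \<in> E3" for a b bs
    using that unfolding E3_def by (rule monomial_cong)
  \<comment> \<open>If the type of one edge depends on the other crossing, then so does the type of the other edge,
    and the two edges unite the same pair of circles or split the same circle.\<close>
  consider (same) "(x, y) \<in> E0 \<longleftrightarrow> (x, y) \<in> E2" "(u, v) \<in> E0 \<longleftrightarrow> (u, v) \<in> E1"
    | (merge) "(x, y) \<notin> E0" "(x, y) \<in> E2" "(u, v) \<notin> E0" "(u, v) \<in> E1"
    | (split) "(x, y) \<in> E0" "(x, y) \<notin> E2" "(u, v) \<in> E0" "(u, v) \<notin> E1"
  proof -
    \<comment> \<open>A merge enlarges the relation and a split shrinks it; these inclusions between
      the four relations leave no other combination.\<close>
    have 1: "(u, v) \<notin> E0 \<and> (u, v) \<in> E1" if "(x, y) \<notin> E0" "(x, y) \<in> E2"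
      using that J1 J2 J3 J4 joinedD eq by (metis subsetD)
    have 2: "(x, y) \<notin> E0 \<and> (x, y) \<in> E2" if "(u, v) \<notin> E0" "(u, v) \<in> E1"
      using that J1 J2 J3 J4 joinedD eq by (metis subsetD)
    have 3: "(u, v) \<in> E0 \<and> (u, v) \<notin> E1" if "(x, y) \<in> E0" "(x, y) \<notin> E2"
      using that J1 J2 J3 J4 joinedD eq by (metis subsetD)
    have 4: "(x, y) \<in> E0 \<and> (x, y) \<notin> E2" if "(u, v) \<in> E0" "(u, v) \<notin> E1"
      using that J1 J2 J3 J4 joinedD eq by (metis subsetD)
    from 1 2 3 4 that show thesis by blast
  qed
  then show ?thesis
  proof cases
    case same
    \<comment> \<open>If both edges split, the two orders give the same pairs of factors, only
      listed in reverse.\<close>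
    then show ?thesis
      using monomial_swap[of D "insert d (insert c s)"]
      by (simp add: e1 e2 e3 e4 frag_extend_add add_ac)
  next
    case merge
    then have j: "joined u v E3 E1" "joined x y E0 E1" "joined x y E3 E2"
      using J1 J3 J4 by (simp_all only: if_True if_False)
    \<comment> \<open>The edge at \<open>d\<close> separates \<open>x\<close> from \<open>y\<close>
      again, so \<open>x\<close>, \<open>y\<close> and \<open>u\<close>, \<open>v\<close> lie on the
      same two circles, and the two sums agree.\<close>
    have xy: "(x, y) \<in> E1" "(x, y) \<notin> E3"
      using joinedD(2)[OF j(2) eq(1)] joinedD(1)[OF j(3) eq(4)] by simp_all
    have "(x, u) \<in> E3 \<and> (y, v) \<in> E3 \<or> (x, v) \<in> E3 \<and> (y, u) \<in> E3"
      by (rule joined_new[OF j(1) eq(4) xy])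
    then have "?m (x # as) + ?m (y # as) = ?m (u # as) + ?m (v # as)"
      using m_cong[of x _ as] m_cong[of y _ as] by (elim disjE conjE) (simp_all add: add.commute)
    then show ?thesis using merge by (simp add: e1 e2 e3 e4)
  next
    case split
    then have j: "joined u v E1 E3" "joined x y E1 E0" "joined x y E2 E3"
      using J1 J3 J4 by (simp_all only: if_True if_False)
    \<comment> \<open>In the last state all four arcs lie on one circle, so either order multiplies
      by twice its class.\<close>
    have *: "(x, y) \<notin> E1" "(x, y) \<in> E3" "(u, v) \<in> E3" "E1 \<subseteq> E3"
      using joinedD[OF j(1) eq(2)] joinedD[OF j(2) eq(2)] joinedD[OF j(3) eq(3)] by simp_all
    then have "(x, u) \<in> E3 \<or> (x, v) \<in> E3"
      using joined_new[OF j(1) eq(2) *(2,1)] *(4) by blast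
    then have "?m (x # as) = ?m (u # as)" using m_cong *(3) by metis
    moreover have "?m (x # as) = ?m (y # as)" "?m (u # as) = ?m (v # as)" using m_cong * by auto
    ultimately show ?thesis using split by (simp add: e1 e2 e3 e4 frag_extend_add)
  qed
qed

lemma card_circles_edge:
  assumes "s \<subseteq> crossings D" "c \<in> crossings D - s"
  shows "if (ends D c 0, ends D c 2) \<in> state_equiv D s
    then card (circles D (insert c s)) = Suc (card (circles D s))
    else card (circles D s) = Suc (card (circles D (insert c s)))"
  using edge_joined[OF assms] assms(2) ends_in[of c] finite_arcs
    joined_card_quotient[OF equiv_generated_equiv, of "ends D c 0" "ends D c 2"]
  unfolding circles_def by (simp split: if_splits)

text \<open>Every added mark changes both sides. This turns the index of a chain group into the
  parity of the number of circles, the source of the minus signs in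
  \<open>- A_pow 2 - A_pow (- 2)\<close>.\<close>

lemma circles_parity:
  assumes "s \<subseteq> crossings D"
  shows "even (card (circles D s)) \<longleftrightarrow> even (card s + card (circles D {}))"
proof -
  have "finite s" using assms finite_crossings finite_subset by blast
  then show ?thesis using assms
  proof (induction s)
    case (insert c s)
    then have "even (card (circles D (insert c s))) \<longleftrightarrow> odd (card (circles D s))"
      using card_circles_edge[of s c] by (auto split: if_splits)
    then show ?case using insert by simp
  qed simp
qed

text \<open>Marking \<open>B\<close> lowers a(s) - b(s) by 2. A merge regains 2 by losing a circle;
  a split loses another 2, for which its additional factor of degree 4 makes up.\<close>

lemma monomial_deg_edge:
  assumes "s \<subseteq> crossings D" "c \<in> crossings D - s"
  shows "monomial_deg D (insert c s) as =
    monomial_deg D s as - (if (ends D c 0, ends D c 2) \<in> state_equiv D s then 4 else 0)"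
proof -
  have "finite s" using assms(1) finite_crossings finite_subset by blast
  have "crossings D - insert c s = (crossings D - s) - {c}" by auto
  then have "card (crossings D - s) = Suc (card (crossings D - insert c s))"
    using assms(2) finite_crossings card_Suc_Diff1[of "crossings D - s" c] by simp
  then show ?thesis
    using card_circles_edge[OF assms] assms(2) \<open>finite s\<close>
    by (auto simp: monomial_deg_def num_A_def num_B_def split: if_splits)
qed

lemma edge_map_in_chains:
  assumes "s \<subseteq> crossings D" "c \<in> crossings D - s" "set as \<subseteq> arcs D"
  shows "frag_extend (edge_map D c) (monomial D s as) \<in> carrier (free_Abelian_group
    (bracket_basis D (1 - state_parity D s) (monomial_deg D s as)))"
proof -
  have s': "insert c s \<in> states D" using assms by (auto simp: states_def)
  have "finite s" using assms(1) finite_crossings finite_subset by blast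
  then have par: "state_parity D (insert c s) = 1 - state_parity D s"
    using assms(2) unfolding state_parity_def by simp presburger
  have in_chains: "monomial D (insert c s) bs \<in> carrier (free_Abelian_group
      (bracket_basis D (1 - state_parity D s) (monomial_deg D (insert c s) bs)))"
    if "set bs \<subseteq> arcs D" for bs
    using monomial_in_chains[OF finite_arcs s' that] by (simp add: par)
  show ?thesis
  proof (cases "(ends D c 0, ends D c 2) \<in> state_equiv D s")
    case True
    have deg: "monomial_deg D (insert c s) (a # as) = monomial_deg D s as" for a
      using True monomial_deg_edge[OF assms(1,2), of "a # as"] by (simp add: monomial_deg_def)
    have "ends D c 0 \<in> arcs D" "ends D c 2 \<in> arcs D" using ends_in assms(2) by auto
    then show ?thesis
      using True in_chains[of "ends D c 0 # as"] in_chains[of "ends D c 2 # as"] assms(3)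
      by (simp add: edge_map_monomial[OF assms(1,2)] deg keys_add[THEN subset_trans])
  next
    case False
    then show ?thesis
      using in_chains[OF assms(3)] monomial_deg_edge[OF assms(1,2), of as]
      by (simp add: edge_map_monomial[OF assms(1,2)])
  qed
qed

lemma bracket_bdry_monomial:
  assumes "state_parity D s = i"
  shows "bracket_bdry D r i (monomial D s as) =
    (\<Sum>c\<in>crossings D - s. frag_cmul (edge_sign r s c) (frag_extend (edge_map D c) (monomial D s as)))"
proof -
  have "{c. c \<in> crossings D - s \<and> (card s + card (circles D {})) mod 2 = i} = crossings D - s"
    using assms by (auto simp: state_parity_def)
  then show ?thesis by (simp add: bracket_bdry_def monomial_def)
qed

lemma bracket_bdry_edge:
  assumes "s \<subseteq> crossings D" "c \<in> crossings D - s"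
  shows "bracket_bdry D r (1 - state_parity D s) (frag_extend (edge_map D c) (monomial D s as)) =
    (\<Sum>d\<in>crossings D - insert c s. frag_cmul (edge_sign r (insert c s) d)
      (frag_extend (edge_map D d) (frag_extend (edge_map D c) (monomial D s as))))"
proof -
  have "finite s" using assms(1) finite_crossings finite_subset by blast
  then have par: "state_parity D (insert c s) = 1 - state_parity D s"
    using assms(2) unfolding state_parity_def by simp presburger
  have add: "bracket_bdry D r i (p + q) = bracket_bdry D r i p + bracket_bdry D r i q" for i p q
    by (simp add: bracket_bdry_def frag_extend_add)
  show ?thesis
    unfolding edge_map_monomial[OF assms]
    by (simp add: add bracket_bdry_monomial[OF par] frag_extend_add frag_cmul_distrib2 sum.distrib
        del: One_nat_def)
qed

text \<open>Every two crossings are changed in both orders; the composites agree and their signs are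
  opposite.\<close>

lemma bracket_bdry_bdry_monomial:
  assumes "linear_order_on (crossings D) r" "s \<subseteq> crossings D"
  shows "bracket_bdry D r (1 - state_parity D s) (bracket_bdry D r (state_parity D s) (monomial D s as)) = 0"
proof -
  let ?X = "crossings D - s" and ?b = "bracket_bdry D r (1 - state_parity D s)"
  let ?Q = "\<lambda>c d. frag_extend (edge_map D d) (frag_extend (edge_map D c) (monomial D s as))"
  let ?f = "\<lambda>c d. frag_cmul (edge_sign r s c * edge_sign r (insert c s) d) (?Q c d)"
  have fin: "finite ?X" "finite s" using finite_crossings assms(2) finite_subset by auto
  have "?b (\<Sum>c\<in>?X. frag_cmul (edge_sign r s c) (frag_extend (edge_map D c) (monomial D s as))) =
      (\<Sum>c\<in>?X. frag_cmul (edge_sign r s c) (?b (frag_extend (edge_map D c) (monomial D s as))))"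
    unfolding bracket_bdry_def using fin by (simp add: frag_extend_sum frag_extend_cmul o_def)
  also have "\<dots> = (\<Sum>c\<in>?X. \<Sum>d\<in>?X - {c}. ?f c d)"
  proof (rule sum.cong)
    fix c assume "c \<in> ?X"
    moreover have "crossings D - insert c s = ?X - {c}" by auto
    ultimately show "frag_cmul (edge_sign r s c) (?b (frag_extend (edge_map D c) (monomial D s as))) =
        (\<Sum>d\<in>?X - {c}. ?f c d)"
      using bracket_bdry_edge[OF assms(2), of c r as] fin by (simp add: frag_cmul_sum)
  qed simp
  also have "\<dots> = 0"
  proof (rule antisymmetric_sum_eq_0[OF fin(1)])
    fix c d assume cd: "c \<in> ?X" "d \<in> ?X" "c \<noteq> d"
    then show "?f c d = - ?f d c"
      using edge_square[OF assms(2) cd] edge_sign_anticommute[OF assms(1), of c d s] fin by simp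
  qed
  finally show ?thesis by (simp add: bracket_bdry_monomial)
qed

lemma basis_monomial:
  assumes "b \<in> bracket_basis D i j"
  obtains s as where "s \<in> states D" "set as \<subseteq> arcs D" "state_parity D s = i"
    "monomial_deg D s as = j" "frag_of b = monomial D s as"
proof -
  obtain s v where b: "b = (s, v)" "(s, v) \<in> enhanced_states D" "state_parity D s = i" "state_deg D (s, v) = j"
    using assms by (auto simp: bracket_basis_def state_parity_def)
  then obtain as where as: "set as \<subseteq> arcs D" "distinct (map (circle_through D s) as)"
    "mark D s as = v" "monomial D s as = frag_of (s, v)"
    using enhanced_state_monomial[OF finite_arcs] by blast
  have s: "s \<in> states D" using b by (auto simp: enhanced_states_def)
  have "(s, v) \<in> bracket_basis D (state_parity D s) (monomial_deg D s as)"
    using monomial_in_chains[OF finite_arcs s as(1)] as(4) by simp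
  then have "monomial_deg D s as = j" using b by (simp add: bracket_basis_def)
  then show ?thesis using that b s as by metis
qed

lemma bracket_bdry_hom:
  "bracket_bdry D r i \<in> hom (free_Abelian_group (bracket_basis D i j)) (free_Abelian_group (bracket_basis D (1 - i) j))"
proof (rule homI)
  fix x y
  show "bracket_bdry D r i (x \<otimes>\<^bsub>free_Abelian_group (bracket_basis D i j)\<^esub> y) =
      bracket_bdry D r i x \<otimes>\<^bsub>free_Abelian_group (bracket_basis D (1 - i) j)\<^esub> bracket_bdry D r i y"
    by (simp add: bracket_bdry_def frag_extend_add)
next
  fix x assume "x \<in> carrier (free_Abelian_group (bracket_basis D i j))"
  then have "Poly_Mapping.keys x \<subseteq> bracket_basis D i j" by simp
  then show "bracket_bdry D r i x \<in> carrier (free_Abelian_group (bracket_basis D (1 - i) j))"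
  proof (induction rule: frag_induction)
    case zero
    then show ?case by (simp add: bracket_bdry_def)
  next
    case (diff x y)
    then show ?case
      using keys_diff[of "bracket_bdry D r i x" "bracket_bdry D r i y"]
      by (auto simp: bracket_bdry_def frag_extend_diff)
  next
    case (one b)
    then obtain s as where *: "s \<in> states D" "set as \<subseteq> arcs D" "state_parity D s = i"
      "monomial_deg D s as = j" "frag_of b = monomial D s as" by (rule basis_monomial)
    have "frag_cmul (edge_sign r s c) (frag_extend (edge_map D c) (monomial D s as)) \<in>
        carrier (free_Abelian_group (bracket_basis D (1 - i) j))" if "c \<in> crossings D - s" for c
      using edge_map_in_chains[of s c as] that * keys_cmul by (fastforce simp: states_def)
    then show ?case
      unfolding *(5) bracket_bdry_monomial[OF *(3)] by (rule sum_closed_free_Abelian_group)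
  qed
qed

lemma bracket_bdry_bdry:
  assumes "linear_order_on (crossings D) r" "x \<in> carrier (free_Abelian_group (bracket_basis D i j))"
  shows "bracket_bdry D r (1 - i) (bracket_bdry D r i x) = 0"
proof -
  have "Poly_Mapping.keys x \<subseteq> bracket_basis D i j" using assms(2) by simp
  then show ?thesis
  proof (induction rule: frag_induction)
    case zero
    then show ?case by (simp add: bracket_bdry_def)
  next
    case (diff x y)
    then show ?case by (simp add: bracket_bdry_def frag_extend_diff)
  next
    case (one b)
    then obtain s as where "s \<in> states D" "set as \<subseteq> arcs D" "state_parity D s = i"
      "monomial_deg D s as = j" "frag_of b = monomial D s as" by (rule basis_monomial)
    then show ?case using bracket_bdry_bdry_monomial[OF assms(1), of s as] by (simp add: states_def)
  qed
qed

end

section \<open>Ranks of subquotients of free abelian groups\<close>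

lemma lookup_scale: "Poly_Mapping.lookup (Poly_Mapping.map ((*) q) x) k = q * Poly_Mapping.lookup x k"
  for q :: rat
  by (simp add: Poly_Mapping.map.rep_eq when_def)

interpretation frag_rat: vector_space "\<lambda>q :: rat. Poly_Mapping.map ((*) q) :: ('b \<Rightarrow>\<^sub>0 rat) \<Rightarrow> ('b \<Rightarrow>\<^sub>0 rat)"
  by unfold_locales
    (auto intro!: poly_mapping_eqI simp: lookup_scale lookup_add algebra_simps)

text \<open>The embedding of the free abelian group into the rational vector space on the same
  basis, where dimension theory is available.\<close>

definition rationalize :: "('b \<Rightarrow>\<^sub>0 int) \<Rightarrow> ('b \<Rightarrow>\<^sub>0 rat)" where
  "rationalize = Poly_Mapping.map of_int"

lemma lookup_rationalize: "Poly_Mapping.lookup (rationalize x) k = of_int (Poly_Mapping.lookup x k)"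
  by (simp add: rationalize_def Poly_Mapping.map.rep_eq when_def)

lemma inj_rationalize: "inj rationalize"
proof (rule injI)
  fix x y :: "'b \<Rightarrow>\<^sub>0 int" assume "rationalize x = rationalize y"
  then have "Poly_Mapping.lookup (rationalize x) k = Poly_Mapping.lookup (rationalize y) k" for k by simp
  then show "x = y" by (intro poly_mapping_eqI) (simp add: lookup_rationalize)
qed

lemma rationalize_0 [simp]: "rationalize 0 = 0"
  by (intro poly_mapping_eqI) (simp add: lookup_rationalize)

lemma rationalize_add: "rationalize (x + y) = rationalize x + rationalize y"
  by (intro poly_mapping_eqI) (simp add: lookup_rationalize lookup_add)

lemma rationalize_sum: "rationalize (\<Sum>i\<in>I. f i) = (\<Sum>i\<in>I. rationalize (f i))"
  by (induction I rule: infinite_finite_induct) (auto simp: rationalize_add)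

lemma rationalize_cmul: "rationalize (frag_cmul n x) = Poly_Mapping.map ((*) (of_int n)) (rationalize x)"
  by (intro poly_mapping_eqI) (simp add: lookup_rationalize lookup_scale)

lemma clear_denominators:
  assumes "finite U"
  obtains N :: int and c :: "'a \<Rightarrow> int"
  where "N \<noteq> 0" and "\<And>u. u \<in> U \<Longrightarrow> rat_of_int (c u) = of_int N * q u"
proof -
  have "\<exists>N c. N \<noteq> 0 \<and> (\<forall>u\<in>U. rat_of_int (c u) = of_int N * q u)"
    using assms
  proof (induction U)
    case (insert u U)
    then obtain N c where Nc: "N \<noteq> 0" "\<forall>u\<in>U. rat_of_int (c u) = of_int N * q u" by blast
    obtain a b where ab: "quotient_of (q u) = (a, b)" by (cases "quotient_of (q u)")
    then have b: "b > 0" "q u = of_int a / of_int b"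
      by (auto simp: quotient_of_denom_pos quotient_of_div)
    let ?c = "\<lambda>w. if w = u then N * a else b * c w"
    have "\<forall>w\<in>insert u U. rat_of_int (?c w) = of_int (N * b) * q w"
      using b Nc(2) by simp
    moreover have "N * b \<noteq> 0" using Nc b by simp
    ultimately show ?case by (intro exI[of _ "N * b"] exI[of _ ?c] conjI)
  qed (auto intro: exI[of _ 1])
  then show ?thesis using that by blast
qed

definition frag_independent :: "('b \<Rightarrow>\<^sub>0 int) set \<Rightarrow> bool" where
  "frag_independent U \<longleftrightarrow> finite U \<and>
    (\<forall>c. (\<Sum>u\<in>U. frag_cmul (c u) u) = 0 \<longrightarrow> (\<forall>u\<in>U. c u = 0))"

text \<open>A rational relation becomes an integral one after multiplication by a common
  denominator.\<close>

lemma frag_independent_iff: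
  fixes U :: "('b \<Rightarrow>\<^sub>0 int) set"
  assumes "finite U"
  shows "frag_independent U \<longleftrightarrow> frag_rat.independent (rationalize ` U)"
proof -
  have inj: "inj_on rationalize U" using inj_rationalize inj_on_subset by blast
  have dep: "frag_rat.independent (rationalize ` U) \<longleftrightarrow>
      (\<forall>q. (\<Sum>u\<in>U. Poly_Mapping.map ((*) (q (rationalize u))) (rationalize u)) = 0 \<longrightarrow>
        (\<forall>u\<in>U. q (rationalize u) = 0))"
    using frag_rat.dependent_finite[of "rationalize ` U"] assms
    by (simp add: sum.reindex[OF inj] o_def) blast
  show ?thesis unfolding dep
  proof
    assume ind: "frag_independent U"
    show "\<forall>q. (\<Sum>u\<in>U. Poly_Mapping.map ((*) (q (rationalize u))) (rationalize u)) = 0 \<longrightarrow>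
        (\<forall>u\<in>U. q (rationalize u) = 0)"
    proof (intro allI impI ballI)
      fix q :: "('b \<Rightarrow>\<^sub>0 rat) \<Rightarrow> rat" and u
      assume sum: "(\<Sum>u\<in>U. Poly_Mapping.map ((*) (q (rationalize u))) (rationalize u)) = 0" and u: "u \<in> U"
      obtain N c where Nc: "N \<noteq> 0" "\<And>u. u \<in> U \<Longrightarrow> rat_of_int (c u) = of_int N * q (rationalize u)"
        using clear_denominators[OF assms, of "\<lambda>u. q (rationalize u)"] by blast
      have "rationalize (\<Sum>u\<in>U. frag_cmul (c u) u) =
          (\<Sum>u\<in>U. Poly_Mapping.map ((*) (of_int N)) (Poly_Mapping.map ((*) (q (rationalize u))) (rationalize u)))"
        unfolding rationalize_sum
        by (intro sum.cong refl) (simp add: rationalize_cmul Nc frag_rat.scale_scale)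
      also have "\<dots> = 0"
        unfolding frag_rat.scale_sum_right[symmetric] sum by (rule frag_rat.scale_zero_right)
      finally have "(\<Sum>u\<in>U. frag_cmul (c u) u) = 0"
        using inj_rationalize by (metis injD rationalize_0)
      then have "c u = 0" using ind u by (auto simp: frag_independent_def)
      then show "q (rationalize u) = 0" using Nc(2)[OF u] Nc(1) by simp
    qed
  next
    assume ind: "\<forall>q. (\<Sum>u\<in>U. Poly_Mapping.map ((*) (q (rationalize u))) (rationalize u)) = 0 \<longrightarrow>
        (\<forall>u\<in>U. q (rationalize u) = 0)"
    show "frag_independent U"
      unfolding frag_independent_def
    proof (intro conjI allI impI assms)
      fix c :: "('b \<Rightarrow>\<^sub>0 int) \<Rightarrow> int" assume "(\<Sum>u\<in>U. frag_cmul (c u) u) = 0"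
      then have "rationalize (\<Sum>u\<in>U. frag_cmul (c u) u) = 0" by simp
      moreover define q where "q w = rat_of_int (c (inv_into UNIV rationalize w))" for w
      then have "q (rationalize u) = of_int (c u)" for u by (simp add: inj_rationalize inv_f_f)
      ultimately show "\<forall>u\<in>U. c u = 0"
        using ind[rule_format, of q] by (simp add: rationalize_sum rationalize_cmul)
    qed
  qed
qed

text \<open>An integral vector in the rational span need not be an integral combination; a nonzero
  multiple of it is.\<close>

lemma frag_eq_combination:
  assumes "finite T" "rationalize x \<in> frag_rat.span (rationalize ` T)"
  obtains N d where "N \<noteq> 0" "frag_cmul N x = (\<Sum>t\<in>T. frag_cmul (d t) t)"
proof -
  have inj: "inj_on rationalize T" using inj_rationalize inj_on_subset by blast
  obtain q where q: "rationalize x = (\<Sum>t\<in>T. Poly_Mapping.map ((*) (q (rationalize t))) (rationalize t))"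
    using assms frag_rat.span_finite[of "rationalize ` T"] by (auto simp: sum.reindex[OF inj])
  obtain N d where N: "N \<noteq> 0" "\<And>t. t \<in> T \<Longrightarrow> rat_of_int (d t) = of_int N * q (rationalize t)"
    using clear_denominators[OF assms(1), of "\<lambda>t. q (rationalize t)"] by blast
  have "rationalize (frag_cmul N x) = rationalize (\<Sum>t\<in>T. frag_cmul (d t) t)"
    unfolding rationalize_sum rationalize_cmul q frag_rat.scale_sum_right
    by (intro sum.cong refl) (simp add: N frag_rat.scale_scale)
  then show ?thesis by (intro that[OF N(1)] injD[OF inj_rationalize])
qed

lemma frag_of_span: "rationalize x \<in> frag_rat.span (rationalize ` frag_of ` S)"
  if "Poly_Mapping.keys x \<subseteq> S"
proof -
  have "rationalize x = rationalize (frag_extend frag_of x)" by (simp flip: frag_expansion)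
  also have "\<dots> \<in> frag_rat.span (rationalize ` frag_of ` S)"
    unfolding frag_extend_def rationalize_sum rationalize_cmul using that
    by (intro frag_rat.span_sum frag_rat.span_scale frag_rat.span_base) blast
  finally show ?thesis .
qed

lemma frag_independent_frag_of:
  fixes S :: "'b set"
  assumes "finite S"
  shows "frag_independent (frag_of ` S)"
  unfolding frag_independent_def
proof (intro conjI allI impI ballI)
  fix c :: "('b \<Rightarrow>\<^sub>0 int) \<Rightarrow> int" and u :: "'b \<Rightarrow>\<^sub>0 int"
  assume sum: "(\<Sum>u\<in>frag_of ` S. frag_cmul (c u) u) = 0" and "u \<in> frag_of ` S"
  then obtain s where s: "s \<in> S" "u = frag_of s" by blast
  have inj: "inj_on frag_of S" by (auto simp: inj_on_def frag_of_eq)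
  have "0 = Poly_Mapping.lookup (\<Sum>u\<in>frag_of ` S. frag_cmul (c u) u) s" by (simp add: sum)
  also have "\<dots> = (\<Sum>t\<in>S. c (frag_of t) * Poly_Mapping.lookup (frag_of t) s)"
    by (simp add: sum.reindex[OF inj] lookup_sum)
  also have "\<dots> = (\<Sum>t\<in>S. if t = s then c (frag_of t) else 0)"
    by (intro sum.cong) (auto simp: lookup_frag_of)
  also have "\<dots> = c u" using s assms by simp
  finally show "c u = 0" by simp
qed (use assms in simp)

text \<open>\<open>dim\<close> refers to the span of a set, so this is the rank of \<open>A\<close>
  when \<open>A\<close> is a subgroup.\<close>

definition rational_rank :: "('b \<Rightarrow>\<^sub>0 int) set \<Rightarrow> nat" where
  "rational_rank A = frag_rat.dim (rationalize ` A)"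

lemma rational_rank_free:
  assumes "finite S"
  shows "rational_rank (carrier (free_Abelian_group S)) = card S"
proof -
  have inj: "inj_on (rationalize \<circ> frag_of) S"
    by (rule comp_inj_on[OF _ inj_on_subset[OF inj_rationalize subset_UNIV]])
      (auto simp: inj_on_def frag_of_eq)
  have "frag_rat.independent (rationalize ` frag_of ` S)"
    using frag_independent_iff frag_independent_frag_of assms by blast
  then have "frag_rat.dim (rationalize ` carrier (free_Abelian_group S)) = card (rationalize ` frag_of ` S)"
    using frag_of_span[of _ S]
    by (intro frag_rat.dim_unique[OF _ _ _ refl]) (auto simp: image_subset_iff)
  then show ?thesis
    using card_image[OF inj] by (simp add: rational_rank_def image_comp)
qed

text \<open>The basis is picked inside the image of \<open>A\<close>, so it consists of integral
  vectors; the finite support bounds its size.\<close>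

lemma frag_basis_extend:
  assumes "finite S" "\<And>x. x \<in> A \<Longrightarrow> Poly_Mapping.keys x \<subseteq> S" "T \<subseteq> A" "frag_independent T"
  obtains W where "T \<subseteq> W" "W \<subseteq> A" "frag_independent W" "card W = rational_rank A"
    "rationalize ` A \<subseteq> frag_rat.span (rationalize ` W)"
proof -
  have "finite T" using assms(4) by (simp add: frag_independent_def)
  then have ind: "frag_rat.independent (rationalize ` T)" using assms(4) frag_independent_iff by blast
  obtain Bs where Bs: "rationalize ` T \<subseteq> Bs" "Bs \<subseteq> rationalize ` A"
    "frag_rat.independent Bs" "rationalize ` A \<subseteq> frag_rat.span Bs"
    by (rule frag_rat.maximal_independent_subset_extend[OF image_mono[OF assms(3)] ind]) (rule that)
  have "rationalize ` A \<subseteq> frag_rat.span (rationalize ` frag_of ` S)"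
    by (intro image_subsetI frag_of_span assms(2))
  then have fin: "finite Bs"
    using frag_rat.independent_span_bound[of "rationalize ` frag_of ` S" Bs] Bs assms(1) by blast
  define W where "W = rationalize -` Bs"
  have Bs_W: "Bs = rationalize ` W" using Bs(2) unfolding W_def by blast
  have inj: "inj_on rationalize X" for X :: "('b \<Rightarrow>\<^sub>0 int) set"
    using inj_rationalize inj_on_subset by blast
  have finW: "finite W" using fin Bs_W finite_imageD[OF _ inj] by blast
  show ?thesis
  proof (rule that[of W])
    show "T \<subseteq> W" using Bs(1) by (auto simp: W_def)
    show "W \<subseteq> A" using Bs(2) inj_rationalize by (auto simp: W_def dest: injD)
    show "frag_independent W" using frag_independent_iff[OF finW] Bs(3) Bs_W by simp
    have "card Bs = frag_rat.dim (rationalize ` A)"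
      using frag_rat.basis_card_eq_dim Bs by blast
    then show "card W = rational_rank A"
      unfolding Bs_W rational_rank_def by (simp add: card_image[OF inj])
    show "rationalize ` A \<subseteq> frag_rat.span (rationalize ` W)" using Bs(4) Bs_W by simp
  qed
qed

lemma frag_independent_card_le:
  assumes "finite S" "\<And>x. x \<in> A \<Longrightarrow> Poly_Mapping.keys x \<subseteq> S" "U \<subseteq> A" "frag_independent U"
  shows "card U \<le> rational_rank A"
proof -
  obtain W where W: "U \<subseteq> W" "frag_independent W" "card W = rational_rank A"
    using frag_basis_extend[OF assms] by metis
  then show ?thesis by (metis card_mono frag_independent_def)
qed

text \<open>A subgroup \<open>A\<close> of a free abelian group of finite rank with a surjection
  onto a commutative group. This covers the image of a boundary, both as a quotient of its domain
  and as a subgroup of its target, and any group isomorphic to the homology, so that ranks need no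
  transport along isomorphisms.\<close>

locale frag_quotient = comm_group G for G :: "'a monoid" (structure) +
  fixes A :: "('b \<Rightarrow>\<^sub>0 int) set" and S :: "'b set" and \<pi> :: "('b \<Rightarrow>\<^sub>0 int) \<Rightarrow> 'a"
  assumes finite_support: "finite S" and support: "x \<in> A \<Longrightarrow> Poly_Mapping.keys x \<subseteq> S"
    and zero_mem: "0 \<in> A" and diff_mem: "x \<in> A \<Longrightarrow> y \<in> A \<Longrightarrow> x - y \<in> A"
    and hom_add: "x \<in> A \<Longrightarrow> y \<in> A \<Longrightarrow> \<pi> (x + y) = \<pi> x \<otimes> \<pi> y"
    and surj: "\<pi> ` A = carrier G"
begin

definition Ker :: "('b \<Rightarrow>\<^sub>0 int) set" where
  "Ker = {x \<in> A. \<pi> x = \<one>}"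

lemma add_mem: "x \<in> A \<Longrightarrow> y \<in> A \<Longrightarrow> x + y \<in> A"
  using diff_mem[of x "0 - y"] diff_mem[of 0 y] zero_mem by simp

lemma uminus_mem: "x \<in> A \<Longrightarrow> - x \<in> A"
  using diff_mem[of 0 x] zero_mem by simp

lemma cmul_mem: "x \<in> A \<Longrightarrow> frag_cmul c x \<in> A"
proof -
  assume x: "x \<in> A"
  have nat: "frag_cmul (int n) x \<in> A" for n
    by (induction n) (auto simp: zero_mem frag_cmul_distrib intro: add_mem x)
  show ?thesis
    using nat uminus_mem[OF nat] by (cases c rule: int_cases2) auto
qed

lemma sum_mem: "(\<And>i. i \<in> I \<Longrightarrow> f i \<in> A) \<Longrightarrow> (\<Sum>i\<in>I. f i) \<in> A"
  by (induction I rule: infinite_finite_induct) (auto simp: zero_mem intro: add_mem)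

lemma hom_closed: "x \<in> A \<Longrightarrow> \<pi> x \<in> carrier G"
  using surj by blast

lemma hom_zero: "\<pi> 0 = \<one>"
  using hom_add[of 0 0] zero_mem hom_closed[of 0] by (metis add.left_neutral l_cancel_one')

lemma hom_uminus: "x \<in> A \<Longrightarrow> \<pi> (- x) = inv (\<pi> x)"
  using hom_add[of "- x" x] hom_zero uminus_mem hom_closed
  by (metis add.left_inverse inv_equality)

lemma hom_cmul: "x \<in> A \<Longrightarrow> \<pi> (frag_cmul c x) = \<pi> x [^] c"
proof -
  assume x: "x \<in> A"
  have nat: "\<pi> (frag_cmul (int n) x) = \<pi> x [^] n" for n
  proof (induction n)
    case (Suc n)
    have "frag_cmul (int (Suc n)) x = frag_cmul (int n) x + x"
      by (simp add: frag_cmul_distrib add.commute)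
    then show ?case using Suc hom_add[OF cmul_mem[OF x] x] by simp
  qed (simp add: hom_zero)
  show ?thesis
  proof (cases c rule: int_cases2)
    case (nonneg n)
    then show ?thesis by (simp add: nat int_pow_int)
  next
    case (nonpos n)
    then have "\<pi> (frag_cmul c x) = inv (\<pi> x [^] n)"
      using hom_uminus[OF cmul_mem[OF x, of "int n"]] nat by simp
    then show ?thesis using nonpos by (simp add: int_pow_neg int_pow_int hom_closed[OF x])
  qed
qed

lemma hom_sum:
  assumes "finite I" "\<And>i. i \<in> I \<Longrightarrow> f i \<in> A"
  shows "\<pi> (\<Sum>i\<in>I. f i) = (\<Otimes>i\<in>I. \<pi> (f i))"
  using assms
proof (induction I)
  case (insert i I)
  then show ?case
    using hom_closed by (simp add: hom_add sum_mem finprod_insert Pi_def)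
qed (simp add: hom_zero)

lemma Ker_uminus: "x \<in> Ker \<Longrightarrow> - x \<in> Ker"
  by (auto simp: Ker_def uminus_mem hom_uminus)

lemma Ker_combination:
  assumes "finite T" "T \<subseteq> Ker"
  shows "(\<Sum>t\<in>T. frag_cmul (d t) t) \<in> Ker"
proof -
  have "\<pi> (\<Sum>t\<in>T. frag_cmul (d t) t) = (\<Otimes>t\<in>T. \<pi> (frag_cmul (d t) t))"
    by (rule hom_sum) (use assms cmul_mem in \<open>auto simp: Ker_def\<close>)
  also have "\<dots> = (\<Otimes>t\<in>T. \<one>)"
    by (rule finprod_cong') (use assms in \<open>auto simp: Ker_def hom_cmul\<close>)
  also have "\<dots> = \<one>" by simp
  finally show ?thesis
    using assms cmul_mem by (auto simp: Ker_def intro!: sum_mem)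
qed

text \<open>The pullback of \<open>Z_independent\<close> along \<open>\<pi>\<close>, which turns
  independence in \<open>G\<close> into a property of vectors.\<close>

definition independent_mod :: "('b \<Rightarrow>\<^sub>0 int) set \<Rightarrow> bool" where
  "independent_mod U \<longleftrightarrow> finite U \<and> U \<subseteq> A \<and>
    (\<forall>c. (\<Sum>u\<in>U. frag_cmul (c u) u) \<in> Ker \<longrightarrow> (\<forall>u\<in>U. c u = 0))"

lemma hom_combination:
  assumes "finite U" "U \<subseteq> A" "inj_on \<pi> U"
  shows "(\<Otimes>x\<in>\<pi> ` U. x [^] c x) = \<pi> (\<Sum>u\<in>U. frag_cmul (c (\<pi> u)) u)"
proof -
  have "(\<Otimes>x\<in>\<pi> ` U. x [^] c x) = (\<Otimes>u\<in>U. \<pi> u [^] c (\<pi> u))"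
    using assms hom_closed by (intro finprod_reindex) (auto simp: Pi_def)
  also have "\<dots> = (\<Otimes>u\<in>U. \<pi> (frag_cmul (c (\<pi> u)) u))"
    using assms hom_closed by (intro finprod_cong') (auto simp: hom_cmul)
  also have "\<dots> = \<pi> (\<Sum>u\<in>U. frag_cmul (c (\<pi> u)) u)"
    using assms cmul_mem by (intro hom_sum[symmetric]) auto
  finally show ?thesis .
qed

lemma independent_mod_lift:
  assumes "Z_independent G X"
  obtains U where "independent_mod U" "card U = card X"
proof -
  have X: "finite X" "X \<subseteq> carrier G" using assms by (auto simp: Z_independent_def)
  define g where "g = inv_into A \<pi>"
  have g: "g x \<in> A" "\<pi> (g x) = x" if "x \<in> X" for x
    using that X surj unfolding g_def by (auto simp: inv_into_into f_inv_into_f)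
  have inj: "inj_on g X" "inj_on \<pi> (g ` X)" and img: "\<pi> ` g ` X = X"
    using g by (auto simp: inj_on_def image_image) metis
  have "independent_mod (g ` X)"
    unfolding independent_mod_def
  proof (intro conjI allI impI)
    fix c assume "(\<Sum>u\<in>g ` X. frag_cmul (c u) u) \<in> Ker"
    moreover have "(\<Sum>u\<in>g ` X. frag_cmul (c u) u) = (\<Sum>u\<in>g ` X. frag_cmul (c (g (\<pi> u))) u)"
      using g by (intro sum.cong) auto
    ultimately have "(\<Otimes>x\<in>X. x [^] c (g x)) = \<one>"
      using hom_combination[of "g ` X" "\<lambda>x. c (g x)"] X g inj(2) img by (auto simp: Ker_def)
    then show "\<forall>u\<in>g ` X. c u = 0"
      using assms by (auto simp: Z_independent_def dest: spec[of _ "\<lambda>x. c (g x)"])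
  qed (use X g in auto)
  then show ?thesis using that card_image[OF inj(1)] by blast
qed

lemma independent_mod_image:
  assumes "independent_mod U"
  shows "Z_independent G (\<pi> ` U)" "card (\<pi> ` U) = card U"
proof -
  have U: "finite U" "U \<subseteq> A"
    and ind: "(\<Sum>u\<in>U. frag_cmul (c u) u) \<in> Ker \<Longrightarrow> u \<in> U \<Longrightarrow> c u = 0" for c u
    using assms by (auto simp: independent_mod_def)
  have inj: "inj_on \<pi> U"
  proof (rule inj_onI, rule ccontr)
    fix u w assume uw: "u \<in> U" "w \<in> U" "\<pi> u = \<pi> w" "u \<noteq> w"
    define c where "c z = (if z = u then 1 else if z = w then -1 else 0 :: int)" for z
    have "(\<Sum>z\<in>U. frag_cmul (c z) z) = (\<Sum>z\<in>{u, w}. frag_cmul (c z) z)"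
      using U uw by (intro sum.mono_neutral_right) (auto simp: c_def)
    also have "\<dots> = u + - w" using uw by (simp add: c_def)
    also have "\<dots> \<in> Ker"
    proof -
      have A: "u \<in> A" "w \<in> A" using uw U by auto
      then have "\<pi> (u + - w) = \<one>"
        using hom_add[OF A(1) uminus_mem[OF A(2)]] hom_closed uw by (simp add: hom_uminus)
      then show ?thesis
        using add_mem[OF A(1) uminus_mem[OF A(2)]] unfolding Ker_def by blast
    qed
    finally show False using ind[of c u] uw by (simp add: c_def)
  qed
  then show "card (\<pi> ` U) = card U" by (rule card_image)
  show "Z_independent G (\<pi> ` U)"
    unfolding Z_independent_def
  proof (intro conjI allI impI)
    fix c :: "'a \<Rightarrow> int" assume "(\<Otimes>x\<in>\<pi> ` U. x [^] c x) = \<one>"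
    then have "(\<Sum>u\<in>U. frag_cmul (c (\<pi> u)) u) \<in> Ker"
      using hom_combination[OF U inj, of c] U cmul_mem by (auto simp: Ker_def intro!: sum_mem)
    then show "\<forall>x\<in>\<pi> ` U. c x = 0" using ind[of "\<lambda>u. c (\<pi> u)"] by auto
  qed (use U hom_closed in auto)
qed

lemma independent_mod_Un:
  assumes "independent_mod U" "frag_independent T" "T \<subseteq> Ker"
  shows "T \<inter> U = {}" "frag_independent (T \<union> U)"
proof -
  have U: "finite U" "U \<subseteq> A" and T: "finite T"
    and indU: "(\<Sum>u\<in>U. frag_cmul (c u) u) \<in> Ker \<Longrightarrow> u \<in> U \<Longrightarrow> c u = 0"
    and indT: "(\<Sum>u\<in>T. frag_cmul (c u) u) = 0 \<Longrightarrow> u \<in> T \<Longrightarrow> c u = 0" for c u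
    using assms by (auto simp: independent_mod_def frag_independent_def)
  show disj: "T \<inter> U = {}"
  proof (rule ccontr)
    assume "T \<inter> U \<noteq> {}"
    then obtain u where u: "u \<in> Ker" "u \<in> U" using assms(3) by blast
    have "(\<Sum>z\<in>U. frag_cmul (if z = u then 1 else 0) z) = (\<Sum>z\<in>{u}. frag_cmul (if z = u then 1 else 0) z)"
      using U u by (intro sum.mono_neutral_right) auto
    then have "(\<Sum>z\<in>U. frag_cmul (if z = u then 1 else 0) z) \<in> Ker" using u by simp
    then show False using indU[of "\<lambda>z. if z = u then 1 else 0" u] u by simp
  qed
  show "frag_independent (T \<union> U)"
    unfolding frag_independent_def
  proof (intro conjI allI impI)
    fix c assume "(\<Sum>u\<in>T \<union> U. frag_cmul (c u) u) = 0"
    then have sum: "(\<Sum>u\<in>T. frag_cmul (c u) u) + (\<Sum>u\<in>U. frag_cmul (c u) u) = 0"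
      using T U disj by (simp add: sum.union_disjoint)
    then have "(\<Sum>u\<in>U. frag_cmul (c u) u) = - (\<Sum>u\<in>T. frag_cmul (c u) u)"
      by (simp add: eq_neg_iff_add_eq_0 add.commute)
    then have "(\<Sum>u\<in>U. frag_cmul (c u) u) \<in> Ker"
      using Ker_uminus[OF Ker_combination[OF T assms(3), of c]] by simp
    then have cU: "c u = 0" if "u \<in> U" for u using indU that by blast
    then have "(\<Sum>u\<in>T. frag_cmul (c u) u) = 0" using sum by simp
    then show "\<forall>u\<in>T \<union> U. c u = 0" using indT cU by blast
  qed (use T U in simp)
qed

text \<open>A relation of \<open>U\<close> modulo \<open>Ker\<close> becomes, after multiplication
  by some \<open>N\<close>, a relation between \<open>U\<close> and \<open>T\<close>; as
  \<open>N\<close> is not zero, the coefficients on \<open>U\<close> vanish.\<close>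

lemma independent_mod_complement:
  assumes "frag_independent (T \<union> U)" "T \<inter> U = {}" "U \<subseteq> A"
    and "rationalize ` Ker \<subseteq> frag_rat.span (rationalize ` T)"
  shows "independent_mod U"
  unfolding independent_mod_def
proof (intro conjI allI impI ballI)
  have fin: "finite T" "finite U" using assms(1) by (auto simp: frag_independent_def)
  show "finite U" by (rule fin)
  fix c u assume sum: "(\<Sum>u\<in>U. frag_cmul (c u) u) \<in> Ker" and u: "u \<in> U"
  obtain N d where N: "N \<noteq> 0"
    "frag_cmul N (\<Sum>u\<in>U. frag_cmul (c u) u) = (\<Sum>t\<in>T. frag_cmul (d t) t)"
    using frag_eq_combination[OF fin(1)] assms(4) sum by blast
  define e where "e z = (if z \<in> T then - d z else N * c z)" for z
  have "(\<Sum>z\<in>T \<union> U. frag_cmul (e z) z) = (\<Sum>z\<in>T. frag_cmul (e z) z) + (\<Sum>z\<in>U. frag_cmul (e z) z)"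
    using fin assms(2) by (rule sum.union_disjoint)
  also have "(\<Sum>z\<in>T. frag_cmul (e z) z) = - (\<Sum>z\<in>T. frag_cmul (d z) z)"
    unfolding sum_negf[symmetric] by (intro sum.cong) (auto simp: e_def)
  also have "(\<Sum>z\<in>U. frag_cmul (e z) z) = frag_cmul N (\<Sum>u\<in>U. frag_cmul (c u) u)"
    unfolding frag_cmul_sum using assms(2) by (intro sum.cong) (auto simp: e_def)
  finally have "(\<Sum>z\<in>T \<union> U. frag_cmul (e z) z) = 0" by (simp add: N)
  then have "e u = 0" using assms(1) u by (auto simp: frag_independent_def)
  moreover have "u \<notin> T" using u assms(2) by blast
  ultimately show "c u = 0" using N(1) by (simp add: e_def)
qed (rule assms)

text \<open>A basis \<open>T\<close> of \<open>Ker\<close> is extended to a basis \<open>W\<close>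
  of \<open>A\<close>. The image of \<open>W - T\<close> attains the supremum in
  \<open>group_rank\<close>; nothing exceeds it, because the lifts of any independent set remain
  independent together with \<open>T\<close>.\<close>

lemma group_rank_add_Ker: "group_rank G + rational_rank Ker = rational_rank A"
proof -
  have Ker_A: "Ker \<subseteq> A" by (auto simp: Ker_def)
  then have support_Ker: "Poly_Mapping.keys x \<subseteq> S" if "x \<in> Ker" for x using support that by blast
  have emp: "frag_independent {}" by (simp add: frag_independent_def)
  obtain T where T: "T \<subseteq> Ker" "frag_independent T" "card T = rational_rank Ker"
    "rationalize ` Ker \<subseteq> frag_rat.span (rationalize ` T)"
    by (rule frag_basis_extend[of S Ker "{}", OF finite_support support_Ker empty_subsetI emp], assumption, rule that)
  obtain W where W: "T \<subseteq> W" "W \<subseteq> A" "frag_independent W" "card W = rational_rank A"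
    by (rule frag_basis_extend[of S A T, OF finite_support support subset_trans[OF T(1) Ker_A] T(2)], assumption, rule that)
  have finW: "finite W" using W(3) by (simp add: frag_independent_def)
  have "independent_mod (W - T)"
    by (rule independent_mod_complement[OF _ _ _ T(4)]) (use W in \<open>auto simp: Un_absorb1\<close>)
  then have attained: "card W - card T \<in> {card X | X. Z_independent G X}"
    using independent_mod_image[of "W - T"] finW W(1)
    by (metis (mono_tags, lifting) card_Diff_subset finite_subset mem_Collect_eq)
  have bound: "n \<le> card W - card T" if n: "n \<in> {card X | X. Z_independent G X}" for n
  proof -
    obtain X where X: "Z_independent G X" "n = card X" using n by blast
    obtain U where U: "independent_mod U" "card U = card X" using independent_mod_lift[OF X(1)] by blast
    note Un = independent_mod_Un[OF U(1) T(2,1)]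
    have "T \<union> U \<subseteq> A" using U(1) T(1) Ker_A by (auto simp: independent_mod_def)
    then have "card (T \<union> U) \<le> rational_rank A"
      using frag_independent_card_le[OF finite_support _ _ Un(2)] support by simp
    moreover have "card (T \<union> U) = card T + card U"
      using Un T(2) U(1) by (intro card_Un_disjoint) (auto simp: independent_mod_def frag_independent_def)
    ultimately show ?thesis using W(4) U(2) X(2) by simp
  qed
  have "group_rank G = card W - card T"
    unfolding group_rank_def by (rule cSup_eq_maximum[OF attained bound])
  then show ?thesis using W T(3) card_mono[OF finW W(1)] by simp
qed

end

section \<open>The Euler characteristic\<close>

lemma rational_rank_zero: "rational_rank {0} = 0"
  using frag_rat.dim_le_card[of "{0}" "{}"] by (simp add: rational_rank_def)

lemma free_hom:
  assumes "d \<in> hom (free_Abelian_group S) (free_Abelian_group S')"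
  shows "group_hom (free_Abelian_group S) (free_Abelian_group S') d"
  using assms by (simp add: group_hom_def group_hom_axioms_def)

text \<open>The image of \<open>d\<close> is a quotient of its domain by the kernel and, by the
  identity map, a quotient of itself by zero. Both views compute the same \<open>group_rank\<close>,
  which is then eliminated.\<close>

lemma rational_rank_image_kernel:
  fixes S :: "'b set" and S' :: "'c set"
  assumes fin: "finite S" "finite S'" and d: "d \<in> hom (free_Abelian_group S) (free_Abelian_group S')"
  shows "rational_rank (d ` carrier (free_Abelian_group S)) +
    rational_rank (kernel (free_Abelian_group S) (free_Abelian_group S') d) = card S"
proof -
  let ?F = "free_Abelian_group S" and ?F' = "free_Abelian_group S'"
  interpret d: group_hom ?F ?F' d by (rule free_hom[OF d])
  let ?I = "d ` carrier ?F"
  let ?G = "subgroup_generated ?F' ?I"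
  have I: "subgroup ?I ?F'" by (rule d.img_is_subgroup)
  have carrier: "carrier ?G = ?I" using I by (rule subgroup.carrier_subgroup_generated_subgroup)
  have comm: "comm_group ?G"
    by (rule d.H.abelian_subgroup_generated) (rule abelian_free_Abelian_group)
  have I_diff: "x - y \<in> ?I" if xy: "x \<in> ?I" "y \<in> ?I" for x y
  proof -
    obtain a b where ab: "Poly_Mapping.keys a \<subseteq> S" "Poly_Mapping.keys b \<subseteq> S" "x = d a" "y = d b"
      using xy by auto
    then have "x - y = d (a - b)" using hom_frag_diff[OF d] by simp
    moreover have "Poly_Mapping.keys (a - b) \<subseteq> S" using ab keys_diff[of a b] by blast
    ultimately show ?thesis by auto
  qed
  interpret dom: frag_quotient ?G "carrier ?F" S d
  proof (intro frag_quotient.intro comm frag_quotient_axioms.intro)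
    fix x y assume "x \<in> carrier ?F" "y \<in> carrier ?F"
    then show "x - y \<in> carrier ?F" "d (x + y) = d x \<otimes>\<^bsub>?G\<^esub> d y"
      using keys_diff[of x y] hom_frag_add[OF d, of x y] by auto
  qed (use fin carrier in auto)
  interpret im: frag_quotient ?G ?I S' "\<lambda>x. x"
  proof (intro frag_quotient.intro comm frag_quotient_axioms.intro)
    show "0 \<in> ?I" using subgroup.one_closed[OF I] by simp
    fix x assume "x \<in> ?I"
    then have "x \<in> carrier ?F'" using subgroup.subset[OF I] by blast
    then show "Poly_Mapping.keys x \<subseteq> S'" by simp
  qed (use fin carrier I_diff in auto)
  have "dom.Ker = kernel ?F ?F' d" by (auto simp: dom.Ker_def kernel_def)
  moreover have "im.Ker = {0}" using im.zero_mem by (auto simp: im.Ker_def)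
  ultimately show ?thesis
    using dom.group_rank_add_Ker im.group_rank_add_Ker rational_rank_free[OF fin(1)]
    by (simp add: rational_rank_zero)
qed

text \<open>The coset map followed by an isomorphism to \<open>H\<close> is a surjection from the
  cycles whose kernel consists of the boundaries.\<close>

lemma group_rank_homology:
  fixes S :: "'b set" and S' :: "'c set" and H :: "'a monoid"
  assumes fin: "finite S"
    and d: "d \<in> hom (free_Abelian_group S) (free_Abelian_group S')"
    and e: "e \<in> hom (free_Abelian_group S') (free_Abelian_group S)"
    and de: "\<And>x. x \<in> carrier (free_Abelian_group S') \<Longrightarrow> d (e x) = 0"
    and H: "comm_group H"
    and iso: "subgroup_generated (free_Abelian_group S) (kernel (free_Abelian_group S) (free_Abelian_group S') d)
      Mod (e ` carrier (free_Abelian_group S')) \<cong> H"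
  shows "group_rank H + rational_rank (e ` carrier (free_Abelian_group S')) =
    rational_rank (kernel (free_Abelian_group S) (free_Abelian_group S') d)"
proof -
  let ?F = "free_Abelian_group S" and ?F' = "free_Abelian_group S'"
  interpret d: group_hom ?F ?F' d by (rule free_hom[OF d])
  interpret e: group_hom ?F' ?F e by (rule free_hom[OF e])
  let ?K = "kernel ?F ?F' d" and ?I = "e ` carrier ?F'"
  let ?G = "subgroup_generated ?F ?K"
  have K: "subgroup ?K ?F" by (rule d.subgroup_kernel)
  have carrier: "carrier ?G = ?K" using K by (rule subgroup.carrier_subgroup_generated_subgroup)
  interpret G: comm_group ?G
    by (rule d.G.abelian_subgroup_generated) (rule abelian_free_Abelian_group)
  have "e x \<in> ?K" if "x \<in> carrier ?F'" for x
    using de[OF that] e.hom_closed[OF that] by (simp add: kernel_def)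
  then have IK: "?I \<subseteq> ?K" by blast
  have I: "subgroup ?I ?G"
    by (rule d.G.subgroup_of_subgroup_generated[OF IK e.img_is_subgroup])
  then interpret I: normal ?I ?G by (rule G.subgroup_imp_normal)
  obtain h where h: "h \<in> iso (?G Mod ?I) H" using iso by (auto simp: is_iso_def)
  interpret h: group_hom "?G Mod ?I" H h
    using h I.factorgroup_is_group H by (simp add: group_hom_def group_hom_axioms_def comm_group.axioms iso_def)
  have hbij: "bij_betw h (carrier (?G Mod ?I)) (carrier H)" using h by (simp add: iso_def)
  define \<pi> where "\<pi> x = h (?I #>\<^bsub>?G\<^esub> x)" for x
  have coset: "?I #>\<^bsub>?G\<^esub> x \<in> carrier (?G Mod ?I)" if "x \<in> ?K" for x
    using that carrier by (auto simp: carrier_FactGroup)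
  interpret q: frag_quotient H ?K S \<pi>
  proof (intro frag_quotient.intro H frag_quotient_axioms.intro fin)
    show "0 \<in> ?K" using subgroup.one_closed[OF K] by simp
    show "\<pi> ` ?K = carrier H"
      using bij_betw_imp_surj_on[OF hbij] carrier
      by (simp add: \<pi>_def carrier_FactGroup image_image)
    fix x assume x: "x \<in> ?K"
    then show "Poly_Mapping.keys x \<subseteq> S" by (auto simp: kernel_def)
    fix y assume y: "y \<in> ?K"
    show "x - y \<in> ?K"
      using x y hom_frag_diff[OF d, of x y] keys_diff[of x y] by (auto simp: kernel_def)
    have "?I #>\<^bsub>?G\<^esub> (x + y) = (?I #>\<^bsub>?G\<^esub> x) \<otimes>\<^bsub>?G Mod ?I\<^esub> (?I #>\<^bsub>?G\<^esub> y)"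
      using hom_mult[OF I.r_coset_hom_Mod, of x y] x y carrier by simp
    then show "\<pi> (x + y) = \<pi> x \<otimes>\<^bsub>H\<^esub> \<pi> y"
      unfolding \<pi>_def h.hom_mult[OF coset[OF x] coset[OF y], symmetric] by (rule arg_cong)
  qed
  have "q.Ker = ?I"
  proof -
    have "\<pi> x = \<one>\<^bsub>H\<^esub> \<longleftrightarrow> x \<in> ?I" if x: "x \<in> ?K" for x
    proof -
      have "\<pi> x = \<one>\<^bsub>H\<^esub> \<longleftrightarrow> h (?I #>\<^bsub>?G\<^esub> x) = h (\<one>\<^bsub>?G Mod ?I\<^esub>)"
        by (simp only: \<pi>_def h.hom_one)
      also have "\<dots> \<longleftrightarrow> ?I #>\<^bsub>?G\<^esub> x = \<one>\<^bsub>?G Mod ?I\<^esub>"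
        using bij_betw_imp_inj_on[OF hbij] coset[OF x] h.G.one_closed by (metis inj_onD)
      also have "\<dots> \<longleftrightarrow> x \<in> ?I"
        using G.coset_join1[of ?I x] G.coset_join2[of x ?I] I x carrier by auto
      finally show ?thesis .
    qed
    then show ?thesis using IK by (auto simp: q.Ker_def)
  qed
  then show ?thesis using q.group_rank_add_Ker by simp
qed

lemma A_pow_add: "A_pow (i + j) = A_pow i * A_pow j"
  by (simp add: A_pow_def mult_single)

lemma A_pow_0: "A_pow 0 = 1"
  by (simp add: A_pow_def single_one)

lemma A_pow_sum: "finite I \<Longrightarrow> A_pow (\<Sum>i\<in>I. f i) = (\<Prod>i\<in>I. A_pow (f i))"
  by (induction I rule: finite_induct) (simp_all add: A_pow_add A_pow_0)

lemma UNIV_w_basis: "UNIV = {Wp, Wm}"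
  using w_basis.exhaust by auto

lemma qdim_eq_sum:
  assumes "finite J" "\<And>j. j \<notin> J \<Longrightarrow> group_rank (G j) = 0"
  shows "qdim G = (\<Sum>j\<in>J. of_nat (group_rank (G j)) * A_pow j)"
  unfolding qdim_def
proof (rule sum.mono_neutral_left[OF assms(1)])
  show "{j. group_rank (G j) \<noteq> 0} \<subseteq> J" using assms(2) by (metis (mono_tags, lifting) mem_Collect_eq subsetI)
qed auto

section \<open>State sums over the chain groups\<close>

context colored_diagram
begin

lemma finite_states: "finite (states D)"
  using finite_crossings by (simp add: states_def)

lemma finite_circles: "finite (circles D s)"
  using finite_arcs by (simp add: circles_eq)

lemma finite_enhanced_states: "finite (enhanced_states D)"
  unfolding enhanced_states_def
  by (intro finite_SigmaI finite_states finite_PiE finite_circles) (simp add: UNIV_w_basis)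

lemma finite_bracket_basis: "finite (bracket_basis D i j)"
  by (rule finite_subset[OF _ finite_enhanced_states]) (auto simp: bracket_basis_def)

text \<open>Expanding a product of one factor \<open>A_pow 2 + A_pow (- 2)\<close> per circle, the
  graded dimension of W, yields one term for each labelling.\<close>

lemma state_generating_function:
  "(\<Sum>v\<in>circles D s \<rightarrow>\<^sub>E UNIV. A_pow (state_deg D (s, v))) =
    A_pow (num_A D s - num_B s) * (A_pow 2 + A_pow (- 2)) ^ card (circles D s)"
proof -
  have "(\<Sum>v\<in>circles D s \<rightarrow>\<^sub>E UNIV. A_pow (state_deg D (s, v))) =
      (\<Sum>v\<in>circles D s \<rightarrow>\<^sub>E UNIV. A_pow (num_A D s - num_B s) * (\<Prod>C\<in>circles D s. A_pow (w_deg (v C))))"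
    by (intro sum.cong refl)
      (simp add: A_pow_sum[OF finite_circles, symmetric] A_pow_add[symmetric] algebra_simps)
  also have "\<dots> = A_pow (num_A D s - num_B s) *
      (\<Sum>v\<in>circles D s \<rightarrow>\<^sub>E UNIV. \<Prod>C\<in>circles D s. A_pow (w_deg (v C)))"
    by (rule sum_distrib_left[symmetric])
  also have "(\<Sum>v\<in>circles D s \<rightarrow>\<^sub>E UNIV. \<Prod>C\<in>circles D s. A_pow (w_deg (v C))) =
      (\<Prod>C\<in>circles D s. \<Sum>w\<in>UNIV. A_pow (w_deg w))"
    by (rule prod_sum_PiE[symmetric]) (auto simp: finite_circles UNIV_w_basis)
  also have "\<dots> = (A_pow 2 + A_pow (- 2)) ^ card (circles D s)"
    by (simp add: UNIV_w_basis)
  finally show ?thesis .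
qed

lemma signed_state_sum:
  assumes "arcs D \<noteq> {}"
  shows "(\<Sum>(s, v)\<in>enhanced_states D. (- 1) ^ state_parity D s * A_pow (state_deg D (s, v))) =
    (- A_pow 2 - A_pow (- 2)) * kauffman_bracket D"
proof -
  let ?X = "- A_pow 2 - A_pow (- 2)"
  have "(\<Sum>(s, v)\<in>enhanced_states D. (- 1) ^ state_parity D s * A_pow (state_deg D (s, v))) =
      (\<Sum>s\<in>states D. \<Sum>v\<in>circles D s \<rightarrow>\<^sub>E UNIV. (- 1) ^ state_parity D s * A_pow (state_deg D (s, v)))"
    unfolding enhanced_states_def
    by (rule sum.Sigma[symmetric]) (auto simp: finite_states UNIV_w_basis intro!: finite_PiE finite_circles)
  also have "\<dots> = (\<Sum>s\<in>states D. ?X * (A_pow (num_A D s - num_B s) * ?X ^ (card (circles D s) - 1)))"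
  proof (rule sum.cong)
    fix s assume "s \<in> states D"
    then have s: "s \<subseteq> crossings D" by (simp add: states_def)
    \<comment> \<open>The exponent in the bracket is a truncated difference; the factor in front
      supplies the missing power only if there is at least one circle.\<close>
    have "circles D s \<noteq> {}" using assms by (simp add: circles_eq)
    then have "card (circles D s) \<noteq> 0" using finite_circles by simp
    then have pow: "?X * ?X ^ (card (circles D s) - 1) = ?X ^ card (circles D s)"
      by (metis power_eq_if)
    have sign: "(- 1) ^ state_parity D s = ((- 1) ^ card (circles D s) :: laurent)"
      using circles_parity[OF s] by (simp add: state_parity_def minus_one_power_iff)
    have "?X = (- 1) * (A_pow 2 + A_pow (- 2))" by simp
    then have "(- 1) ^ state_parity D s * (A_pow 2 + A_pow (- 2)) ^ card (circles D s) = ?X ^ card (circles D s)"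
      by (simp only: sign power_mult_distrib)
    then show "(\<Sum>v\<in>circles D s \<rightarrow>\<^sub>E UNIV. (- 1) ^ state_parity D s * A_pow (state_deg D (s, v))) =
        ?X * (A_pow (num_A D s - num_B s) * ?X ^ (card (circles D s) - 1))"
      unfolding sum_distrib_left[symmetric] state_generating_function
      by (subst mult.left_commute) (simp only: \<open>(- 1) ^ state_parity D s * _ ^ _ = _\<close> mult.left_commute[of ?X] pow)
  qed simp
  also have "\<dots> = ?X * kauffman_bracket D"
    unfolding kauffman_bracket_def by (rule sum_distrib_left[symmetric])
  finally show ?thesis .
qed

lemma group_rank_framed_homology:
  fixes j :: int
  defines "F \<equiv> \<lambda>i. free_Abelian_group (bracket_basis D i j)"
  assumes "linear_order_on (crossings D) r" "H \<in> framed_homology D r" "i < 2"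
  shows "group_rank (H i j) + rational_rank (bracket_bdry D r (1 - i) ` carrier (F (1 - i))) =
    rational_rank (kernel (F i) (F (1 - i)) (bracket_bdry D r i))"
  unfolding F_def
proof (rule group_rank_homology)
  let ?F = "\<lambda>i. free_Abelian_group (bracket_basis D i j)" and ?d = "bracket_bdry D r"
  \<comment> \<open>Truncated subtraction: for natural numbers this holds only for
    \<open>i < 2\<close>.\<close>
  have i: "1 - (1 - i) = i" using assms(4) by auto
  show "?d (1 - i) \<in> hom (?F (1 - i)) (?F i)" using bracket_bdry_hom[of r "1 - i" j] i by simp
  show "?d i (?d (1 - i) x) = 0" if "x \<in> carrier (?F (1 - i))" for x
    using bracket_bdry_bdry[OF assms(2) that] i by simp
  show "comm_group (H i j)" using assms(3,4) by (simp add: framed_homology_def)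
  show "subgroup_generated (?F i) (kernel (?F i) (?F (1 - i)) (?d i)) Mod ?d (1 - i) ` carrier (?F (1 - i)) \<cong> H i j"
    using assms(3,4) by (simp add: framed_homology_def homology_def bracket_complex_def)
qed (rule finite_bracket_basis bracket_bdry_hom)+

lemma bracket_bdry_rank_nullity:
  fixes j :: int
  defines "F \<equiv> \<lambda>i. free_Abelian_group (bracket_basis D i j)"
  shows "rational_rank (bracket_bdry D r i ` carrier (F i)) +
    rational_rank (kernel (F i) (F (1 - i)) (bracket_bdry D r i)) = card (bracket_basis D i j)"
  unfolding F_def
  by (rule rational_rank_image_kernel[OF finite_bracket_basis finite_bracket_basis bracket_bdry_hom])

text \<open>The image of a boundary is divided out in the homology of its target and is
  complementary in rank to the kernel in its source. Source and target have opposite indices, so the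
  ranks of both images cancel.\<close>

lemma group_rank_diff:
  assumes "linear_order_on (crossings D) r" "H \<in> framed_homology D r"
  shows "int (group_rank (H 0 j)) - int (group_rank (H 1 j)) =
    int (card (bracket_basis D 0 j)) - int (card (bracket_basis D 1 j))"
  using group_rank_framed_homology[OF assms, of 0 j] group_rank_framed_homology[OF assms, of 1 j]
    bracket_bdry_rank_nullity[of r 0 j] bracket_bdry_rank_nullity[of r 1 j]
  by simp

lemma euler_char_framed_homology:
  assumes "linear_order_on (crossings D) r" "H \<in> framed_homology D r" "arcs D \<noteq> {}"
  shows "euler_char H = (- A_pow 2 - A_pow (- 2)) * kauffman_bracket D"
proof -
  define J where "J = state_deg D ` enhanced_states D"
  have J: "finite J" using finite_enhanced_states by (simp add: J_def)
  have "bracket_basis D i j = {}" if "j \<notin> J" for i j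
    using that by (auto simp: bracket_basis_def J_def simp del: state_deg.simps)
  \<comment> \<open>\<open>qdim\<close> sums over all degrees of nonzero rank; these lie in the
    finite set of degrees of basis elements.\<close>
  then have zero: "group_rank (H i j) = 0" if "i < 2" "j \<notin> J" for i j
    using group_rank_framed_homology[OF assms(1,2) that(1), of j] bracket_bdry_rank_nullity[of r i j] that(2)
    by simp
  have qdim: "qdim (H i) = (\<Sum>j\<in>J. of_nat (group_rank (H i j)) * A_pow j)" if "i < 2" for i
    by (rule qdim_eq_sum[OF J]) (rule zero[OF that])
  have euler: "euler_char H =
      (\<Sum>j\<in>J. of_int (int (group_rank (H 0 j)) - int (group_rank (H 1 j))) * A_pow j)"
    unfolding euler_char_def
    by (simp add: qdim[of 0, simplified] qdim[of 1, simplified] sum_subtractf left_diff_distrib)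
  \<comment> \<open>Each basis element contributes the sign of its index, 1 in index 0 and -1 in
    index 1.\<close>
  also have "\<dots> = (\<Sum>j\<in>J. \<Sum>(s, v)\<in>{b \<in> enhanced_states D. state_deg D b = j}.
      (- 1) ^ state_parity D s * A_pow (state_deg D (s, v)))"
  proof (rule sum.cong)
    fix j assume "j \<in> J"
    let ?E = "{b \<in> enhanced_states D. state_deg D b = j}"
    have E: "?E = bracket_basis D 0 j \<union> bracket_basis D 1 j" "bracket_basis D 0 j \<inter> bracket_basis D 1 j = {}"
      by (auto simp: bracket_basis_def)
    have "(\<Sum>(s, v)\<in>?E. (- 1) ^ state_parity D s * A_pow (state_deg D (s, v))) =
        (\<Sum>(s, v)\<in>bracket_basis D 0 j. (- 1) ^ state_parity D s * A_pow (state_deg D (s, v))) +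
        (\<Sum>(s, v)\<in>bracket_basis D 1 j. (- 1) ^ state_parity D s * A_pow (state_deg D (s, v)))"
      unfolding E(1) by (rule sum.union_disjoint[OF finite_bracket_basis finite_bracket_basis E(2)])
    also have "(\<Sum>(s, v)\<in>bracket_basis D 0 j. (- 1) ^ state_parity D s * A_pow (state_deg D (s, v))) =
        (\<Sum>b\<in>bracket_basis D 0 j. A_pow j)"
      by (rule sum.cong) (auto simp: bracket_basis_def state_parity_def)
    also have "(\<Sum>(s, v)\<in>bracket_basis D 1 j. (- 1) ^ state_parity D s * A_pow (state_deg D (s, v))) =
        (\<Sum>b\<in>bracket_basis D 1 j. - A_pow j)"
      by (rule sum.cong) (auto simp: bracket_basis_def state_parity_def)
    finally show "of_int (int (group_rank (H 0 j)) - int (group_rank (H 1 j))) * A_pow j =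
        (\<Sum>(s, v)\<in>?E. (- 1) ^ state_parity D s * A_pow (state_deg D (s, v)))"
      unfolding group_rank_diff[OF assms(1,2)] by (simp add: left_diff_distrib)
  qed simp
  also have "\<dots> = (\<Sum>(s, v)\<in>enhanced_states D. (- 1) ^ state_parity D s * A_pow (state_deg D (s, v)))"
    by (rule sum.group[OF finite_enhanced_states J]) (simp add: J_def)
  also have "\<dots> = (- A_pow 2 - A_pow (- 2)) * kauffman_bracket D"
    by (rule signed_state_sum[OF assms(3)])
  finally show ?thesis .
qed

end

text \<open>Without arcs there are no crossings either, so the projection would have no connected
  component and be empty, although the isotopy keeps the number of link components. This secures a
  circle in every state.\<close>

lemma diagram_of_arcs_nonempty:
  assumes "diagram_of D L" "L \<noteq> {}"
  shows "arcs D \<noteq> {}"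
proof
  assume empty: "arcs D = {}"
  obtain n g where PD: "PD_code D" and has: "has_diagram n g D" and iso: "framed_isotopic L (blackboard n g)"
    using assms(1) by (auto simp: diagram_of_def planar_diagram_def)
  obtain m G F where tr: "framed_trace m (G (0::real)) (F (0::real)) = L" "framed_trace m (G 1) (F 1) = blackboard n g"
    using iso unfolding framed_isotopic_def by blast
  have "m \<noteq> 0" using tr(1) assms(2) by (auto simp: framed_trace_def)
  then have "blackboard n g \<noteq> {}" using tr(2) by (auto simp: framed_trace_def)
  then have n: "n \<noteq> 0" by (auto simp: blackboard_def framed_trace_def)
  have crossings: "crossings D = {}"
  proof (rule ccontr)
    assume "crossings D \<noteq> {}"
    then obtain c where "(c, 0) \<in> crossing_ends D" by (auto simp: crossing_ends_def)
    then show False using PD empty by (auto simp: PD_code_def)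
  qed
  let ?P = "(\<lambda>(j, t). plane_curve g j t) ` ({..<n} \<times> {0..<1})"
  obtain un :: "nat \<Rightarrow> nat \<times> real" and \<alpha> :: "nat \<Rightarrow> complex set" where
    "bij_betw \<alpha> (arcs D) (components (?P - (\<lambda>c. (\<lambda>(j, t). plane_curve g j t) (un c)) ` crossings D))"
    using has unfolding has_diagram_def Let_def by (elim conjE exE) (rule that)
  then have "components ?P = {}" using empty crossings by (simp add: bij_betw_def)
  then have "?P = {}" by (simp add: components_eq_empty)
  moreover have "(0, 0) \<in> {..<n} \<times> {0..<1::real}" using n by simp
  ultimately show False by blast
qed

theorem theorem4p2:
  fixes L :: "(space4 \<times> space4) set" and D :: diagram and r :: "(nat \<times> nat) set"
    and H :: "'a graded_pair"
  assumes "framed_link L" and "L \<noteq> {}"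
    and "diagram_of D L" and "linear_order_on (crossings D) r"
    and "H \<in> framed_homology D r"
  shows "euler_char H = (- A_pow 2 - A_pow (-2)) * kauffman_bracket D"
proof -
  have planar: "planar_diagram D" using assms(3) by (simp add: diagram_of_def)
  obtain \<sigma> :: "nat \<times> nat \<Rightarrow> bool"
    where "\<And>c k. (c, k) \<in> crossing_ends D \<Longrightarrow> \<sigma> (c, (k + 3) mod 4) \<longleftrightarrow> \<not> \<sigma> (c, k)"
      and "\<And>b. b \<in> crossing_ends D \<Longrightarrow> \<sigma> (other_end D b) \<longleftrightarrow> \<not> \<sigma> b"
    using source_sink_coloring[OF planar] by blast
  then interpret colored_diagram D \<sigma>
    using planar by unfold_locales (auto simp: planar_diagram_def)
  show ?thesis
    using assms(4,5) diagram_of_arcs_nonempty[OF assms(3,2)] by (rule euler_char_framed_homology)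
qed

end
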